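(* Fix $\gamma\in\mathcal M_{\rm ac}$ and let $F^{(\gamma)}(t)=F^{(\gamma)}_t$, $t\ge0$, be the solution of the heat equation with Robin boundary conditions $$\partial_tu=\Delta u,\quad \nabla u(t,0)=A^{-1}[u(t,0)-\alpha],\quad \nabla u(t,1)=B^{-1}[\beta-u(t,1)],$$ with initial condition $F^{(\gamma)}(0,\cdot)=F(\gamma)(\cdot)$. Define $$v^{(\gamma)}(t)=F^{(\gamma)}(t)+F^{(\gamma)}(t)[1-F^{(\gamma)}(t)]\,\frac{\Delta F^{(\gamma)}(t)}{(\nabla F^{(\gamma)}(t))^2},\qquad t\ge0.$$ Then $v^{(\gamma)}(0,\cdot)=\gamma(\cdot)$, $v^{(\gamma)}$ is smooth in $(0,\infty)\times[0,1]$, and the pair $(v,F)=(v^{(\gamma)},F^{(\gamma)})$ satisfies in $(0,\infty)\times[0,1]$ both systems $$\left\{\begin{aligned}&\Delta F_t=(v_t-F_t)\frac{(\nabla F_t)^2}{F_t(1-F_t)},\qquad (t,x)\in(0,\infty)\times(0,1),\\&\nabla F_t(0)=A^{-1}[F_t(0)-\alpha],\quad\nabla F_t(1)=B^{-1}[\beta-F_t(1)],\end{aligned}\right.$$ and, with $R_t=\log[F_t/(1-F_t)]$, $$\left\{\begin{aligned}&\partial_tv=\Delta v-2\nabla(\sigma(v)\nabla R),\qquad (t,x)\in(0,\infty)\times(0,1),\\&\nabla v_t(1)-2\sigma(v_t(1))\nabla R_t(1)=\mathfrak p_{1-\beta,B}(v_t(1),R_t(1)),\\&\nabla v_t(0)-2\sigma(v_t(0))\nabla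 R_t(0)=-\mathfrak p_{1-\alpha,A}(v_t(0),R_t(0)),\\&v(0,\cdot)=\gamma.\end{aligned}\right.$$
   Context: Fix $0<\alpha<\beta<1$, $A>0$, $B>0$. $\nabla$, $\Delta$ are the first and second derivatives in the space variable $x\in[0,1]$; $w_t=w(t,\cdot)$; $\sigma(a)=a(1-a)$; and for $0<\varrho<1$, $D>0$, $$\mathfrak p_{\varrho,D}(a,M)=\frac1D\big\{[1-a]\varrho e^M-a[1-\varrho]e^{-M}\big\}.$$ $\mathcal M_{\rm ac}$ is the set of measurable densities $\gamma:[0,1]\to[0,1]$. $\mathcal F=\{F\in C^1([0,1]):\alpha<F(x)<\beta,\ \nabla F(x)>0\ \forall x\in[0,1]\}$. $F(\gamma)$ is the unique element $F$ of $\mathcal F$ solving $$F(x)=\alpha+(\beta-\alpha)\frac{A+\int_0^x\exp\{\int_0^y\mathcal R_\gamma(F;z)dz\}dy}{A+\int_0^1\exp\{\int_0^y\mathcal R_\gamma(F;z)dz\}dy+B\exp\{\int_0^1\mathcal R_\gamma(F;y)dy\}},\quad \mathcal R_\gamma(F;x)=[\gamma(x)-F(x)]\frac{\nabla F(x)}{F(x)[1-F(x)]};$$ equivalently $\Delta F=(\gamma-F)(\nabla F)^2/[F(1-F)]$ a.e. in $(0,1)$ with $\nabla F(0)=A^{-1}[F(0)-\alpha]$, $\nabla F(1)=B^{-1}[\beta-F(1)]$. (At $t=0$, $\Delta F^{(\gamma)}(0)=\Delta F(\gamma)$ exists almost everywhere and identities are understood a.e.) The solution of the heat equation with initial condition $\phi$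 is the unique generalized solution: the $u$ with $u\in L^2([0,T];\mathcal H^1)$ for every $T>0$, $\mathcal H^1=H^1([0,1])$, such that for all $0<t\le T$ and all $H\in C^{1,2}([0,T]\times[0,1])$ $$\begin{aligned}&\int_0^1u_tH_t\,dx-\int_0^1\phi H_0\,dx-\int_0^t\!\!ds\int_0^1u_s\partial_sH_s\,dx\\&=-\int_0^t\!\!ds\int_0^1\nabla u_s\nabla H_s\,dx-\int_0^t\Big\{\frac1B[u_s(1)-\beta]H_s(1)+\frac1A[u_s(0)-\alpha]H_s(0)\Big\}ds;\end{aligned}$$ it is smooth in $(0,\infty)\times[0,1]$. *)

theory Defs
  imports "HOL-Analysis.Analysis"
begin

text \<open>
  A function on \<open>[0,1]\<close> (resp. \<open>[0,T] \<times> [0,1]\<close>) is represented by a function on the whole line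
  (resp. by \<open>w :: real \<Rightarrow> real \<Rightarrow> real\<close>, time first), whose values outside the domain are never
  used: derivatives are taken within the domain and are one-sided at its end points.
\<close>

definition grad :: "(real \<Rightarrow> real) \<Rightarrow> real \<Rightarrow> real"
  where "grad f x = vector_derivative f (at x within {0..1})"

definition lap :: "(real \<Rightarrow> real) \<Rightarrow> real \<Rightarrow> real"
  where "lap f = grad (grad f)"

definition time_deriv :: "real set \<Rightarrow> (real \<Rightarrow> real \<Rightarrow> real) \<Rightarrow> real \<Rightarrow> real \<Rightarrow> real"
  where "time_deriv S w t x = vector_derivative (\<lambda>s. w s x) (at t within S)"

definition sigma :: "real \<Rightarrow> real"
  where "sigma a = a * (1 - a)"

definition pfun :: "real \<Rightarrow> real \<Rightarrow> real \<Rightarrow> real \<Rightarrow> real"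
  where "pfun \<rho> D a M = (1 / D) * ((1 - a) * \<rho> * exp M - a * (1 - \<rho>) * exp (- M))"

definition M_ac :: "(real \<Rightarrow> real) set"
  where "M_ac = {\<gamma>. \<gamma> \<in> borel_measurable (lebesgue_on {0..1}) \<and> (\<forall>x\<in>{0..1}. \<gamma> x \<in> {0..1})}"

definition F_class :: "real \<Rightarrow> real \<Rightarrow> (real \<Rightarrow> real) set"
  where "F_class \<alpha> \<beta> = {F. (\<forall>x\<in>{0..1}. F differentiable (at x within {0..1})) \<and>
    continuous_on {0..1} (grad F) \<and> (\<forall>x\<in>{0..1}. \<alpha> < F x \<and> F x < \<beta> \<and> grad F x > 0)}"

definition Rfun :: "(real \<Rightarrow> real) \<Rightarrow> (real \<Rightarrow> real) \<Rightarrow> real \<Rightarrow> real"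
  where "Rfun \<gamma> F x = (\<gamma> x - F x) * (grad F x / (F x * (1 - F x)))"

text \<open>\<open>is_F \<alpha> \<beta> A B \<gamma> F\<close> says that \<open>F\<close> is (on \<open>[0,1]\<close>) the function \<open>F(\<gamma>)\<close>.\<close>

definition is_F :: "real \<Rightarrow> real \<Rightarrow> real \<Rightarrow> real \<Rightarrow> (real \<Rightarrow> real) \<Rightarrow> (real \<Rightarrow> real) \<Rightarrow> bool"
  where "is_F \<alpha> \<beta> A B \<gamma> F \<longleftrightarrow> F \<in> F_class \<alpha> \<beta> \<and>
    (let I = (\<lambda>y. LINT z:{0..y}|lebesgue. Rfun \<gamma> F z);
         J = (\<lambda>x. LINT y:{0..x}|lebesgue. exp (I y))
     in \<forall>x\<in>{0..1}. F x = \<alpha> + (\<beta> - \<alpha>) * ((A + J x) / (A + J 1 + B * exp (I 1))))"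

text \<open>\<open>f \<in> H\<^sup>1([0,1])\<close> with weak derivative \<open>g\<close>.\<close>

definition H1_weak_deriv :: "(real \<Rightarrow> real) \<Rightarrow> (real \<Rightarrow> real) \<Rightarrow> bool"
  where "H1_weak_deriv f g \<longleftrightarrow>
    f \<in> borel_measurable (lebesgue_on {0..1}) \<and> g \<in> borel_measurable (lebesgue_on {0..1}) \<and>
    set_integrable lebesgue {0..1} (\<lambda>x. (f x)\<^sup>2) \<and> set_integrable lebesgue {0..1} (\<lambda>x. (g x)\<^sup>2) \<and>
    (\<forall>\<phi> a b. 0 < a \<longrightarrow> b < 1 \<longrightarrow> (\<forall>x. x \<notin> {a..b} \<longrightarrow> \<phi> x = 0) \<longrightarrow> \<phi> C1_differentiable_on UNIV \<longrightarrow>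
      (LINT x:{0..1}|lebesgue. f x * deriv \<phi> x) = - (LINT x:{0..1}|lebesgue. g x * \<phi> x))"

text \<open>\<open>u \<in> L\<^sup>2([0,T]; H\<^sup>1)\<close> with spatial weak derivative \<open>g\<close>; the integral is the square of the norm.\<close>

definition L2_H1 :: "real \<Rightarrow> (real \<Rightarrow> real \<Rightarrow> real) \<Rightarrow> (real \<Rightarrow> real \<Rightarrow> real) \<Rightarrow> bool"
  where "L2_H1 T u g \<longleftrightarrow>
    set_borel_measurable lebesgue ({0..T} \<times> {0..1}) (\<lambda>(t, x). u t x) \<and>
    set_borel_measurable lebesgue ({0..T} \<times> {0..1}) (\<lambda>(t, x). g t x) \<and>
    (AE t in lebesgue_on {0..T}. H1_weak_deriv (u t) (g t)) \<and>
    set_integrable lebesgue ({0..T} \<times> {0..1}) (\<lambda>(t, x). (u t x)\<^sup>2 + (g t x)\<^sup>2)"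

definition C12 :: "real \<Rightarrow> (real \<Rightarrow> real \<Rightarrow> real) \<Rightarrow> bool"
  where "C12 T H \<longleftrightarrow>
    (\<forall>t\<in>{0..T}. \<forall>x\<in>{0..1}.
      (\<lambda>s. H s x) differentiable (at t within {0..T}) \<and>
      H t differentiable (at x within {0..1}) \<and>
      grad (H t) differentiable (at x within {0..1})) \<and>
    continuous_on ({0..T} \<times> {0..1}) (\<lambda>(t, x). H t x) \<and>
    continuous_on ({0..T} \<times> {0..1}) (\<lambda>(t, x). time_deriv {0..T} H t x) \<and>
    continuous_on ({0..T} \<times> {0..1}) (\<lambda>(t, x). grad (H t) x) \<and>
    continuous_on ({0..T} \<times> {0..1}) (\<lambda>(t, x). lap (H t) x)"

definition weak_heat_identity ::
  "real \<Rightarrow> real \<Rightarrow> real \<Rightarrow> real \<Rightarrow> (real \<Rightarrow> real) \<Rightarrow> (real \<Rightarrow> real \<Rightarrow> real) \<Rightarrow> (real \<Rightarrow> real \<Rightarrow> real) \<Rightarrow> bool"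
  where "weak_heat_identity \<alpha> \<beta> A B \<phi> u g \<longleftrightarrow>
    (\<forall>T t H. 0 < t \<longrightarrow> t \<le> T \<longrightarrow> C12 T H \<longrightarrow>
      (LINT x:{0..1}|lebesgue. u t x * H t x) - (LINT x:{0..1}|lebesgue. \<phi> x * H 0 x)
        - (LINT s:{0..t}|lebesgue. (LINT x:{0..1}|lebesgue. u s x * time_deriv {0..T} H s x))
      = - (LINT s:{0..t}|lebesgue. (LINT x:{0..1}|lebesgue. g s x * grad (H s) x))
        - (LINT s:{0..t}|lebesgue. (1 / B) * (u s 1 - \<beta>) * H s 1 + (1 / A) * (u s 0 - \<alpha>) * H s 0))"

text \<open>
  The solution of the heat equation with initial condition \<open>\<phi>\<close>. The generalized solution is an
  equivalence class modulo null sets; \<open>u\<close> is its version that is continuous on \<open>(0,\<infinity>) \<times> [0,1]\<close>, so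
  that \<open>u s 0\<close> and \<open>u s 1\<close> are the boundary traces. Continuity as \<open>t \<rightarrow> 0\<close> is not assumed.
\<close>

definition heat_solution ::
  "real \<Rightarrow> real \<Rightarrow> real \<Rightarrow> real \<Rightarrow> (real \<Rightarrow> real) \<Rightarrow> (real \<Rightarrow> real \<Rightarrow> real) \<Rightarrow> bool"
  where "heat_solution \<alpha> \<beta> A B \<phi> u \<longleftrightarrow>
    (\<exists>g. (\<forall>T>0. L2_H1 T u g) \<and> weak_heat_identity \<alpha> \<beta> A B \<phi> u g) \<and>
    continuous_on ({0<..} \<times> {0..1}) (\<lambda>(t, x). u t x) \<and> (\<forall>x\<in>{0..1}. u 0 x = \<phi> x)"

text \<open>
  \<open>C\<^sup>k\<close> and \<open>C\<^sup>\<infinity>\<close> on \<open>(0,\<infinity>) \<times> [0,1]\<close>, up to the boundary: all mixed partial derivatives up to order \<open>k\<close>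
  (resp. of every order) exist and are continuous there.
\<close>

primrec Ck_on_strip :: "nat \<Rightarrow> (real \<Rightarrow> real \<Rightarrow> real) \<Rightarrow> bool"
  where
    "Ck_on_strip 0 w \<longleftrightarrow> continuous_on ({0<..} \<times> {0..1}) (\<lambda>(t, x). w t x)"
  | "Ck_on_strip (Suc k) w \<longleftrightarrow>
      continuous_on ({0<..} \<times> {0..1}) (\<lambda>(t, x). w t x) \<and>
      (\<forall>t\<in>{0<..}. \<forall>x\<in>{0..1}. (\<lambda>s. w s x) differentiable (at t within {0<..}) \<and>
         w t differentiable (at x within {0..1})) \<and>
      Ck_on_strip k (time_deriv {0<..} w) \<and> Ck_on_strip k (\<lambda>t. grad (w t))"

definition smooth_on_strip :: "(real \<Rightarrow> real \<Rightarrow> real) \<Rightarrow> bool"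
  where "smooth_on_strip w \<longleftrightarrow> (\<forall>k. Ck_on_strip k w)"

definition vfun :: "(real \<Rightarrow> real \<Rightarrow> real) \<Rightarrow> real \<Rightarrow> real \<Rightarrow> real"
  where "vfun F t x = F t x + F t x * (1 - F t x) * (lap (F t) x / (grad (F t) x)\<^sup>2)"

definition logit :: "(real \<Rightarrow> real \<Rightarrow> real) \<Rightarrow> real \<Rightarrow> real \<Rightarrow> real"
  where "logit F t x = ln (F t x / (1 - F t x))"

definition elliptic_system ::
  "real \<Rightarrow> real \<Rightarrow> real \<Rightarrow> real \<Rightarrow> (real \<Rightarrow> real \<Rightarrow> real) \<Rightarrow> (real \<Rightarrow> real \<Rightarrow> real) \<Rightarrow> bool"
  where "elliptic_system \<alpha> \<beta> A B v F \<longleftrightarrow>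
    (\<forall>t>0. (\<forall>x\<in>{0<..<1}. lap (F t) x = (v t x - F t x) * ((grad (F t) x)\<^sup>2 / (F t x * (1 - F t x)))) \<and>
       grad (F t) 0 = (1 / A) * (F t 0 - \<alpha>) \<and> grad (F t) 1 = (1 / B) * (\<beta> - F t 1))"

text \<open>The parabolic system without its initial condition, which is only meaningful almost everywhere.\<close>

definition parabolic_system ::
  "real \<Rightarrow> real \<Rightarrow> real \<Rightarrow> real \<Rightarrow> (real \<Rightarrow> real \<Rightarrow> real) \<Rightarrow> (real \<Rightarrow> real \<Rightarrow> real) \<Rightarrow> bool"
  where "parabolic_system \<alpha> \<beta> A B v R \<longleftrightarrow>
    (\<forall>t>0. (\<forall>x\<in>{0<..<1}. time_deriv {0<..} v t x =
          lap (v t) x - 2 * grad (\<lambda>y. sigma (v t y) * grad (R t) y) x) \<and>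
       grad (v t) 1 - 2 * sigma (v t 1) * grad (R t) 1 = pfun (1 - \<beta>) B (v t 1) (R t 1) \<and>
       grad (v t) 0 - 2 * sigma (v t 0) * grad (R t) 0 = - pfun (1 - \<alpha>) A (v t 0) (R t 0))"

end

theory Submission
  imports Defs
begin

text \<open>
  Subtracting the linear stationary solution from \<open>F\<close> leaves a function \<open>w\<close> satisfying homogeneous
  Robin conditions. Testing the weak identity with \<open>K f\<close>, where \<open>K\<close> is the Green operator of
  \<open>- \<partial>\<^sub>x\<^sub>x\<close> under these conditions, shows \<open>\<partial>\<^sub>t K w = - w\<close>. Since \<open>K\<close> is symmetric and positive,
  \<open>\<parallel>K w\<parallel>\<^sup>2\<close>, \<open>\<langle>K w, K\<^sup>2 w\<rangle>\<close> and \<open>\<parallel>K\<^sup>2 w\<parallel>\<^sup>2\<close> decrease in time, and are up to constants the successive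
  derivatives of the last one; this yields \<open>\<parallel>w(t)\<parallel>\<^sub>\<infinity> \<le> C \<parallel>K w(t - \<delta>)\<parallel>\<^sub>2\<close>. Applied to differences of
  difference quotients in time it gives smoothness of \<open>w\<close> in time, hence in space because
  \<open>w = - K \<partial>\<^sub>t w\<close>.

  As \<open>t \<rightarrow> 0\<close>, symmetry gives \<open>\<parallel>\<partial>\<^sub>t w(t)\<parallel>\<^sup>2 = \<langle>\<psi>, \<partial>\<^sub>t\<^sub>t w(2 t)\<rangle>\<close> for the initial datum \<open>\<psi>\<close>. As \<open>\<psi>'\<close> is
  Lipschitz and \<open>\<psi>\<close> satisfies the Robin conditions, \<open>\<partial>\<^sub>t w\<close> is bounded in \<open>L\<^sup>2\<close> and \<open>w(t) \<rightarrow> \<psi>\<close> in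
  \<open>C\<^sup>1\<close>. The classical maximum principle for \<open>F\<close> and for \<open>\<nabla>F\<close>, whose boundary values are
  \<open>(F - \<alpha>) / A\<close> and \<open>(\<beta> - F) / B\<close>, then gives \<open>\<alpha> < F < \<beta>\<close> and \<open>\<nabla>F > 0\<close>; the two systems follow by
  differentiation.
\<close>

section \<open>The Robin Green operator\<close>

text \<open>Two regularity gaps shape the proof. The weak solution is only continuous for t > 0 and
  meets its initial value only when tested against functions \<open>K f\<close>. In the integrated
  equation every energy has a time derivative at once, and difference quotients in time are again
  solutions; since \<open>K (dq h v)\<close> tends to - v, an estimate for K of a solution loses one
  K in the limit. This takes the place of an eigenfunction expansion. The other gap lies in the
  datum: \<gamma> is merely measurable, so F(\<gamma>) has a Lipschitz derivative and no more, and
  \<Delta>F need not converge uniformly as t \<rightarrow> 0. An L^2 bound on \<partial>_t w is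
  enough: interpolated against the L^2 continuity of w it gives C^1 convergence, which is what the
  maximum principle needs in order to start from positive values of F - \<alpha>, \<beta> - F and
  \<nabla>F at some small time. The principle itself is nonstrict; strictness comes from comparison
  with a fraction of the stationary profile.\<close>

definition ip :: "(real \<Rightarrow> real) \<Rightarrow> (real \<Rightarrow> real) \<Rightarrow> real"
  where "ip f g = integral {0..1} (\<lambda>x. f x * g x)"

definition nrm :: "(real \<Rightarrow> real) \<Rightarrow> real"
  where "nrm f = sqrt (ip f f)"

lemma ip_commute: "ip f g = ip g f"
  by (simp add: ip_def mult.commute)

lemma ip_cong:
  assumes "\<And>x. x \<in> {0..1} \<Longrightarrow> f x = f' x" "\<And>x. x \<in> {0..1} \<Longrightarrow> g x = g' x"
  shows "ip f g = ip f' g'"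
  unfolding ip_def by (rule integral_cong) (simp add: assms)

text \<open>Integrability is not assumed: a non-integrable square has integral 0 by
  convention.\<close>

lemma ip_nonneg: "0 \<le> ip f f"
  unfolding ip_def by (cases "(\<lambda>x. f x * f x) integrable_on {0..1}")
    (auto intro: integral_nonneg simp: not_integrable_integral)

lemma ip_scale [simp]: "ip (\<lambda>x. c * f x) g = c * ip f g" "ip f (\<lambda>x. c * g x) = c * ip f g"
proof -
  have *: "ip (\<lambda>x. c * f x) g = c * ip f g" for f g
    unfolding ip_def by (simp add: mult.assoc)
  show "ip (\<lambda>x. c * f x) g = c * ip f g" by (rule *)
  show "ip f (\<lambda>x. c * g x) = c * ip f g"
    using *[of g f] ip_commute[of f g] ip_commute[of f "\<lambda>x. c * g x"] by simp
qed

lemma ip_minus [simp]: "ip (\<lambda>x. - f x) g = - ip f g" "ip f (\<lambda>x. - g x) = - ip f g"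
  using ip_scale(1)[of "-1" f g] ip_scale(2)[of f "-1" g] by simp_all

lemma ip_add:
  assumes "continuous_on {0..1} f" "continuous_on {0..1} g" "continuous_on {0..1} h"
  shows "ip (\<lambda>x. f x + g x) h = ip f h + ip g h"
  unfolding ip_def using assms
  by (simp add: distrib_right integral_add integrable_continuous_interval continuous_on_mult)

lemma ip_diff:
  assumes "continuous_on {0..1} f" "continuous_on {0..1} g" "continuous_on {0..1} h"
  shows "ip (\<lambda>x. f x - g x) h = ip f h - ip g h"
  unfolding ip_def using assms
  by (simp add: left_diff_distrib integral_diff integrable_continuous_interval continuous_on_mult)

lemma nrm_nonneg [simp]: "0 \<le> nrm f"
  by (simp add: nrm_def ip_nonneg)

lemma nrm_sq: "(nrm f)\<^sup>2 = ip f f"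
  by (simp add: nrm_def ip_nonneg)

lemma nrm_minus [simp]: "nrm (\<lambda>x. - f x) = nrm f"
  by (simp add: nrm_def)

lemma nrm_cong: "(\<And>x. x \<in> {0..1} \<Longrightarrow> f x = g x) \<Longrightarrow> nrm f = nrm g"
  unfolding nrm_def by (subst ip_cong[of f g f g]) simp_all

text \<open>The squared norm of x f + g is a quadratic polynomial in x that is never negative;
  evaluate it at its minimiser. If the leading coefficient \<open>ip f f\<close> vanishes, the
  polynomial is affine and must be constant.\<close>

lemma cauchy_schwarz:
  assumes f: "continuous_on {0..1} f" and g: "continuous_on {0..1} g"
  shows "\<bar>ip f g\<bar> \<le> nrm f * nrm g"
proof -
  have *: "0 \<le> ip f f * x\<^sup>2 + 2 * ip f g * x + ip g g" for x
  proof -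
    have "ip (\<lambda>y. x * f y + g y) (\<lambda>y. x * f y + g y)
      = x * (x * ip f f) + x * ip f g + (x * ip f g + ip g g)"
    proof -
      have c: "continuous_on {0..1} (\<lambda>y. x * f y)" "continuous_on {0..1} (\<lambda>y. x * f y + g y)"
        using f g by (auto intro!: continuous_intros)
      show ?thesis
        unfolding ip_add[OF c(1) g c(2)] ip_scale
          ip_commute[of f "\<lambda>y. x * f y + g y"] ip_commute[of g "\<lambda>y. x * f y + g y"]
          ip_add[OF c(1) g f] ip_add[OF c(1) g g] ip_commute[of g f]
        by (simp add: distrib_left)
    qed
    then show ?thesis using ip_nonneg[of "\<lambda>y. x * f y + g y"] by (simp add: power2_eq_square algebra_simps)
  qed
  have "(ip f g)\<^sup>2 \<le> ip f f * ip g g"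
  proof (cases "ip f f = 0")
    case True
    have "ip f g = 0"
    proof (rule ccontr)
      assume "ip f g \<noteq> 0"
      \<comment> \<open>The affine function takes the value -1 at this point.\<close>
      then show False using *[of "- (ip g g + 1) / (2 * ip f g)"] True by simp
    qed
    then show ?thesis using True by simp
  next
    case False
    then have p: "ip f f > 0" using ip_nonneg[of f] by simp
    have "0 \<le> ip f f * (- ip f g / ip f f)\<^sup>2 + 2 * ip f g * (- ip f g / ip f f) + ip g g" by (rule *)
    also have "\<dots> = ip g g - (ip f g)\<^sup>2 / ip f f" using p by (simp add: power2_eq_square field_simps)
    finally show ?thesis using p by (simp add: field_simps)
  qed
  then have "sqrt ((ip f g)\<^sup>2) \<le> sqrt (ip f f * ip g g)" by (rule real_sqrt_le_mono)
  then show ?thesis by (simp add: nrm_def real_sqrt_mult)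
qed

lemma integral_abs_le_nrm:
  assumes f: "continuous_on {0..1} f"
  shows "integral {0..1} (\<lambda>x. \<bar>f x\<bar>) \<le> nrm f"
proof -
  have "integral {0..1} (\<lambda>x. \<bar>f x\<bar>) = ip (\<lambda>x. \<bar>f x\<bar>) (\<lambda>x. 1)" by (simp add: ip_def)
  also have "\<dots> \<le> nrm (\<lambda>x. \<bar>f x\<bar>) * nrm (\<lambda>x. 1)"
    using cauchy_schwarz[of "\<lambda>x. \<bar>f x\<bar>" "\<lambda>x. 1"] f by (simp add: continuous_intros)
  also have "\<dots> = nrm f" by (simp add: nrm_def ip_def)
  finally show ?thesis .
qed

lemma nrm_le_sup:
  assumes f: "continuous_on {0..1} f" and b: "\<And>x. x \<in> {0..1} \<Longrightarrow> \<bar>f x\<bar> \<le> c"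
  shows "nrm f \<le> c"
proof -
  have c: "0 \<le> c" using b[of 0] by simp
  have "ip f f \<le> integral {0..1} (\<lambda>x::real. c\<^sup>2)"
    unfolding ip_def
  proof (rule integral_le)
    fix x :: real assume "x \<in> {0..1}"
    then have "\<bar>f x\<bar>\<^sup>2 \<le> c\<^sup>2" using b by (intro power_mono) auto
    then show "f x * f x \<le> c\<^sup>2" by (simp add: power2_eq_square)
  qed (auto intro!: integrable_continuous_interval continuous_intros f)
  then have "(nrm f)\<^sup>2 \<le> c\<^sup>2" by (simp add: nrm_sq)
  then show ?thesis using c by (rule power2_le_imp_le)
qed

lemma ip_eq_0D:
  assumes f: "continuous_on {0..1} f" and z: "ip f f = 0" and x: "x \<in> {0..1}"
  shows "f x = 0"
proof -
  have "((\<lambda>x. f x * f x) has_integral 0) {0..1}"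
    using z unfolding ip_def
    by (metis integrable_integral integrable_continuous_interval continuous_on_mult f)
  then have "f x * f x = 0"
    using has_integral_0_cbox_imp_0[of 0 1 "\<lambda>x. f x * f x" x] f x
    by (simp add: continuous_intros)
  then show ?thesis by simp
qed

lemma left_integral_deriv:
  fixes h :: "real \<Rightarrow> real"
  assumes h: "continuous_on {0..1} h" and x: "x \<in> {0..1}"
  shows "((\<lambda>u. integral {0..u} h) has_real_derivative h x) (at x within {0..1})"
  using integral_has_vector_derivative[OF h x] by (simp add: has_real_derivative_iff_has_vector_derivative)

lemma right_integral_deriv:
  fixes h :: "real \<Rightarrow> real"
  assumes h: "continuous_on {0..1} h" and x: "x \<in> {0..1}"
  shows "((\<lambda>u. integral {u..1} h) has_real_derivative - h x) (at x within {0..1})"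
  using integral_has_vector_derivative'[OF h x] by (simp add: has_real_derivative_iff_has_vector_derivative)

section \<open>Green operator: derivatives, energy identity, sup bounds\<close>

locale robin =
  fixes A B :: real
  assumes A_pos: "0 < A" and B_pos: "0 < B"
begin

text \<open>The Green operator of \<open>- \<partial>\<^sub>x\<^sub>x\<close> with homogeneous Robin conditions, and its spatial derivative.\<close>

definition K :: "(real \<Rightarrow> real) \<Rightarrow> real \<Rightarrow> real"
  where "K f x = ((1 + B - x) * integral {0..x} (\<lambda>y. (y + A) * f y)
    + (x + A) * integral {x..1} (\<lambda>y. (1 + B - y) * f y)) / (1 + A + B)"

definition K1 :: "(real \<Rightarrow> real) \<Rightarrow> real \<Rightarrow> real"
  where "K1 f x = (integral {x..1} (\<lambda>y. (1 + B - y) * f y)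
    - integral {0..x} (\<lambda>y. (y + A) * f y)) / (1 + A + B)"

lemma S_pos: "0 < 1 + A + B" using A_pos B_pos by simp

lemma K_cong:
  assumes "\<And>y. y \<in> {0..1} \<Longrightarrow> f y = g y" and "x \<in> {0..1}"
  shows "K f x = K g x" "K1 f x = K1 g x"
proof -
  have "integral {0..x} (\<lambda>y. (y + A) * f y) = integral {0..x} (\<lambda>y. (y + A) * g y)"
    "integral {x..1} (\<lambda>y. (1 + B - y) * f y) = integral {x..1} (\<lambda>y. (1 + B - y) * g y)"
    using assms by (auto intro!: integral_cong)
  then show "K f x = K g x" "K1 f x = K1 g x" by (simp_all add: K_def K1_def)
qed

text \<open>\<open>x + A\<close> and \<open>1 + B - x\<close> are the affine functions satisfying
  the left and the right homogeneous Robin condition, and \<open>1 + A + B\<close> is their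
  Wronskian. The terms from the moving end points of the integrals cancel here and add up to the
  Wronskian in \<open>K1_deriv\<close>.\<close>

lemma K_deriv:
  assumes f: "continuous_on {0..1} f" and x: "x \<in> {0..1}"
  shows "(K f has_real_derivative K1 f x) (at x within {0..1})"
proof -
  have [simp]: "1 + A + B \<noteq> 0" using S_pos by simp
  have 1: "((\<lambda>u. integral {0..u} (\<lambda>y. (y + A) * f y)) has_real_derivative (x + A) * f x) (at x within {0..1})"
    by (rule left_integral_deriv) (use x in \<open>auto intro!: continuous_intros f\<close>)
  have 2: "((\<lambda>u. integral {u..1} (\<lambda>y. (1 + B - y) * f y)) has_real_derivative - ((1 + B - x) * f x)) (at x within {0..1})"
    by (rule right_integral_deriv) (use x in \<open>auto intro!: continuous_intros f\<close>)
  have "((\<lambda>x. (1 + B - x) * integral {0..x} (\<lambda>y. (y + A) * f y)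
    + (x + A) * integral {x..1} (\<lambda>y. (1 + B - y) * f y)) has_real_derivative
      (0 - 1) * integral {0..x} (\<lambda>y. (y + A) * f y) + (x + A) * f x * (1 + B - x)
    + ((1 + 0) * integral {x..1} (\<lambda>y. (1 + B - y) * f y) + - ((1 + B - x) * f x) * (x + A))) (at x within {0..1})"
    by (rule derivative_intros 1 2)+
  then show ?thesis
    unfolding K_def[abs_def] K1_def
    by (rule DERIV_cong[OF DERIV_cdivide]) simp
qed

lemma K1_deriv:
  assumes f: "continuous_on {0..1} f" and x: "x \<in> {0..1}"
  shows "(K1 f has_real_derivative - f x) (at x within {0..1})"
proof -
  have s: "1 + A + B \<noteq> 0" using S_pos by simp
  have 1: "((\<lambda>u. integral {0..u} (\<lambda>y. (y + A) * f y)) has_real_derivative (x + A) * f x) (at x within {0..1})"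
    by (rule left_integral_deriv) (use x in \<open>auto intro!: continuous_intros f\<close>)
  have 2: "((\<lambda>u. integral {u..1} (\<lambda>y. (1 + B - y) * f y)) has_real_derivative - ((1 + B - x) * f x)) (at x within {0..1})"
    by (rule right_integral_deriv) (use x in \<open>auto intro!: continuous_intros f\<close>)
  have "(K1 f has_real_derivative (- ((1 + B - x) * f x) - (x + A) * f x) / (1 + A + B)) (at x within {0..1})"
    unfolding K1_def[abs_def] by (intro DERIV_cdivide DERIV_diff 1 2)
  moreover have "- ((1 + B - x) * f x) - (x + A) * f x = (1 + A + B) * - f x" by (simp add: algebra_simps)
  then have "(- ((1 + B - x) * f x) - (x + A) * f x) / (1 + A + B) = - f x"
    by (simp only: nonzero_mult_div_cancel_left[OF s])
  ultimately show ?thesis by (rule DERIV_cong)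
qed

lemma K_cont: "continuous_on {0..1} f \<Longrightarrow> continuous_on {0..1} (K f)"
  by (rule DERIV_continuous_on) (rule K_deriv)

lemma K1_cont: "continuous_on {0..1} f \<Longrightarrow> continuous_on {0..1} (K1 f)"
  by (rule DERIV_continuous_on) (rule K1_deriv)

lemma K_bdry: "K1 f 0 = K f 0 / A" "K1 f 1 = - K f 1 / B"
  using A_pos B_pos by (simp_all add: K_def K1_def)

text \<open>Integration by parts, with \<open>K_bdry\<close> for the boundary terms. The right side
  is the Robin energy form of \<open>K f\<close> and \<open>K g\<close>; being symmetric and
  nonnegative on the diagonal, it yields symmetry and positivity of K at once.\<close>

lemma K_green:
  assumes f: "continuous_on {0..1} f" and g: "continuous_on {0..1} g"
  shows "ip (K f) g = ip (K1 f) (K1 g) + K f 0 * K g 0 / A + K f 1 * K g 1 / B"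
proof -
  have "((\<lambda>x. K1 f x * K1 g x - K f x * g x) has_integral (K f 1 * K1 g 1 - K f 0 * K1 g 0)) {0..1}"
  proof (rule fundamental_theorem_of_calculus)
    fix x :: real assume x: "x \<in> {0..1}"
    show "((\<lambda>x. K f x * K1 g x) has_vector_derivative K1 f x * K1 g x - K f x * g x) (at x within {0..1})"
      unfolding has_real_derivative_iff_has_vector_derivative[symmetric]
      by (rule DERIV_cong[OF DERIV_mult[OF K_deriv[OF f x] K1_deriv[OF g x]]]) simp
  qed simp
  then have *: "integral {0..1} (\<lambda>x. K1 f x * K1 g x - K f x * g x) = K f 1 * K1 g 1 - K f 0 * K1 g 0"
    by (rule integral_unique)
  have "ip (K1 f) (K1 g) - ip (K f) g = K f 1 * K1 g 1 - K f 0 * K1 g 0"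
  proof -
    have "(\<lambda>x. K1 f x * K1 g x) integrable_on {0..1}" "(\<lambda>x. K f x * g x) integrable_on {0..1}"
      by (rule integrable_continuous_interval continuous_on_mult K_cont K1_cont f g)+
    from integral_diff[OF this] *
    show ?thesis unfolding ip_def by linarith
  qed
  then have "ip (K f) g = ip (K1 f) (K1 g) - (K f 1 * K1 g 1 - K f 0 * K1 g 0)" by linarith
  also have "\<dots> = ip (K1 f) (K1 g) + K f 0 * K g 0 / A + K f 1 * K g 1 / B"
    unfolding K_bdry[of g] by (simp add: algebra_simps)
  finally show ?thesis .
qed

lemma K_sym:
  assumes f: "continuous_on {0..1} f" and g: "continuous_on {0..1} g"
  shows "ip (K f) g = ip f (K g)"
proof -
  have "ip (K f) g = ip (K1 f) (K1 g) + K f 0 * K g 0 / A + K f 1 * K g 1 / B" by (rule K_green[OF f g])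
  also have "\<dots> = ip (K1 g) (K1 f) + K g 0 * K f 0 / A + K g 1 * K f 1 / B"
    by (simp only: ip_commute[of "K1 f" "K1 g"] mult.commute[of "K f 0"] mult.commute[of "K f 1"])
  also have "\<dots> = ip (K g) f" by (rule K_green[OF g f, symmetric])
  also have "\<dots> = ip f (K g)" by (rule ip_commute)
  finally show ?thesis .
qed

lemma K_pos:
  assumes f: "continuous_on {0..1} f"
  shows "0 \<le> ip (K f) f" "ip (K1 f) (K1 f) \<le> ip (K f) f"
proof -
  have "0 \<le> K f 0 * K f 0 / A" "0 \<le> K f 1 * K f 1 / B" using A_pos B_pos by simp_all
  with K_green[OF f f] ip_nonneg[of "K1 f"]
  show "0 \<le> ip (K f) f" "ip (K1 f) (K1 f) \<le> ip (K f) f" by linarith+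
qed

lemma K_add:
  assumes f: "continuous_on {0..1} f" and g: "continuous_on {0..1} g" and x: "x \<in> {0..1}"
  shows "K (\<lambda>y. f y + g y) x = K f x + K g x" "K1 (\<lambda>y. f y + g y) x = K1 f x + K1 g x"
proof -
  have "continuous_on {0..x} f" "continuous_on {x..1} f" "continuous_on {0..x} g" "continuous_on {x..1} g"
    using x by (auto intro: continuous_on_subset[OF f] continuous_on_subset[OF g])
  then have
    "integral {0..x} (\<lambda>y. (y + A) * (f y + g y))
      = integral {0..x} (\<lambda>y. (y + A) * f y) + integral {0..x} (\<lambda>y. (y + A) * g y)"
    "integral {x..1} (\<lambda>y. (1 + B - y) * (f y + g y))
      = integral {x..1} (\<lambda>y. (1 + B - y) * f y) + integral {x..1} (\<lambda>y. (1 + B - y) * g y)"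
    by (auto simp: distrib_left intro!: integral_add integrable_continuous_interval continuous_intros)
  then show "K (\<lambda>y. f y + g y) x = K f x + K g x" "K1 (\<lambda>y. f y + g y) x = K1 f x + K1 g x"
    by (simp_all add: K_def K1_def algebra_simps add_divide_distrib diff_divide_distrib)
qed

lemma K_scale: "K (\<lambda>y. c * f y) x = c * K f x" "K1 (\<lambda>y. c * f y) x = c * K1 f x"
proof -
  have *: "integral S (\<lambda>y. h y * (c * f y)) = c * integral S (\<lambda>y. h y * f y)" for S :: "real set" and h
  proof -
    have "(\<lambda>y. h y * (c * f y)) = (\<lambda>y. c * (h y * f y))" by (simp add: mult.left_commute)
    then show ?thesis by (simp only: integral_mult_right)
  qed
  then show "K (\<lambda>y. c * f y) x = c * K f x" "K1 (\<lambda>y. c * f y) x = c * K1 f x"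
    by (simp_all only: K_def K1_def *)
      (simp_all only: distrib_left right_diff_distrib times_divide_eq_right mult.left_commute)
qed

lemma K_minus: "K (\<lambda>y. - f y) x = - K f x" "K1 (\<lambda>y. - f y) x = - K1 f x"
  using K_scale[of "-1" f x] by simp_all

lemma K_diff:
  assumes f: "continuous_on {0..1} f" and g: "continuous_on {0..1} g" and x: "x \<in> {0..1}"
  shows "K (\<lambda>y. f y - g y) x = K f x - K g x" "K1 (\<lambda>y. f y - g y) x = K1 f x - K1 g x"
  using K_add[OF f continuous_on_minus[OF g] x] by (simp_all add: K_minus)

text \<open>The weights under the integrals are at most \<open>1 + A + B\<close>, and the L^1 norm
  on [0, 1] is at most the L^2 norm. In \<open>K1\<close> this factor cancels against the Wronskian;
  in \<open>K\<close> the outer weights leave one more.\<close>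

lemma K_bounds:
  assumes f: "continuous_on {0..1} f" and x: "x \<in> {0..1}"
  shows "\<bar>K f x\<bar> \<le> (1 + A + B) * nrm f" "\<bar>K1 f x\<bar> \<le> nrm f"
proof -
  let ?S = "1 + A + B"
  let ?P = "integral {0..x} (\<lambda>y. (y + A) * f y)" and ?Q = "integral {x..1} (\<lambda>y. (1 + B - y) * f y)"
  let ?I = "integral {0..x} (\<lambda>y. \<bar>f y\<bar>)" and ?J = "integral {x..1} (\<lambda>y. \<bar>f y\<bar>)"
  have c: "continuous_on {0..x} f" "continuous_on {x..1} f"
    using x by (auto intro: continuous_on_subset[OF f])
  have ab: "\<bar>r * f y\<bar> \<le> ?S * \<bar>f y\<bar>" if "0 \<le> r" "r \<le> ?S" for r y
    using that by (auto simp: abs_mult intro!: mult_right_mono)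
  have P: "\<bar>?P\<bar> \<le> ?S * ?I"
  proof -
    have "norm ?P \<le> integral {0..x} (\<lambda>y. ?S * \<bar>f y\<bar>)"
    proof (rule integral_norm_bound_integral)
      fix y assume "y \<in> {0..x}"
      then show "norm ((y + A) * f y) \<le> ?S * \<bar>f y\<bar>"
        unfolding real_norm_def using A_pos B_pos x by (intro ab) auto
    qed (auto intro!: integrable_continuous_interval continuous_intros c)
    then show ?thesis by simp
  qed
  have Q: "\<bar>?Q\<bar> \<le> ?S * ?J"
  proof -
    have "norm ?Q \<le> integral {x..1} (\<lambda>y. ?S * \<bar>f y\<bar>)"
    proof (rule integral_norm_bound_integral)
      fix y assume "y \<in> {x..1}"
      then show "norm ((1 + B - y) * f y) \<le> ?S * \<bar>f y\<bar>"
        unfolding real_norm_def using A_pos B_pos x by (intro ab) auto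
    qed (auto intro!: integrable_continuous_interval continuous_intros c)
    then show ?thesis by simp
  qed
  have IJ: "?I + ?J = integral {0..1} (\<lambda>y. \<bar>f y\<bar>)"
    using x by (intro Henstock_Kurzweil_Integration.integral_combine) (auto intro!: integrable_continuous_interval continuous_intros f)
  have n: "?I + ?J \<le> nrm f" unfolding IJ by (rule integral_abs_le_nrm[OF f])
  have PQ: "\<bar>?P\<bar> + \<bar>?Q\<bar> \<le> ?S * nrm f"
    using P Q n mult_left_mono[OF n, of ?S] S_pos by (simp add: distrib_left)
  have "\<bar>?Q - ?P\<bar> \<le> ?S * nrm f" using PQ by linarith
  then show "\<bar>K1 f x\<bar> \<le> nrm f"
    unfolding K1_def using S_pos by (simp add: abs_divide pos_divide_le_eq mult.commute)
  have "\<bar>(1 + B - x) * ?P + (x + A) * ?Q\<bar> \<le> ?S * \<bar>?P\<bar> + ?S * \<bar>?Q\<bar>"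
  proof (rule order_trans[OF abs_triangle_ineq], rule add_mono)
    show "\<bar>(1 + B - x) * ?P\<bar> \<le> ?S * \<bar>?P\<bar>" "\<bar>(x + A) * ?Q\<bar> \<le> ?S * \<bar>?Q\<bar>"
      using A_pos B_pos x by (auto simp: abs_mult intro!: mult_right_mono)
  qed
  also have "\<dots> \<le> ?S * (?S * nrm f)"
    using PQ S_pos by (simp only: distrib_left[symmetric]) simp
  finally show "\<bar>K f x\<bar> \<le> ?S * nrm f"
    unfolding K_def using S_pos by (simp add: abs_divide pos_divide_le_eq mult.commute)
qed

end

section \<open>Functions on the space-time strip\<close>

lemma nrm_triangle:
  assumes f: "continuous_on {0..1} f" and g: "continuous_on {0..1} g"
  shows "nrm (\<lambda>x. f x + g x) \<le> nrm f + nrm g"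
proof (rule power2_le_imp_le)
  have fg: "continuous_on {0..1} (\<lambda>x. f x + g x)" by (intro continuous_intros f g)
  have "ip (\<lambda>x. f x + g x) (\<lambda>x. f x + g x) = ip f (\<lambda>x. f x + g x) + ip g (\<lambda>x. f x + g x)"
    by (rule ip_add[OF f g fg])
  also have "\<dots> = (ip f f + ip g f) + (ip f g + ip g g)"
    unfolding ip_commute[of f "\<lambda>x. f x + g x"] ip_commute[of g "\<lambda>x. f x + g x"]
      ip_add[OF f g f] ip_add[OF f g g] by simp
  also have "\<dots> \<le> (nrm f + nrm g)\<^sup>2"
    using cauchy_schwarz[OF f g] by (simp add: nrm_sq[symmetric] ip_commute[of g f] power2_sum)
  finally show "(nrm (\<lambda>x. f x + g x))\<^sup>2 \<le> (nrm f + nrm g)\<^sup>2" by (simp add: nrm_sq)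
qed simp

lemma nrm_diff_abs:
  assumes f: "continuous_on {0..1} f" and g: "continuous_on {0..1} g"
  shows "\<bar>nrm f - nrm g\<bar> \<le> nrm (\<lambda>x. f x - g x)"
proof -
  have fg: "continuous_on {0..1} (\<lambda>x. f x - g x)" "continuous_on {0..1} (\<lambda>x. - (f x - g x))"
    by (intro continuous_intros f g)+
  show ?thesis
    using nrm_triangle[OF fg(1) g] nrm_triangle[OF fg(2) f] nrm_minus[of "\<lambda>x. f x - g x"] by simp
qed

lemma nrm_tendsto:
  assumes u: "uniform_limit {0..1} f g F" and f: "\<And>n. continuous_on {0..1} (f n)" and g: "continuous_on {0..1} g"
  shows "((\<lambda>n. nrm (f n)) \<longlongrightarrow> nrm g) F"
proof (rule tendstoI)
  fix e :: real assume e: "0 < e"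
  have "\<forall>\<^sub>F n in F. \<forall>x\<in>{0..1}. dist (f n x) (g x) < e / 2"
    using uniform_limitD[OF u, of "e / 2"] e by simp
  then show "\<forall>\<^sub>F n in F. dist (nrm (f n)) (nrm g) < e"
  proof eventually_elim
    case (elim n)
    have "nrm (\<lambda>x. f n x - g x) \<le> e / 2"
      using elim by (intro nrm_le_sup continuous_intros f g) (auto simp: dist_real_def intro: less_imp_le)
    then show ?case using nrm_diff_abs[OF f g, of n] e by (simp add: dist_real_def)
  qed
qed

section \<open>Joint continuity, time derivatives and difference quotients\<close>

definition scont :: "(real \<Rightarrow> real \<Rightarrow> real) \<Rightarrow> bool"
  where "scont w \<longleftrightarrow> continuous_on ({0<..} \<times> {0..1}) (\<lambda>(t, x). w t x)"

text \<open>The derivative is an argument, so that an equation such as \<partial>_t K w = - w can be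
  stated with its explicit right side.\<close>

definition tder :: "(real \<Rightarrow> real \<Rightarrow> real) \<Rightarrow> (real \<Rightarrow> real \<Rightarrow> real) \<Rightarrow> bool"
  where "tder w w' \<longleftrightarrow> (\<forall>t>0. \<forall>x\<in>{0..1}. ((\<lambda>s. w s x) has_real_derivative w' t x) (at t))"

definition dq :: "real \<Rightarrow> (real \<Rightarrow> real \<Rightarrow> real) \<Rightarrow> real \<Rightarrow> real \<Rightarrow> real"
  where "dq h w t x = (w (t + h) x - w t x) / h"

lemma tderD: "tder w w' \<Longrightarrow> 0 < t \<Longrightarrow> x \<in> {0..1} \<Longrightarrow> ((\<lambda>s. w s x) has_real_derivative w' t x) (at t)"
  by (simp add: tder_def)

lemma scont_comp:
  assumes "scont w" "continuous_on S f" "continuous_on S g" "f ` S \<subseteq> {0<..}" "g ` S \<subseteq> {0..1}"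
  shows "continuous_on S (\<lambda>p. w (f p) (g p))"
proof -
  have "continuous_on S (\<lambda>p. case (f p, g p) of (t, x) \<Rightarrow> w t x)"
    by (rule continuous_on_compose2[OF assms(1)[unfolded scont_def] continuous_on_Pair[OF assms(2,3)]])
      (use assms(4,5) in auto)
  then show ?thesis by simp
qed

lemma scont_slice: "scont w \<Longrightarrow> 0 < t \<Longrightarrow> continuous_on {0..1} (w t)"
  by (rule scont_comp[of w _ "\<lambda>_. t" "\<lambda>x. x"]) auto

lemma scont_time: "scont w \<Longrightarrow> x \<in> {0..1} \<Longrightarrow> continuous_on {0<..} (\<lambda>t. w t x)"
  by (rule scont_comp[of w _ "\<lambda>t. t" "\<lambda>_. x"]) auto

lemma scont_add: "scont a \<Longrightarrow> scont b \<Longrightarrow> scont (\<lambda>t x. a t x + b t x)"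
  and scont_diff: "scont a \<Longrightarrow> scont b \<Longrightarrow> scont (\<lambda>t x. a t x - b t x)"
  and scont_mult: "scont a \<Longrightarrow> scont b \<Longrightarrow> scont (\<lambda>t x. a t x * b t x)"
  and scont_minus: "scont a \<Longrightarrow> scont (\<lambda>t x. - a t x)"
  and scont_const: "scont (\<lambda>t x. c)"
  unfolding scont_def split_beta by (intro continuous_intros; assumption)+

lemma scont_shift: "scont w \<Longrightarrow> 0 \<le> h \<Longrightarrow> scont (\<lambda>t. w (t + h))"
  unfolding scont_def[of "\<lambda>t. w (t + h)"] split_beta
  by (rule scont_comp) (auto intro!: continuous_intros)

lemma scont_dq: "scont w \<Longrightarrow> 0 < h \<Longrightarrow> scont (dq h w)"
  using scont_mult[OF scont_diff[OF scont_shift[of w h]] scont_const[of "inverse h"]]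
  unfolding dq_def[abs_def] divide_inverse by simp

lemma scont_cong:
  assumes "scont a" "\<And>t x. 0 < t \<Longrightarrow> x \<in> {0..1} \<Longrightarrow> a t x = b t x"
  shows "scont b"
proof -
  have "continuous_on ({0<..} \<times> {0..1}) (\<lambda>(t, x). a t x) \<longleftrightarrow> continuous_on ({0<..} \<times> {0..1}) (\<lambda>(t, x). b t x)"
    by (rule continuous_on_cong) (use assms(2) in auto)
  then show ?thesis using assms(1) by (simp add: scont_def)
qed

lemma scont_unif:
  assumes w: "scont w" and t: "0 < t"
  shows "uniform_limit {0..1} w (w t) (at t)"
proof (rule uniform_limitI)
  fix e :: real assume e: "0 < e"
  from continuous_on_prod_compactE[OF w[unfolded scont_def] compact_Icc, of t "e/2"] t e
  obtain X where X: "t \<in> X" "open X" and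
    b: "\<forall>s\<in>X \<inter> {0<..}. \<forall>x\<in>{0..1}. dist (w s x) (w t x) \<le> e / 2" by auto
  have "\<forall>\<^sub>F s in at t. s \<in> X \<inter> {0<..}"
    by (rule eventually_at_in_open') (use X t in auto)
  then show "\<forall>\<^sub>F s in at t. \<forall>x\<in>{0..1}. dist (w s x) (w t x) < e"
    by eventually_elim (use b e in force)
qed

text \<open>Triangle inequality through (t, y): uniformity in y handles the change of time,
  continuity of the slice at t the change of space. It serves functions such as
  \<open>K (w t)\<close>, whose estimates come slice by slice.\<close>

lemma scontI:
  assumes c: "\<And>t. 0 < t \<Longrightarrow> continuous_on {0..1} (w t)"
    and u: "\<And>t. 0 < t \<Longrightarrow> uniform_limit {0..1} w (w t) (at t)"
  shows "scont w"
  unfolding scont_def continuous_on_iff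
proof (intro ballI allI impI)
  fix p :: "real \<times> real" and e :: real assume p: "p \<in> {0<..} \<times> {0..1}" and e: "0 < e"
  obtain t x where tx: "p = (t, x)" "0 < t" "x \<in> {0..1}" using p by auto
  note t = tx(2) and x = tx(3)
  obtain d1 where d1: "0 < d1" "\<And>y. y \<in> {0..1} \<Longrightarrow> dist y x < d1 \<Longrightarrow> dist (w t y) (w t x) < e / 2"
    using c[OF t] x e unfolding continuous_on_iff by (metis atLeastAtMost_iff half_gt_zero)
  have "\<forall>\<^sub>F s in at t. \<forall>y\<in>{0..1}. dist (w s y) (w t y) < e / 2"
    using uniform_limitD[OF u[OF t], of "e / 2"] e by simp
  then obtain d2 where d2: "0 < d2" "\<And>s. s \<noteq> t \<Longrightarrow> dist s t < d2 \<Longrightarrow> \<forall>y\<in>{0..1}. dist (w s y) (w t y) < e / 2"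
    unfolding eventually_at by auto
  have d2': "dist (w s y) (w t y) < e / 2" if "dist s t < d2" "y \<in> {0..1}" for s y
    using d2(2)[of s] that e by (cases "s = t") auto
  show "\<exists>d>0. \<forall>q\<in>{0<..} \<times> {0..1}. dist q p < d \<longrightarrow>
      dist (case q of (t, x) \<Rightarrow> w t x) (case p of (t, x) \<Rightarrow> w t x) < e"
  proof (intro exI[of _ "min d1 d2"] conjI ballI impI)
    fix q :: "real \<times> real" assume q: "q \<in> {0<..} \<times> {0..1}" and d: "dist q p < min d1 d2"
    have "dist (fst q) t < d2" "dist (snd q) x < d1"
      using d dist_fst_le[of q p] dist_snd_le[of q p] tx by auto
    then have "dist (w (fst q) (snd q)) (w t (snd q)) < e / 2" "dist (w t (snd q)) (w t x) < e / 2"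
      using d1 d2' q by auto
    then show "dist (case q of (t, x) \<Rightarrow> w t x) (case p of (t, x) \<Rightarrow> w t x) < e"
      using dist_triangle[of "w (fst q) (snd q)" "w t x" "w t (snd q)"] tx by (simp add: split_beta)
  qed (use d1 d2 in auto)
qed

text \<open>Continuity at time t sees only the window from t / 2 to 2 t. Locally uniform convergence
  is available on such compact windows, away from t = 0.\<close>

lemma scont_local:
  assumes "\<And>a b. 0 < a \<Longrightarrow> a < b \<Longrightarrow> continuous_on ({a..b} \<times> {0..1}) (\<lambda>(t, x). w t x)"
  shows "scont w"
  unfolding scont_def continuous_on_eq_continuous_within
proof (clarsimp)
  fix t x :: real assume t: "0 < t" and x: "0 \<le> x" "x \<le> 1"
  have "continuous (at (t, x) within {t/2..2*t} \<times> {0..1}) (\<lambda>(t, x). w t x)"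
    using assms[of "t/2" "2*t"] t x by (auto simp: continuous_on_eq_continuous_within)
  also have "at (t, x) within {t/2..2*t} \<times> {0..1} = at (t, x) within {0<..} \<times> {0..1}"
    by (rule at_within_nhd[of _ "{t/2<..<2*t} \<times> UNIV"]) (use t in \<open>auto intro: open_Times\<close>)
  finally show "continuous (at (t, x) within {0<..} \<times> {0..1}) (\<lambda>(t, x). w t x)" .
qed

lemma ip_time_cont:
  assumes a: "scont a" and b: "scont b"
  shows "continuous_on {0<..} (\<lambda>t. ip (a t) (b t))"
  using integral_continuous_on_param[OF scont_mult[OF a b, unfolded scont_def, folded cbox_interval]]
  unfolding ip_def cbox_interval by simp

lemma param_integral_deriv:
  assumes w: "scont w" and w': "scont w'" and d: "tder w w'" and h: "continuous_on {0..1} h"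
    and ab: "{a..b} \<subseteq> {0..1}" and t: "0 < t"
  shows "((\<lambda>t. integral {a..b} (\<lambda>y. h y * w t y)) has_real_derivative integral {a..b} (\<lambda>y. h y * w' t y)) (at t)"
proof -
  have "((\<lambda>t. integral (cbox a b) (\<lambda>y. h y * w t y)) has_real_derivative
      integral (cbox a b) (\<lambda>y. h y * w' t y)) (at t within {0<..})"
  proof (rule leibniz_rule_field_derivative)
    fix s y :: real assume s: "s \<in> {0<..}" and y: "y \<in> cbox a b"
    then have y: "y \<in> {0..1}" using ab by auto
    show "((\<lambda>x. h y * w x y) has_real_derivative h y * w' s y) (at s within {0<..})"
      using s by (intro DERIV_cmult DERIV_subset[OF tderD[OF d _ y]]) auto
  next
    fix s :: real assume s: "s \<in> {0<..}"
    have "continuous_on {a..b} (\<lambda>y. h y * w s y)"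
      using s ab by (intro continuous_on_mult continuous_on_subset[OF h] continuous_on_subset[OF scont_slice[OF w]]) auto
    then show "(\<lambda>y. h y * w s y) integrable_on cbox a b"
      by (simp add: integrable_continuous_interval)
  next
    have "continuous_on ({0<..} \<times> {a..b}) (\<lambda>p. h (snd p) * w' (fst p) (snd p))"
      by (intro continuous_on_mult continuous_on_compose2[OF h] scont_comp[OF w'])
        (use ab in \<open>auto intro!: continuous_intros\<close>)
    then show "continuous_on ({0<..} \<times> cbox a b) (\<lambda>(x, y). h y * w' x y)"
      by (simp add: split_beta)
  qed (use t in auto)
  then show ?thesis using t by (simp add: at_within_open[OF _ open_greaterThan])
qed

lemma ip_deriv:
  assumes a: "scont a" "scont a'" "tder a a'" and b: "scont b" "scont b'" "tder b b'" and t: "0 < t"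
  shows "((\<lambda>t. ip (a t) (b t)) has_real_derivative ip (a' t) (b t) + ip (a t) (b' t)) (at t)"
proof -
  have "tder (\<lambda>t x. a t x * b t x) (\<lambda>t x. a' t x * b t x + a t x * b' t x)"
    unfolding tder_def
    by (intro allI impI ballI DERIV_cong[OF DERIV_mult[OF tderD[OF a(3)] tderD[OF b(3)]]]) (simp_all add: mult.commute)
  from param_integral_deriv[OF scont_mult[OF a(1) b(1)] scont_add[OF scont_mult[OF a(2) b(1)] scont_mult[OF a(1) b(2)]]
      this continuous_on_const[of _ 1] order_refl t]
  have "((\<lambda>t. ip (a t) (b t)) has_real_derivative integral {0..1} (\<lambda>x. a' t x * b t x + a t x * b' t x)) (at t)"
    by (simp add: ip_def)
  also have "integral {0..1} (\<lambda>x. a' t x * b t x + a t x * b' t x) = ip (a' t) (b t) + ip (a t) (b' t)"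
    unfolding ip_def using t
    by (intro integral_add integrable_continuous_interval continuous_on_mult scont_slice a b)
  finally show ?thesis .
qed

lemma dq_unif_compact:
  assumes d: "tder w w'" and w': "scont w'" and a: "0 < a" and e: "0 < e"
  shows "\<exists>h0>0. \<forall>h. 0 < h \<longrightarrow> h < h0 \<longrightarrow> (\<forall>t\<in>{a..b}. \<forall>x\<in>{0..1}. \<bar>dq h w t x - w' t x\<bar> < e)"
proof -
  \<comment> \<open>The extra unit of time makes room for t + h; hence the cap 1 in
    \<open>min d0 1\<close>.\<close>
  have "continuous_on ({a..b + 1} \<times> {0..1}) (\<lambda>(t, x). w' t x)"
    by (rule continuous_on_subset[OF w'[unfolded scont_def]]) (use a in auto)
  then have "uniformly_continuous_on ({a..b + 1} \<times> {0..1}) (\<lambda>(t, x). w' t x)"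
    by (rule compact_uniformly_continuous) (auto intro: compact_Times)
  then obtain d0 where d0: "0 < d0" "\<And>p q. p \<in> {a..b + 1} \<times> {0..1} \<Longrightarrow> q \<in> {a..b + 1} \<times> {0..1} \<Longrightarrow>
      dist q p < d0 \<Longrightarrow> dist (w' (fst q) (snd q)) (w' (fst p) (snd p)) < e"
    using e unfolding uniformly_continuous_on_def split_beta by blast
  show ?thesis
  proof (intro exI[of _ "min d0 1"] conjI allI impI ballI)
    fix h t x :: real assume h: "0 < h" "h < min d0 1" and t: "t \<in> {a..b}" and x: "x \<in> {0..1}"
    have "\<exists>z>t. z < t + h \<and> w (t + h) x - w t x = (t + h - t) * w' z x"
      by (rule MVT2) (use h t a x in \<open>auto intro!: tderD[OF d]\<close>)
    then obtain z where z: "t < z" "z < t + h" "w (t + h) x - w t x = h * w' z x" by auto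
    have "dq h w t x = w' z x" using z h by (simp add: dq_def)
    moreover have "dist (w' z x) (w' t x) < e"
      using d0(2)[of "(t, x)" "(z, x)"] z h t x by (auto simp: dist_Pair_Pair dist_real_def)
    ultimately show "\<bar>dq h w t x - w' t x\<bar> < e" by (simp add: dist_real_def)
  qed (use d0 in auto)
qed

lemma dq_unif:
  assumes d: "tder w w'" and w': "scont w'" and t: "0 < t"
  shows "uniform_limit {0..1} (\<lambda>h. dq h w t) (w' t) (at_right 0)"
proof (rule uniform_limitI)
  fix e :: real assume "0 < e"
  from dq_unif_compact[OF d w' t this, of t] obtain h0 where
    "h0 > 0" "\<forall>h. 0 < h \<longrightarrow> h < h0 \<longrightarrow> (\<forall>x\<in>{0..1}. \<bar>dq h w t x - w' t x\<bar> < e)" by auto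
  then show "\<forall>\<^sub>F h in at_right 0. \<forall>x\<in>{0..1}. dist (dq h w t x) (w' t x) < e"
    unfolding eventually_at_right_field dist_real_def by blast
qed

lemma tder_minus: "tder a a' \<Longrightarrow> tder (\<lambda>t x. - a t x) (\<lambda>t x. - a' t x)"
  by (auto simp: tder_def intro!: DERIV_minus)

lemma tder_cong:
  assumes "tder a a'" "\<And>t x. 0 < t \<Longrightarrow> x \<in> {0..1} \<Longrightarrow> a t x = b t x" "\<And>t x. 0 < t \<Longrightarrow> x \<in> {0..1} \<Longrightarrow> a' t x = b' t x"
  shows "tder b b'"
  unfolding tder_def
proof (intro allI impI ballI)
  fix t x :: real assume t: "0 < t" and x: "x \<in> {0..1}"
  have "((\<lambda>s. b s x) has_real_derivative a' t x) (at t)"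
    by (rule has_field_derivative_transform_within_open[OF tderD[OF assms(1) t x] open_greaterThan[of 0]])
      (use t x assms(2) in auto)
  then show "((\<lambda>s. b s x) has_real_derivative b' t x) (at t)" by (simp add: assms(3)[OF t x])
qed

lemma tder_shift:
  assumes d: "tder a a'" and h: "0 \<le> h"
  shows "tder (\<lambda>t. a (t + h)) (\<lambda>t. a' (t + h))"
  unfolding tder_def
proof (intro allI impI ballI)
  fix t x :: real assume "0 < t" "x \<in> {0..1}"
  then show "((\<lambda>s. a (s + h) x) has_real_derivative a' (t + h) x) (at t)"
    using tderD[OF d, of "t + h" x] h by (simp add: DERIV_shift)
qed

lemma tder_dq: "tder a a' \<Longrightarrow> 0 < h \<Longrightarrow> tder (dq h a) (dq h a')"
  using tder_shift[of a a' h] unfolding dq_def[abs_def] tder_def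
  by (auto intro!: DERIV_cdivide DERIV_diff)

section \<open>Smoothing\<close>

context robin
begin

lemma K_uniform_limit:
  assumes u: "uniform_limit {0..1} f g F" and f: "\<And>n. continuous_on {0..1} (f n)" and g: "continuous_on {0..1} g"
  shows "uniform_limit {0..1} (\<lambda>n. K (f n)) (K g) F" "uniform_limit {0..1} (\<lambda>n. K1 (f n)) (K1 g) F"
proof -
  have *: "\<forall>\<^sub>F n in F. nrm (\<lambda>x. f n x - g x) \<le> e" if "0 < e" for e
    using uniform_limitD[OF u that]
  proof eventually_elim
    case (elim n)
    then show ?case
      by (intro nrm_le_sup continuous_intros f g) (auto simp: dist_real_def intro: less_imp_le)
  qed
  show "uniform_limit {0..1} (\<lambda>n. K (f n)) (K g) F"
  proof (rule uniform_limitI)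
    fix e :: real assume e: "0 < e"
    have "\<forall>\<^sub>F n in F. nrm (\<lambda>x. f n x - g x) \<le> e / (2 * (1 + A + B))"
      using e S_pos by (intro *) simp
    then show "\<forall>\<^sub>F n in F. \<forall>x\<in>{0..1}. dist (K (f n) x) (K g x) < e"
    proof eventually_elim
      case (elim n)
      show ?case
      proof
        fix x :: real assume x: "x \<in> {0..1}"
        have "\<bar>K (\<lambda>x. f n x - g x) x\<bar> \<le> (1 + A + B) * nrm (\<lambda>x. f n x - g x)"
          by (rule K_bounds(1)) (intro continuous_intros f g x)+
        also have "\<dots> \<le> (1 + A + B) * (e / (2 * (1 + A + B)))"
          by (rule mult_left_mono[OF elim]) (use S_pos in simp)
        also have "\<dots> = e / 2" using S_pos by (simp add: field_simps del: distrib_left_numeral distrib_right_numeral)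
        also have "\<dots> < e" using e by simp
        finally show "dist (K (f n) x) (K g x) < e" by (simp add: dist_real_def K_diff[OF f g x])
      qed
    qed
  qed
  show "uniform_limit {0..1} (\<lambda>n. K1 (f n)) (K1 g) F"
  proof (rule uniform_limitI)
    fix e :: real assume e: "0 < e"
    have "\<forall>\<^sub>F n in F. nrm (\<lambda>x. f n x - g x) \<le> e / 2"
      using e by (intro *) simp
    then show "\<forall>\<^sub>F n in F. \<forall>x\<in>{0..1}. dist (K1 (f n) x) (K1 g x) < e"
    proof eventually_elim
      case (elim n)
      show ?case
      proof
        fix x :: real assume x: "x \<in> {0..1}"
        have "\<bar>K1 (\<lambda>x. f n x - g x) x\<bar> \<le> nrm (\<lambda>x. f n x - g x)"
          by (rule K_bounds(2)) (intro continuous_intros f g x)+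
        then show "dist (K1 (f n) x) (K1 g x) < e" using elim e by (simp add: dist_real_def K_diff[OF f g x])
      qed
    qed
  qed
qed

lemma scont_K:
  assumes w: "scont w"
  shows "scont (\<lambda>t. K (w t))" "scont (\<lambda>t. K1 (w t))"
proof -
  \<comment> \<open>\<open>K_uniform_limit\<close> asks for continuity of every slice, while w is
    controlled for positive times only; the other slices are overwritten by 0.\<close>
  define w0 where "w0 t = (if 0 < t then w t else (\<lambda>_. 0))" for t
  have c: "continuous_on {0..1} (w0 t)" for t by (simp add: w0_def scont_slice[OF w])
  have w0: "scont w0" by (rule scont_cong[OF w]) (simp add: w0_def)
  have u: "uniform_limit {0..1} w0 (w0 t) (at t)" if "0 < t" for t by (rule scont_unif[OF w0 that])
  have "scont (\<lambda>t. K (w0 t))" "scont (\<lambda>t. K1 (w0 t))"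
    by (auto intro!: scontI K_cont K1_cont c K_uniform_limit u)
  from scont_cong[OF this(1), of "\<lambda>t. K (w t)"] scont_cong[OF this(2), of "\<lambda>t. K1 (w t)"]
  show "scont (\<lambda>t. K (w t))" "scont (\<lambda>t. K1 (w t))" by (simp_all add: w0_def)
qed

lemma K_tder:
  assumes w: "scont w" and w': "scont w'" and d: "tder w w'"
  shows "tder (\<lambda>t. K (w t)) (\<lambda>t. K (w' t))" "tder (\<lambda>t. K1 (w t)) (\<lambda>t. K1 (w' t))"
proof -
  have 1: "((\<lambda>t. integral {0..x} (\<lambda>y. (y + A) * w t y)) has_real_derivative integral {0..x} (\<lambda>y. (y + A) * w' t y)) (at t)"
    and 2: "((\<lambda>t. integral {x..1} (\<lambda>y. (1 + B - y) * w t y)) has_real_derivative integral {x..1} (\<lambda>y. (1 + B - y) * w' t y)) (at t)"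
    if "0 < t" "x \<in> {0..1}" for t x
    by (rule param_integral_deriv[OF w w' d _ _ that(1)]; use that in \<open>auto intro!: continuous_intros\<close>)+
  show "tder (\<lambda>t. K (w t)) (\<lambda>t. K (w' t))"
    unfolding tder_def K_def by (intro allI ballI impI DERIV_cdivide DERIV_add DERIV_cmult 1 2)
  show "tder (\<lambda>t. K1 (w t)) (\<lambda>t. K1 (w' t))"
    unfolding tder_def K1_def by (intro allI ballI impI DERIV_cdivide DERIV_diff 1 2)
qed

text \<open>Applying the Green operator to \<open>\<partial>\<^sub>t w = \<partial>\<^sub>x\<^sub>x w\<close> with homogeneous Robin conditions gives
  \<open>\<partial>\<^sub>t K w = - w\<close>, which makes sense for merely continuous \<open>w\<close>.\<close>

definition sol :: "(real \<Rightarrow> real \<Rightarrow> real) \<Rightarrow> bool"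
  where "sol w \<longleftrightarrow> scont w \<and> tder (\<lambda>t. K (w t)) (\<lambda>t x. - w t x)"

lemma solD: "sol w \<Longrightarrow> scont w" "sol w \<Longrightarrow> tder (\<lambda>t. K (w t)) (\<lambda>t x. - w t x)"
  by (simp_all add: sol_def)

lemma K_dq:
  assumes w: "scont w" and h: "0 < h" and t: "0 < t" and x: "x \<in> {0..1}"
  shows "K (dq h w t) x = dq h (\<lambda>t. K (w t)) t x"
proof -
  have "K (\<lambda>y. inverse h * (w (t + h) y - w t y)) x = inverse h * (K (w (t + h)) x - K (w t) x)"
    unfolding K_scale using t h x by (subst K_diff) (auto intro!: scont_slice w)
  then show ?thesis by (simp add: dq_def[abs_def] divide_inverse mult.commute)
qed

text \<open>By linearity, and without any differentiability of w in time: quotients can be estimated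
  before their limit is known to exist.\<close>

lemma sol_dq:
  assumes w: "sol w" and h: "0 < h"
  shows "sol (dq h w)"
  unfolding sol_def
proof
  show "scont (dq h w)" by (rule scont_dq[OF solD(1)[OF w] h])
  show "tder (\<lambda>t. K (dq h w t)) (\<lambda>t x. - dq h w t x)"
    by (rule tder_cong[OF tder_dq[OF solD(2)[OF w] h]])
      (simp_all add: K_dq[OF solD(1)[OF w] h] dq_def diff_divide_distrib)
qed

lemma sol_diff:
  assumes a: "sol a" and b: "sol b"
  shows "sol (\<lambda>t x. a t x - b t x)"
  unfolding sol_def
proof
  show "scont (\<lambda>t x. a t x - b t x)" by (intro scont_diff solD a b)
  have "tder (\<lambda>t x. K (a t) x - K (b t) x) (\<lambda>t x. - a t x - - b t x)"
    unfolding tder_def by (intro allI ballI impI DERIV_diff tderD[OF solD(2)] a b)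
  then show "tder (\<lambda>t. K (\<lambda>x. a t x - b t x)) (\<lambda>t x. - (a t x - b t x))"
    by (rule tder_cong) (simp_all add: K_diff scont_slice solD a b)
qed

lemma sol_K:
  assumes w: "sol w"
  shows "sol (\<lambda>t. K (w t))"
  unfolding sol_def
proof
  show "scont (\<lambda>t. K (w t))" by (intro scont_K solD w)
  have "tder (\<lambda>t. K (K (w t))) (\<lambda>t. K (\<lambda>x. - w t x))"
    by (rule K_tder[OF scont_K(1)[OF solD(1)[OF w]] scont_minus[OF solD(1)[OF w]] solD(2)[OF w]])
  then show "tder (\<lambda>t. K (K (w t))) (\<lambda>t x. - K (w t) x)"
    by (rule tder_cong) (simp_all add: K_minus)
qed

text \<open>By monotonicity, the mean value theorem over a time step d bounds \<open>?D2\<close> at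
  the end by \<open>?D1\<close> at the start, divided by 2 d, and likewise \<open>?D1\<close> by
  \<open>?D0\<close>; nonnegativity disposes of the subtracted terms. Two steps give the lag 2 d
  and, after a square root, the factor 1 / (2 d). K stays on both sides because v itself has no
  known time derivative yet.\<close>

lemma smoothing1:
  assumes v: "sol v" and d: "0 < d" and t: "2 * d < t"
  shows "nrm (K (v t)) \<le> nrm (K (K (v (t - 2 * d)))) / (2 * d)"
proof -
  let ?z = "\<lambda>t. K (v t)" and ?y = "\<lambda>t. K (K (v t))"
  let ?D0 = "\<lambda>t. ip (?y t) (?y t)" and ?D1 = "\<lambda>t. ip (?y t) (?z t)" and ?D2 = "\<lambda>t. ip (?z t) (?z t)"
  have cv: "scont v" and cz: "scont ?z" and cy: "scont ?y"
    by (intro scont_K solD v)+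
  have mv: "scont (\<lambda>t x. - v t x)" and mz: "scont (\<lambda>t x. - K (v t) x)"
    by (intro scont_minus cv cz)+
  have dz: "tder ?z (\<lambda>t x. - v t x)" by (rule solD(2)[OF v])
  have dy: "tder ?y (\<lambda>t x. - K (v t) x)" by (rule solD(2)[OF sol_K[OF v]])
  have D2: "(?D2 has_real_derivative - 2 * ip (?z t) (v t)) (at t)" if "0 < t" for t
    using ip_deriv[OF cz mv dz cz mv dz that] by (simp add: ip_commute[of "v t" "K (v t)"])
  have D1: "(?D1 has_real_derivative - 2 * ?D2 t) (at t)" if t: "0 < t" for t
  proof -
    have "ip (?y t) (v t) = ?D2 t"
      by (rule K_sym) (intro scont_slice cz cv t)+
    then show ?thesis using ip_deriv[OF cy mz dy cz mv dz t] by simp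
  qed
  have D0: "(?D0 has_real_derivative - 2 * ?D1 t) (at t)" if "0 < t" for t
    using ip_deriv[OF cy mz dy cy mz dy that] by (simp add: ip_commute[of "K (v t)" "K (K (v t))"])
  have D2mono: "?D2 s \<le> ?D2 r" if "0 < r" "r \<le> s" for r s
  proof (rule DERIV_nonpos_imp_nonincreasing[OF that(2)])
    fix x assume "r \<le> x" "x \<le> s"
    then have x: "0 < x" using that by simp
    show "\<exists>y. (?D2 has_real_derivative y) (at x) \<and> y \<le> 0"
      using D2[OF x] K_pos(1)[OF scont_slice[OF cv x]] by (intro exI conjI) auto
  qed
  have D1pos: "0 \<le> ?D1 s" if "0 < s" for s
    by (rule K_pos(1)) (intro scont_slice cz that)
  have D1mono: "?D1 s \<le> ?D1 r" if "0 < r" "r \<le> s" for r s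
  proof (rule DERIV_nonpos_imp_nonincreasing[OF that(2)])
    fix x assume "r \<le> x" "x \<le> s"
    then have x: "0 < x" using that by simp
    show "\<exists>y. (?D1 has_real_derivative y) (at x) \<and> y \<le> 0"
      using D1[OF x] ip_nonneg[of "K (v x)"] by (intro exI conjI) auto
  qed
  have "\<exists>z>t - d. z < t \<and> ?D1 t - ?D1 (t - d) = (t - (t - d)) * (- 2 * ?D2 z)"
    by (rule MVT2) (use d t in \<open>auto intro!: D1[simplified]\<close>)
  then obtain z where z: "t - d < z" "z < t" "?D1 t - ?D1 (t - d) = d * (- 2 * ?D2 z)" by auto
  have "d * ?D2 t \<le> d * ?D2 z" using z d t by (intro mult_left_mono D2mono) auto
  moreover have "0 \<le> ?D1 t" using D1pos d t by simp
  ultimately have 1: "2 * d * ?D2 t \<le> ?D1 (t - d)" using z(3) by argo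
  have "\<exists>z>t - 2 * d. z < t - d \<and> ?D0 (t - d) - ?D0 (t - 2 * d) = (t - d - (t - 2 * d)) * (- 2 * ?D1 z)"
    by (rule MVT2) (use d t in \<open>auto intro!: D0[simplified]\<close>)
  then obtain z where z: "t - 2 * d < z" "z < t - d" "?D0 (t - d) - ?D0 (t - 2 * d) = d * (- 2 * ?D1 z)" by auto
  have "d * ?D1 (t - d) \<le> d * ?D1 z" using z d t by (intro mult_left_mono D1mono) auto
  moreover have "0 \<le> ?D0 (t - d)" by (rule ip_nonneg)
  ultimately have 2: "2 * d * ?D1 (t - d) \<le> ?D0 (t - 2 * d)" using z(3) by argo
  have "(2 * d * nrm (?z t))\<^sup>2 = 2 * d * (2 * d * ?D2 t)"
    by (simp add: power_mult_distrib nrm_sq) (simp add: power2_eq_square)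
  also have "\<dots> \<le> 2 * d * ?D1 (t - d)" using 1 d by (intro mult_left_mono) auto
  also have "\<dots> \<le> (nrm (?y (t - 2 * d)))\<^sup>2" using 2 by (simp add: nrm_sq)
  finally have "2 * d * nrm (?z t) \<le> nrm (?y (t - 2 * d))" by (rule power2_le_imp_le) simp
  then show ?thesis using d by (simp add: field_simps)
qed

text \<open>K commutes with difference quotients, and K v has the time derivative - v. An estimate
  for K of a solution, applied to \<open>dq h v\<close>, therefore becomes in the limit an estimate
  for v with one K fewer.\<close>

lemma sol_quotients:
  assumes v: "sol v"
  obtains q where "\<And>h r. 0 < r \<Longrightarrow> continuous_on {0..1} (q h r)"
    "\<And>r. 0 < r \<Longrightarrow> uniform_limit {0..1} (\<lambda>h. q h r) (\<lambda>x. - v r x) (at_right 0)"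
    "\<And>h r x. 0 < h \<Longrightarrow> 0 < r \<Longrightarrow> x \<in> {0..1} \<Longrightarrow> K (dq h v r) x = q h r x"
proof -
  have cv: "scont v" by (rule solD[OF v])
  have cK: "scont (\<lambda>t. K (v t))" and mv: "scont (\<lambda>t x. - v t x)" by (intro scont_K scont_minus cv)+
  \<comment> \<open>Only h > 0 matters for the limit; the other values make every member of the
    family continuous, as \<open>nrm_tendsto\<close> requires.\<close>
  define q where "q h r = (if 0 < h then dq h (\<lambda>t. K (v t)) r else (\<lambda>x. - v r x))" for h r
  show thesis
  proof (rule that)
    fix h r :: real assume r: "0 < r"
    show "continuous_on {0..1} (q h r)"
      using r unfolding q_def by (auto intro!: scont_slice scont_dq cK mv)
    have "\<forall>\<^sub>F h in at_right 0. \<forall>x\<in>{0..1}. dq h (\<lambda>t. K (v t)) r x = q h r x"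
      using eventually_at_right_less by eventually_elim (simp add: q_def)
    from uniform_limit_cong[OF this refl] dq_unif[OF solD(2)[OF v] mv r]
    show "uniform_limit {0..1} (\<lambda>h. q h r) (\<lambda>x. - v r x) (at_right 0)" by blast
  qed (simp add: q_def K_dq[OF cv])
qed

text \<open>\<open>smoothing1\<close> for \<open>dq h v\<close>, in the limit h \<rightarrow>
  0.\<close>

lemma smoothing2:
  assumes v: "sol v" and d: "0 < d" and t: "2 * d < t"
  shows "nrm (v t) \<le> nrm (K (v (t - 2 * d))) / (2 * d)"
proof -
  let ?s = "t - 2 * d"
  have s: "0 < ?s" and t0: "0 < t" using d t by auto
  have cv: "scont v" by (rule solD[OF v])
  have cK: "scont (\<lambda>t. K (v t))" and mv: "scont (\<lambda>t x. - v t x)" by (intro scont_K scont_minus cv)+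
  obtain q where cq: "\<And>h r. 0 < r \<Longrightarrow> continuous_on {0..1} (q h r)"
    and uq: "\<And>r. 0 < r \<Longrightarrow> uniform_limit {0..1} (\<lambda>h. q h r) (\<lambda>x. - v r x) (at_right 0)"
    and q: "\<And>h r x. 0 < h \<Longrightarrow> 0 < r \<Longrightarrow> x \<in> {0..1} \<Longrightarrow> K (dq h v r) x = q h r x"
    by (rule sol_quotients[OF v]) blast
  have ev: "\<forall>\<^sub>F h in at_right (0::real). 0 < h" by (simp add: eventually_at_right_less)
  have cm: "continuous_on {0..1} (\<lambda>x. - v r x)" if "0 < r" for r by (rule scont_slice[OF mv that])
  have L: "((\<lambda>h. nrm (q h t)) \<longlongrightarrow> nrm (\<lambda>x. - v t x)) (at_right 0)"
    by (rule nrm_tendsto[OF uq[OF t0] cq[OF t0] cm[OF t0]])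
  have R: "((\<lambda>h. nrm (K (q h ?s)) / (2 * d)) \<longlongrightarrow> nrm (K (\<lambda>x. - v ?s x)) / (2 * d)) (at_right 0)"
    by (intro tendsto_divide tendsto_const nrm_tendsto K_uniform_limit uq K_cont cq cm s) (use d in auto)
  have "nrm (\<lambda>x. - v t x) \<le> nrm (K (\<lambda>x. - v ?s x)) / (2 * d)"
  proof (rule tendsto_le[OF _ R L])
    show "\<forall>\<^sub>F h in at_right 0. nrm (q h t) \<le> nrm (K (q h ?s)) / (2 * d)"
      using ev
    proof eventually_elim
      case (elim h)
      have 1: "nrm (K (dq h v t)) \<le> nrm (K (K (dq h v ?s))) / (2 * d)"
        by (rule smoothing1[OF sol_dq[OF v elim] d t])
      have 2: "nrm (K (dq h v t)) = nrm (q h t)"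
        by (rule nrm_cong) (simp only: q[OF elim t0])
      have 3: "nrm (K (K (dq h v ?s))) = nrm (K (q h ?s))"
        by (intro nrm_cong K_cong) (simp_all only: q[OF elim s])
      show ?case using 1 unfolding 2 3 .
    qed
  qed simp
  then show ?thesis by (simp add: K_minus[abs_def])
qed

text \<open>Since - v is the limit of \<open>K (dq h v)\<close>, the sup bound for K leads to the
  L^2 norm of \<open>dq h v\<close>; \<open>smoothing2\<close> bounds it by
  \<open>K (dq h v)\<close> at an earlier time, which is again close to - v. A second use of
  \<open>smoothing2\<close> brings in \<open>K v\<close>. Each use costs the time 2 d and a factor 1
  / (2 d).\<close>

lemma smoothing3:
  assumes v: "sol v" and d: "0 < d" and t: "4 * d < t" and x: "x \<in> {0..1}"
  shows "\<bar>v t x\<bar> \<le> (1 + A + B) / (2 * d)\<^sup>2 * nrm (K (v (t - 4 * d)))"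
proof -
  let ?s = "t - 2 * d"
  have s: "0 < ?s" "2 * d < ?s" and t0: "0 < t" "2 * d < t" using d t by auto
  have cv: "scont v" by (rule solD[OF v])
  have cK: "scont (\<lambda>t. K (v t))" and mv: "scont (\<lambda>t x. - v t x)" by (intro scont_K scont_minus cv)+
  obtain q where cq: "\<And>h r. 0 < r \<Longrightarrow> continuous_on {0..1} (q h r)"
    and uq: "\<And>r. 0 < r \<Longrightarrow> uniform_limit {0..1} (\<lambda>h. q h r) (\<lambda>x. - v r x) (at_right 0)"
    and q: "\<And>h r x. 0 < h \<Longrightarrow> 0 < r \<Longrightarrow> x \<in> {0..1} \<Longrightarrow> K (dq h v r) x = q h r x"
    by (rule sol_quotients[OF v]) blast
  have ev: "\<forall>\<^sub>F h in at_right (0::real). 0 < h" by (simp add: eventually_at_right_less)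
  have cm: "continuous_on {0..1} (\<lambda>x. - v r x)" if "0 < r" for r by (rule scont_slice[OF mv that])
  have L: "((\<lambda>h. \<bar>q h t x\<bar>) \<longlongrightarrow> \<bar>- v t x\<bar>) (at_right 0)"
    by (intro tendsto_rabs tendsto_uniform_limitI[OF uq[OF t0(1)] x])
  have R: "((\<lambda>h. (1 + A + B) / (2 * d) * nrm (q h ?s)) \<longlongrightarrow> (1 + A + B) / (2 * d) * nrm (\<lambda>x. - v ?s x)) (at_right 0)"
    by (intro tendsto_mult tendsto_const nrm_tendsto uq cq cm s)
  have "\<bar>- v t x\<bar> \<le> (1 + A + B) / (2 * d) * nrm (\<lambda>x. - v ?s x)"
  proof (rule tendsto_le[OF _ R L])
    show "\<forall>\<^sub>F h in at_right 0. \<bar>q h t x\<bar> \<le> (1 + A + B) / (2 * d) * nrm (q h ?s)"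
      using ev
    proof eventually_elim
      case (elim h)
      have "\<bar>K (dq h v t) x\<bar> \<le> (1 + A + B) * nrm (dq h v t)"
        by (intro K_bounds x scont_slice scont_dq cv elim t0)
      also have "\<dots> \<le> (1 + A + B) * (nrm (K (dq h v ?s)) / (2 * d))"
        by (intro mult_left_mono smoothing2 sol_dq v elim d t0) (use S_pos in simp)
      also have "nrm (K (dq h v ?s)) = nrm (q h ?s)"
        by (intro nrm_cong) (simp_all only: q[OF elim s(1)])
      also have "K (dq h v t) x = q h t x" by (rule q[OF elim t0(1) x])
      finally show ?case by simp
    qed
  qed simp
  also have "\<dots> \<le> (1 + A + B) / (2 * d) * (nrm (K (v (?s - 2 * d))) / (2 * d))"
    unfolding nrm_minus using S_pos d by (intro mult_left_mono smoothing2 v s) auto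
  finally show ?thesis using d by (simp add: power2_eq_square)
qed

section \<open>Time and space derivatives of solutions\<close>

definition sol_deriv :: "(real \<Rightarrow> real \<Rightarrow> real) \<Rightarrow> (real \<Rightarrow> real \<Rightarrow> real) \<Rightarrow> bool"
  where "sol_deriv w w' \<longleftrightarrow> sol w \<and> sol w' \<and> tder w w' \<and>
    (\<forall>t>0. \<forall>x\<in>{0..1}. K (w' t) x = - w t x)"

lemma sol_derivD:
  assumes "sol_deriv w w'"
  shows "sol w" "sol w'" "tder w w'" "0 < t \<Longrightarrow> x \<in> {0..1} \<Longrightarrow> K (w' t) x = - w t x"
  using assms by (simp_all add: sol_deriv_def)

text \<open>The difference of two difference quotients is a solution, and \<open>smoothing3\<close>
  bounds it by the same difference for \<open>K w\<close>, which is small because \<open>K w\<close>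
  has a continuous time derivative. So the quotients converge locally uniformly.\<close>

lemma sol_time_deriv:
  assumes w: "sol w"
  obtains w' where "sol_deriv w w'"
proof -
  define hh where "hh n = inverse (real (Suc n))" for n
  have hpos: "0 < hh n" for n by (simp add: hh_def)
  have hlim: "filterlim hh (at_right 0) sequentially"
    unfolding hh_def filterlim_at using LIMSEQ_inverse_real_of_nat
    by (auto simp del: of_nat_Suc)
  have cw: "scont w" and dKw: "tder (\<lambda>t. K (w t)) (\<lambda>t x. - w t x)" using solD[OF w] by auto
  have mw: "scont (\<lambda>t x. - w t x)" by (rule scont_minus[OF cw])
  define Q where "Q n p = dq (hh n) w (fst p) (snd p)" for n and p :: "real \<times> real"
  have cauchy: "uniformly_Cauchy_on ({a..b} \<times> {0..1}) Q" if a: "0 < a" for a b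
    unfolding uniformly_Cauchy_on_def
  proof (intro allI impI)
    fix e :: real assume e: "0 < e"
    \<comment> \<open>\<open>smoothing3\<close> with d = a / 8 looks back by a / 2, so from times in
      [a, b] it stays above a / 2.\<close>
    define C where "C = (1 + A + B) / (2 * (a / 8))\<^sup>2"
    have C: "0 < C" unfolding C_def using S_pos a by (intro divide_pos_pos) auto
    \<comment> \<open>Each quotient contributes e', and C (2 e') = e / 2.\<close>
    define e' where "e' = e / (4 * C)"
    have e': "0 < e'" using e C by (simp add: e'_def)
    from dq_unif_compact[OF dKw mw half_gt_zero[OF a] e', of b] obtain h0 where h0: "0 < h0"
      "\<And>h t x. 0 < h \<Longrightarrow> h < h0 \<Longrightarrow> t \<in> {a / 2..b} \<Longrightarrow> x \<in> {0..1} \<Longrightarrow> \<bar>dq h (\<lambda>t. K (w t)) t x - - w t x\<bar> < e'"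
      by metis
    have "\<forall>\<^sub>F n in sequentially. hh n < h0"
      unfolding hh_def using order_tendstoD(2)[OF LIMSEQ_inverse_real_of_nat h0(1)] .
    then obtain M where M: "\<And>n. M \<le> n \<Longrightarrow> hh n < h0" by (auto simp: eventually_sequentially)
    show "\<exists>M. \<forall>p\<in>{a..b} \<times> {0..1}. \<forall>m\<ge>M. \<forall>n\<ge>M. dist (Q m p) (Q n p) < e"
    proof (intro exI[of _ M] ballI allI impI)
      fix p :: "real \<times> real" and m n assume p: "p \<in> {a..b} \<times> {0..1}" and m: "M \<le> m" and n: "M \<le> n"
      obtain t x where tx: "p = (t, x)" "t \<in> {a..b}" "x \<in> {0..1}" using p by auto
      let ?v = "\<lambda>t x. dq (hh m) w t x - dq (hh n) w t x" and ?s = "t - 4 * (a / 8)"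
      have s: "0 < ?s" "?s \<in> {a / 2..b}" using tx a by auto
      have v: "sol ?v" by (intro sol_diff sol_dq w hpos)
      have "\<bar>?v t x\<bar> \<le> C * nrm (K (?v ?s))"
        unfolding C_def by (rule smoothing3[OF v _ _ tx(3)]) (use a tx in auto)
      also have "nrm (K (?v ?s)) \<le> 2 * e'"
      proof (rule nrm_le_sup)
        show "continuous_on {0..1} (K (?v ?s))" by (intro K_cont scont_slice solD v s)
        fix y :: real assume y: "y \<in> {0..1}"
        have "K (?v ?s) y = dq (hh m) (\<lambda>t. K (w t)) ?s y - dq (hh n) (\<lambda>t. K (w t)) ?s y"
          using s y by (subst K_diff) (auto simp: K_dq[OF cw hpos] intro!: scont_slice scont_dq cw hpos)
        then show "\<bar>K (?v ?s) y\<bar> \<le> 2 * e'"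
          using h0(2)[OF hpos M[OF m] s(2) y] h0(2)[OF hpos M[OF n] s(2) y] by linarith
      qed
      also have "C * (2 * e') = e / 2" using C by (simp add: e'_def)
      finally have "\<bar>?v t x\<bar> \<le> e / 2" using C by simp
      then show "dist (Q m p) (Q n p) < e" using e by (simp add: Q_def tx dist_real_def)
    qed
  qed
  define w' where "w' t x = lim (\<lambda>n. Q n (t, x))" for t x
  have ul: "uniform_limit ({a..b} \<times> {0..1}) Q (\<lambda>p. w' (fst p) (snd p)) sequentially" if "0 < a" for a b
    using Cauchy_uniformly_convergent[OF cauchy[OF that, of b]]
    unfolding uniformly_convergent_uniform_limit_iff w'_def by simp
  have cw': "scont w'"
  proof (rule scont_local)
    fix a b :: real assume a: "0 < a" and "a < b"
    show "continuous_on ({a..b} \<times> {0..1}) (\<lambda>(t, x). w' t x)"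
      unfolding split_beta
    proof (rule uniform_limit_theorem[OF _ ul[OF a]])
      show "\<forall>\<^sub>F n in sequentially. continuous_on ({a..b} \<times> {0..1}) (Q n)"
        unfolding Q_def
        by (intro always_eventually allI scont_comp[OF scont_dq[OF cw hpos]]) (use a in \<open>auto intro!: continuous_intros\<close>)
    qed simp
  qed
  have ulx: "uniform_limit {0..1} (\<lambda>n. dq (hh n) w t) (w' t) sequentially" if "0 < t" for t
    unfolding uniform_limit_iff
  proof (intro allI impI)
    fix e :: real assume "0 < e"
    from uniform_limitD[OF ul[OF that, of t] this]
    show "\<forall>\<^sub>F n in sequentially. \<forall>x\<in>{0..1}. dist (dq (hh n) w t x) (w' t x) < e"
      by eventually_elim (auto simp: Q_def)
  qed
  have dKlim: "(\<lambda>n. dq (hh n) (\<lambda>t. K (w t)) t x) \<longlonglongrightarrow> - w t x" if "0 < t" "x \<in> {0..1}" for t x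
    using tendsto_uniform_limitI[OF dq_unif[OF dKw mw that(1)] that(2)] hlim by (rule filterlim_compose)
  have Kw': "K (w' t) x = - w t x" if t: "0 < t" and x: "x \<in> {0..1}" for t x
  proof (rule LIMSEQ_unique[OF _ dKlim[OF t x]])
    have "(\<lambda>n. K (dq (hh n) w t) x) \<longlonglongrightarrow> K (w' t) x"
      by (rule tendsto_uniform_limitI[OF K_uniform_limit(1)[OF ulx[OF t]] x])
        (intro scont_slice scont_dq cw cw' hpos t)+
    then show "(\<lambda>n. dq (hh n) (\<lambda>t. K (w t)) t x) \<longlonglongrightarrow> K (w' t) x"
      using K_dq[OF cw hpos t x] by simp
  qed
  have d: "tder w w'"
    unfolding tder_def
  proof (intro allI impI ballI)
    fix t x :: real assume t: "0 < t" and x: "x \<in> {0..1}"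
    let ?S = "{t / 2<..<2 * t}"
    have tS: "t \<in> ?S" using t by simp
    \<comment> \<open>Convergence of one-sided quotients along a sequence of steps does not yet give
      a derivative. But the functions \<open>dq (hh n) (\<lambda>t. K (w t))\<close> tend to - w
      while their time derivatives, minus the quotients of w, tend uniformly to - w', so the limit
      can be differentiated.\<close>
    have "\<exists>g. \<forall>s\<in>?S. (\<lambda>n. dq (hh n) (\<lambda>t. K (w t)) s x) \<longlonglongrightarrow> g s \<and>
        (g has_derivative (\<lambda>h. - w' s x * h)) (at s within ?S)"
    proof (rule has_derivative_sequence[where ?x0.0 = t])
      show "(\<lambda>n. dq (hh n) (\<lambda>t. K (w t)) t x) \<longlonglongrightarrow> - w t x" by (rule dKlim[OF t x])
    next
      fix n s assume s: "s \<in> ?S"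
      then have s0: "0 < s" using t by auto
      show "((\<lambda>s. dq (hh n) (\<lambda>t. K (w t)) s x) has_derivative (\<lambda>h. - dq (hh n) w s x * h)) (at s within ?S)"
        using tderD[OF tder_dq[OF dKw hpos] s0 x, of n]
        by (auto simp: has_field_derivative_def dq_def diff_divide_distrib intro: has_derivative_at_withinI)
    next
      fix e :: real assume e: "0 < e"
      from uniform_limitD[OF ul[OF half_gt_zero[OF t], of "2 * t"] e]
      show "\<forall>\<^sub>F n in sequentially. \<forall>s\<in>?S. \<forall>h. norm (- dq (hh n) w s x * h - - w' s x * h) \<le> e * norm h"
      proof eventually_elim
        case (elim n)
        show ?case
        proof (intro ballI allI)
          fix s h :: real assume s: "s \<in> ?S"
          have "\<bar>w' s x - dq (hh n) w s x\<bar> \<le> e"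
            using elim[rule_format, of "(s, x)"] s x by (simp add: Q_def dist_real_def)
          then have "\<bar>w' s x - dq (hh n) w s x\<bar> * \<bar>h\<bar> \<le> e * \<bar>h\<bar>" by (rule mult_right_mono) simp
          moreover have "- dq (hh n) w s x * h - - w' s x * h = (w' s x - dq (hh n) w s x) * h"
            by (simp add: left_diff_distrib)
          ultimately show "norm (- dq (hh n) w s x * h - - w' s x * h) \<le> e * norm h"
            by (simp only: real_norm_def abs_mult)
        qed
      qed
    qed (use t in simp_all)
    then obtain g where g: "\<And>s. s \<in> ?S \<Longrightarrow> (\<lambda>n. dq (hh n) (\<lambda>t. K (w t)) s x) \<longlonglongrightarrow> g s"
      "\<And>s. s \<in> ?S \<Longrightarrow> (g has_derivative (\<lambda>h. - w' s x * h)) (at s within ?S)" by blast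
    have gw: "g s = - w s x" if "s \<in> ?S" for s
      using LIMSEQ_unique[OF g(1)[OF that] dKlim[of s x]] that t x by auto
    have "(g has_real_derivative - w' t x) (at t)"
      using g(2)[OF tS] unfolding has_field_derivative_def at_within_open[OF tS open_greaterThanLessThan] .
    then have "((\<lambda>s. - w s x) has_real_derivative - w' t x) (at t)"
      by (rule has_field_derivative_transform_within_open[OF _ open_greaterThanLessThan tS gw])
    from DERIV_minus[OF this] show "((\<lambda>s. w s x) has_real_derivative w' t x) (at t)" by simp
  qed
  have "sol w'"
    unfolding sol_def using cw' tder_cong[OF tder_minus[OF d], of "\<lambda>t. K (w' t)" "\<lambda>t x. - w' t x"]
    by (simp add: Kw')
  with w d Kw' have "sol_deriv w w'" by (simp add: sol_deriv_def)
  then show ?thesis by (rule that)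
qed

text \<open>All four facts are read off from w = - K w'.\<close>

lemma sol_space_deriv:
  assumes w: "sol_deriv w w'" and t: "0 < t"
  shows "x \<in> {0..1} \<Longrightarrow> (w t has_real_derivative - K1 (w' t) x) (at x within {0..1})"
    "x \<in> {0..1} \<Longrightarrow> ((\<lambda>x. - K1 (w' t) x) has_real_derivative w' t x) (at x within {0..1})"
    "- K1 (w' t) 0 = w t 0 / A" "- K1 (w' t) 1 = - w t 1 / B"
proof -
  have c: "continuous_on {0..1} (w' t)" by (intro scont_slice solD sol_derivD(2)[OF w] t)
  show "(w t has_real_derivative - K1 (w' t) x) (at x within {0..1})" if x: "x \<in> {0..1}" for x
    by (rule has_field_derivative_transform_within[OF DERIV_minus[OF K_deriv[OF c x]] zero_less_one x])
      (simp add: sol_derivD(4)[OF w t])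
  show "((\<lambda>x. - K1 (w' t) x) has_real_derivative w' t x) (at x within {0..1})" if x: "x \<in> {0..1}" for x
    using DERIV_minus[OF K1_deriv[OF c x]] by simp
  show "- K1 (w' t) 0 = w t 0 / A" "- K1 (w' t) 1 = - w t 1 / B"
    using K_bdry[of "w' t"] sol_derivD(4)[OF w t, of 0] sol_derivD(4)[OF w t, of 1] by simp_all
qed

end

section \<open>The initial layer\<close>

lemma deriv01_unique:
  assumes "(f has_real_derivative a) (at x within {0..1})" "(f has_real_derivative b) (at x within {0..1})" "x \<in> {0..1}"
  shows "a = b"
proof -
  have "at x within {0..1} \<noteq> bot"
    using assms(3) by (auto simp: trivial_limit_within islimpt_Icc)
  then show ?thesis
    using vector_derivative_unique_within[of x "{0..1}" f a b] assms(1,2)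
    by (simp add: has_real_derivative_iff_has_vector_derivative)
qed

lemma ip_tendsto:
  assumes u: "uniform_limit {0..1} f g F" and f: "\<And>n. continuous_on {0..1} (f n)" and g: "continuous_on {0..1} g"
    and h: "continuous_on {0..1} h"
  shows "((\<lambda>n. ip (f n) h) \<longlongrightarrow> ip g h) F"
proof -
  have u0: "uniform_limit {0..1} (\<lambda>n x. f n x - g x) (\<lambda>x. 0) F"
    using u by (simp add: uniform_limit_iff dist_real_def)
  have "((\<lambda>n. nrm (\<lambda>x. f n x - g x)) \<longlongrightarrow> nrm (\<lambda>x. 0)) F"
    by (rule nrm_tendsto[OF u0]) (intro continuous_intros f g)+
  then have "((\<lambda>n. nrm (\<lambda>x. f n x - g x) * nrm h) \<longlongrightarrow> 0) F"
    by (intro tendsto_mult_left_zero) (simp add: nrm_def ip_def)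
  then have "((\<lambda>n. ip (f n) h - ip g h) \<longlongrightarrow> 0) F"
  proof (rule Lim_null_comparison[rotated], intro always_eventually allI)
    fix n
    show "norm (ip (f n) h - ip g h) \<le> nrm (\<lambda>x. f n x - g x) * nrm h"
      unfolding real_norm_def ip_diff[OF f g h, symmetric] by (intro cauchy_schwarz continuous_intros f g h)
  qed
  then show ?thesis by (simp add: LIM_zero_iff)
qed

text \<open>The difference of the squares at two points is the integral of 2 f f'; average over the
  second point. The bound is small as soon as f is small in L^2 and f' merely bounded, which is how
  it is used for interpolation.\<close>

lemma sobolev:
  assumes f: "continuous_on {0..1} f'" and d: "\<And>x. x \<in> {0..1} \<Longrightarrow> (f has_real_derivative f' x) (at x within {0..1})"
    and x: "x \<in> {0..1}"
  shows "(f x)\<^sup>2 \<le> ip f f + 2 * nrm f * nrm f'"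
proof -
  have cf: "continuous_on {0..1} f" by (rule DERIV_continuous_on[OF d])
  have ci: "continuous_on {0..1} (\<lambda>z. f z * f' z)" by (intro continuous_intros cf f)
  have le: "(f b)\<^sup>2 - (f a)\<^sup>2 \<le> 2 * nrm f * nrm f' \<and> (f a)\<^sup>2 - (f b)\<^sup>2 \<le> 2 * nrm f * nrm f'"
    if ab: "a \<in> {0..1}" "b \<in> {0..1}" "a \<le> b" for a b
  proof -
    have sub: "{a..b} \<subseteq> {0..1}" using ab by auto
    have "((\<lambda>z. 2 * (f z * f' z)) has_integral (f b)\<^sup>2 - (f a)\<^sup>2) {a..b}"
    proof (rule fundamental_theorem_of_calculus[OF ab(3)])
      fix z assume "z \<in> {a..b}"
      then have z: "z \<in> {0..1}" using sub by auto
      have "((\<lambda>z. (f z)\<^sup>2) has_real_derivative 2 * (f z * f' z)) (at z within {a..b})"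
        using DERIV_subset[OF d[OF z] sub] by (auto intro!: derivative_eq_intros)
      then show "((\<lambda>z. (f z)\<^sup>2) has_vector_derivative 2 * (f z * f' z)) (at z within {a..b})"
        by (simp add: has_real_derivative_iff_has_vector_derivative)
    qed
    then have eq: "(f b)\<^sup>2 - (f a)\<^sup>2 = 2 * integral {a..b} (\<lambda>z. f z * f' z)"
      by (metis integral_unique integral_mult_right)
    have "\<bar>integral {a..b} (\<lambda>z. f z * f' z)\<bar> \<le> integral {a..b} (\<lambda>z. \<bar>f z\<bar> * \<bar>f' z\<bar>)"
      unfolding real_norm_def[symmetric]
      by (intro integral_norm_bound_integral integrable_continuous_interval continuous_on_subset[OF ci sub])
        (auto intro!: continuous_intros continuous_on_subset[OF cf sub] continuous_on_subset[OF f sub] simp: abs_mult)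
    also have "\<dots> \<le> ip (\<lambda>z. \<bar>f z\<bar>) (\<lambda>z. \<bar>f' z\<bar>)"
      unfolding ip_def
      by (intro integral_subset_le sub integrable_continuous_interval)
        (auto intro!: continuous_intros cf f continuous_on_subset[OF cf sub] continuous_on_subset[OF f sub])
    also have "\<dots> \<le> nrm (\<lambda>z. \<bar>f z\<bar>) * nrm (\<lambda>z. \<bar>f' z\<bar>)"
      using cauchy_schwarz[OF continuous_on_rabs[OF cf] continuous_on_rabs[OF f]] by simp
    also have "\<dots> = nrm f * nrm f'" by (simp add: nrm_def ip_def)
    finally show ?thesis using eq by (simp add: abs_le_iff)
  qed
  have "integral {0..1} (\<lambda>y::real. (f x)\<^sup>2) \<le> integral {0..1} (\<lambda>y. f y * f y + 2 * nrm f * nrm f')"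
  proof (rule integral_le)
    fix y :: real assume y: "y \<in> {0..1}"
    then have "(f x)\<^sup>2 - (f y)\<^sup>2 \<le> 2 * nrm f * nrm f'"
      using le[OF x y] le[OF y x] by linarith
    then show "(f x)\<^sup>2 \<le> f y * f y + 2 * nrm f * nrm f'" by (simp add: power2_eq_square)
  qed (intro integrable_continuous_interval continuous_intros cf)+
  also have "\<dots> = ip f f + 2 * nrm f * nrm f'"
    unfolding ip_def by (subst integral_add) (auto intro!: integrable_continuous_interval continuous_intros cf)
  finally show ?thesis by simp
qed

text \<open>Proved for the Steklov averages of \<open>\<kappa>\<close> first.\<close>

lemma lipschitz_by_parts:
  fixes \<kappa> m m' :: "real \<Rightarrow> real"
  assumes lip: "\<And>x y. x \<in> {0..1} \<Longrightarrow> y \<in> {0..1} \<Longrightarrow> \<bar>\<kappa> x - \<kappa> y\<bar> \<le> L * \<bar>x - y\<bar>"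
    and m: "\<And>x. x \<in> {0..1} \<Longrightarrow> (m has_real_derivative m' x) (at x within {0..1})"
    and m': "continuous_on {0..1} m'"
  shows "\<bar>ip \<kappa> m' - (\<kappa> 1 * m 1 - \<kappa> 0 * m 0)\<bar> \<le> L * nrm m"
proof -
  have L: "0 \<le> L" using lip[of 0 1] by simp
  have cm: "continuous_on {0..1} m" by (rule DERIV_continuous_on[OF m])
  \<comment> \<open>Clamping extends \<kappa> to the line with the same Lipschitz constant, so that
    averages over [x, x + h] make sense up to x = 1.\<close>
  define cl where "cl y = max 0 (min 1 y)" for y :: real
  have cl: "cl y \<in> {0..1}" "\<bar>cl x - cl y\<bar> \<le> \<bar>x - y\<bar>" for x y by (auto simp: cl_def)
  have clid: "x \<in> {0..1} \<Longrightarrow> cl x = x" for x by (auto simp: cl_def)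
  define k where "k y = \<kappa> (cl y)" for y
  have klip: "\<bar>k x - k y\<bar> \<le> L * \<bar>x - y\<bar>" for x y
    unfolding k_def using lip[OF cl(1) cl(1), of x y] mult_left_mono[OF cl(2) L, of x y] by linarith
  have ck: "continuous_on S k" for S
  proof (rule continuous_on_subset[OF lipschitz_on_continuous_on])
    show "L-lipschitz_on UNIV k" using klip L by (auto simp: lipschitz_on_def dist_real_def)
  qed simp
  have ck01: "continuous_on {0..1} k" by (rule ck)
  \<comment> \<open>C h collects the errors from replacing the average by \<open>k\<close> in the
    inner product and in both boundary terms.\<close>
  define C where "C = L * nrm m' + L * \<bar>m 1\<bar> + L * \<bar>m 0\<bar>"
  have C: "0 \<le> C" using L by (auto simp: C_def)
  have main: "\<bar>ip k m' - (k 1 * m 1 - k 0 * m 0)\<bar> \<le> L * nrm m + C * h" if h: "0 < h" "h < 1" for h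
  proof -
    define P where "P x = integral {-1..x} k" for x
    have dP: "(P has_real_derivative k x) (at x)" if "-1 < x" "x < 3" for x
    proof -
      have "(P has_real_derivative k x) (at x within {-1..3})"
        unfolding P_def has_real_derivative_iff_has_vector_derivative
        by (rule integral_has_vector_derivative[OF ck]) (use that in auto)
      then show ?thesis using that by (simp add: at_within_Icc_at)
    qed
    define s where "s x = (P (x + h) - P x) / h" for x
    define s' where "s' x = (k (x + h) - k x) / h" for x
    have ds: "(s has_real_derivative s' x) (at x within {0..1})" if x: "x \<in> {0..1}" for x
    proof -
      have "((\<lambda>x. P (x + h)) has_real_derivative k (x + h)) (at x)"
        using dP[of "x + h"] x h by (simp add: DERIV_shift)
      moreover have "(P has_real_derivative k x) (at x)" using dP x by simp
      ultimately have "(s has_real_derivative s' x) (at x)"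
        unfolding s_def[abs_def] s'_def by (intro DERIV_cdivide DERIV_diff)
      then show ?thesis by (rule has_field_derivative_at_within)
    qed
    have cs: "continuous_on {0..1} s" by (rule DERIV_continuous_on[OF ds])
    have cs': "continuous_on {0..1} s'"
      unfolding s'_def using h by (intro continuous_intros continuous_on_compose2[OF ck[of UNIV]]) auto
    have sk: "\<bar>s x - k x\<bar> \<le> L * h" if x: "x \<in> {0..1}" for x
    proof -
      have "\<exists>z>x. z < x + h \<and> P (x + h) - P x = (x + h - x) * k z"
        by (rule MVT2) (use h x in \<open>auto intro!: dP\<close>)
      then obtain z where z: "x < z" "z < x + h" "P (x + h) - P x = h * k z" by auto
      then have "s x = k z" using h by (simp add: s_def)
      then show ?thesis using klip[of z x] mult_left_mono[of "\<bar>z - x\<bar>" h L] z L by auto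
    qed
    have s'b: "\<bar>s' x\<bar> \<le> L" for x
      using klip[of "x + h" x] h by (simp add: s'_def abs_divide pos_divide_le_eq)
    have "((\<lambda>x. s' x * m x + s x * m' x) has_integral s 1 * m 1 - s 0 * m 0) {0..1}"
    proof (rule fundamental_theorem_of_calculus)
      fix x :: real assume x: "x \<in> {0..1}"
      show "((\<lambda>x. s x * m x) has_vector_derivative s' x * m x + s x * m' x) (at x within {0..1})"
        unfolding has_real_derivative_iff_has_vector_derivative[symmetric]
        using DERIV_mult[OF ds[OF x] m[OF x]] by (simp add: mult.commute)
    qed simp
    then have "integral {0..1} (\<lambda>x. s' x * m x + s x * m' x) = s 1 * m 1 - s 0 * m 0" by (rule integral_unique)
    then have ibp: "ip s' m + ip s m' = s 1 * m 1 - s 0 * m 0"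
      unfolding ip_def
      by (subst (asm) integral_add) (auto intro!: integrable_continuous_interval continuous_intros cs cs' cm m')
    have b0: "\<bar>ip s' m\<bar> \<le> L * nrm m"
    proof (rule order_trans[OF cauchy_schwarz[OF cs' cm]])
      show "nrm s' * nrm m \<le> L * nrm m" by (intro mult_right_mono nrm_le_sup cs' s'b) simp
    qed
    have b1: "\<bar>ip s m' - ip k m'\<bar> \<le> L * h * nrm m'"
      unfolding ip_diff[OF cs ck01 m', symmetric]
    proof (rule order_trans[OF cauchy_schwarz])
      show "nrm (\<lambda>x. s x - k x) * nrm m' \<le> L * h * nrm m'"
        by (intro mult_right_mono nrm_le_sup continuous_intros cs ck sk) auto
    qed (intro continuous_intros cs ck m')+
    have b2: "\<bar>s 1 * m 1 - k 1 * m 1\<bar> \<le> L * h * \<bar>m 1\<bar>" "\<bar>s 0 * m 0 - k 0 * m 0\<bar> \<le> L * h * \<bar>m 0\<bar>"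
      unfolding left_diff_distrib[symmetric] abs_mult by (intro mult_right_mono sk; simp)+
    have "C * h = L * h * nrm m' + L * h * \<bar>m 1\<bar> + L * h * \<bar>m 0\<bar>" by (simp add: C_def algebra_simps)
    then show ?thesis using ibp b0 b1 b2 by linarith
  qed
  have "\<bar>ip k m' - (k 1 * m 1 - k 0 * m 0)\<bar> \<le> L * nrm m"
  proof (rule field_le_epsilon)
    fix e :: real assume e: "0 < e"
    define h where "h = min (1/2) (e / (C + 1))"
    have h: "0 < h" "h < 1" using e C by (auto simp: h_def)
    have "C * h \<le> (C + 1) * (e / (C + 1))" using C e by (intro mult_mono) (auto simp: h_def)
    also have "\<dots> = e" using C by simp
    finally show "\<bar>ip k m' - (k 1 * m 1 - k 0 * m 0)\<bar> \<le> L * nrm m + e" using main[OF h] by linarith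
  qed
  moreover have "ip k m' = ip \<kappa> m'" by (rule ip_cong) (simp_all add: k_def clid)
  ultimately show ?thesis by (simp add: k_def clid)
qed

section \<open>Convergence to the initial datum in C^1\<close>

context robin
begin

text \<open>The energy inequality forces \<open>K1 g\<close> to vanish, and its derivative is -
  g.\<close>

lemma K_inj:
  assumes g: "continuous_on {0..1} g" and K0: "\<And>x. x \<in> {0..1} \<Longrightarrow> K g x = 0" and x: "x \<in> {0..1}"
  shows "g x = 0"
proof -
  have "ip (K g) g = ip (\<lambda>x. 0) g" by (rule ip_cong) (simp_all add: K0)
  then have "ip (K g) g = 0" by (simp add: ip_def)
  then have "ip (K1 g) (K1 g) = 0" using K_pos(2)[OF g] ip_nonneg[of "K1 g"] by simp
  then have K1: "K1 g y = 0" if "y \<in> {0..1}" for y by (rule ip_eq_0D[OF K1_cont[OF g] _ that])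
  have "((\<lambda>_. 0) has_real_derivative - g x) (at x within {0..1})"
    by (rule has_field_derivative_transform_within[OF K1_deriv[OF g x] zero_less_one x]) (simp add: K1)
  from deriv01_unique[OF this DERIV_const x] show ?thesis by simp
qed

text \<open>Self-adjointness of the evolution. The derivative in r of the pairing of a(r) with b(T -
  r) is the pairing of a' with b minus that of a with b'; it vanishes because a = - K a', b = - K b'
  and K is symmetric. So time can be moved from one factor to the other.\<close>

lemma sol_diag:
  assumes a': "sol_deriv a a'" and b': "sol_deriv b b'"
    and pos: "0 < t" "0 < s" "0 < t'" "0 < s'" and eq: "t + s = t' + s'"
  shows "ip (a t) (b s) = ip (a t') (b s')"
proof -
  let ?T = "t + s" and ?U = "{0<..<t + s}"
  note a = sol_derivD[OF a'] and b = sol_derivD[OF b']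
  note c = a(1,2)[THEN solD(1)] b(1,2)[THEN solD(1)]
  have "\<exists>c. \<forall>r\<in>?U. ip (a r) (b (?T - r)) = c"
  proof (rule has_field_derivative_zero_constant)
    fix r assume r: "r \<in> ?U"
    have "((\<lambda>r. integral (cbox 0 1) (\<lambda>x. a r x * b (?T - r) x)) has_real_derivative
        integral (cbox 0 1) (\<lambda>x. a' r x * b (?T - r) x - a r x * b' (?T - r) x)) (at r within ?U)"
    proof (rule leibniz_rule_field_derivative)
      fix r x :: real assume r: "r \<in> ?U" and x: "x \<in> cbox 0 1"
      have 1: "((\<lambda>r. a r x) has_real_derivative a' r x) (at r)"
        using tderD[OF a(3)] r x by auto
      have "((\<lambda>r. b (?T - r) x) has_real_derivative b' (?T - r) x * (- 1)) (at r)"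
        by (rule DERIV_chain'[OF _ tderD[OF b(3)]]) (use r x in \<open>auto intro!: derivative_eq_intros\<close>)
      then show "((\<lambda>r. a r x * b (?T - r) x) has_real_derivative
          a' r x * b (?T - r) x - a r x * b' (?T - r) x) (at r within ?U)"
        by (rule DERIV_subset[OF DERIV_cong[OF DERIV_mult[OF 1]]]) (auto simp: mult.commute)
    next
      fix r assume r: "r \<in> ?U"
      then have "0 < r" "0 < ?T - r" by auto
      then show "(\<lambda>x. a r x * b (?T - r) x) integrable_on cbox 0 1"
        unfolding cbox_interval
        by (intro integrable_continuous_interval continuous_on_mult scont_slice[OF c(1)] scont_slice[OF c(3)])
    next
      have "continuous_on (?U \<times> {0..1}) (\<lambda>p. a' (fst p) (snd p) * b (?T - fst p) (snd p) - a (fst p) (snd p) * b' (?T - fst p) (snd p))"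
        by (intro continuous_on_diff continuous_on_mult
            scont_comp[OF c(1)] scont_comp[OF c(2)] scont_comp[OF c(3)] scont_comp[OF c(4)])
          (auto intro!: continuous_intros)
      then show "continuous_on (?U \<times> cbox 0 1) (\<lambda>(r, x). a' r x * b (?T - r) x - a r x * b' (?T - r) x)"
        by (simp add: split_beta)
    qed (use r in auto)
    moreover have "integral (cbox 0 1) (\<lambda>x. a' r x * b (?T - r) x - a r x * b' (?T - r) x) = 0"
    proof -
      let ?s = "?T - r"
      have rs: "0 < r" "0 < ?s" using r by auto
      note cs = c(1)[THEN scont_slice, OF rs(1)] c(2)[THEN scont_slice, OF rs(1)]
        c(3)[THEN scont_slice, OF rs(2)] c(4)[THEN scont_slice, OF rs(2)]
      have "integral {0..1} (\<lambda>x. a' r x * b ?s x - a r x * b' ?s x) = ip (a' r) (b ?s) - ip (a r) (b' ?s)"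
        unfolding ip_def by (intro integral_diff integrable_continuous_interval continuous_on_mult cs)
      also have "ip (a' r) (b ?s) = ip (a' r) (\<lambda>x. - K (b' ?s) x)"
        by (rule ip_cong) (simp_all only: b(4)[OF rs(2)] minus_minus)
      also have "\<dots> = - ip (K (a' r)) (b' ?s)"
        using K_sym[OF cs(2,4)] by simp
      also have "ip (K (a' r)) (b' ?s) = ip (\<lambda>x. - a r x) (b' ?s)"
        by (rule ip_cong) (simp_all only: a(4)[OF rs(1)])
      finally show ?thesis by simp
    qed
    ultimately show "((\<lambda>r. ip (a r) (b (?T - r))) has_real_derivative 0) (at r within ?U)"
      unfolding ip_def by simp
  qed simp
  then obtain k where k: "\<And>r. r \<in> ?U \<Longrightarrow> ip (a r) (b (?T - r)) = k" by blast
  have "?T - t' = s'" "?T - t = s" "t \<in> ?U" "t' \<in> ?U" using pos eq by auto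
  then show ?thesis using k[of t] k[of t'] by (simp only:)
qed

text \<open>The data \<open>\<psi>\<close> is attained by \<open>w\<close> in a weak sense only; that \<open>\<psi>\<close> is \<open>W\<^sup>2\<^sup>,\<^sup>\<infinity>\<close> and satisfies the
  Robin conditions upgrades this to \<open>C\<^sup>1\<close> convergence as \<open>t \<rightarrow> 0\<close>.\<close>

lemma initial_layer:
  assumes ww1: "sol_deriv w w1"
    and psi: "\<And>x. x \<in> {0..1} \<Longrightarrow> (\<psi> has_real_derivative \<psi>' x) (at x within {0..1})"
    and lip: "\<And>x y. x \<in> {0..1} \<Longrightarrow> y \<in> {0..1} \<Longrightarrow> \<bar>\<psi>' x - \<psi>' y\<bar> \<le> L * \<bar>x - y\<bar>"
    and bdry: "\<psi>' 0 = \<psi> 0 / A" "\<psi>' 1 = - \<psi> 1 / B"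
    and init: "\<And>f. continuous_on {0..1} f \<Longrightarrow> ((\<lambda>t. ip (w t) (K f)) \<longlongrightarrow> ip \<psi> (K f)) (at_right 0)"
  shows "uniform_limit {0..1} w \<psi> (at_right 0)"
    "uniform_limit {0..1} (\<lambda>t x. - K1 (w1 t) x) \<psi>' (at_right 0)"
proof -
  note w = sol_derivD[OF ww1]
  have L: "0 \<le> L" using lip[of 0 1] by simp
  have cpsi: "continuous_on {0..1} \<psi>" by (rule DERIV_continuous_on[OF psi])
  have cpsi': "continuous_on {0..1} \<psi>'"
  proof (rule lipschitz_on_continuous_on)
    show "L-lipschitz_on {0..1} \<psi>'" using lip L by (auto simp: lipschitz_on_def dist_real_def)
  qed
  obtain w2 where w12: "sol_deriv w1 w2" by (rule sol_time_deriv[OF w(2)])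
  note w2 = sol_derivD(2-)[OF w12]
  obtain w3 where w23: "sol_deriv w2 w3" by (rule sol_time_deriv[OF w2(1)])
  note w3 = sol_derivD(2-)[OF w23]
  note c = w(1)[THEN solD(1), THEN scont_slice] w(2)[THEN solD(1), THEN scont_slice]
    w2(1)[THEN solD(1), THEN scont_slice] w3(1)[THEN solD(1), THEN scont_slice]
  have diag: "ip (w t) (w2 s) = ip (w t') (w2 s')"
    if "0 < t" "0 < s" "0 < t'" "0 < s'" "t + s = t' + s'" for t s t' s'
    by (rule sol_diag[OF ww1 w23 that])
  \<comment> \<open>\<open>diag\<close> turns the pairing of \<open>w t\<close> with
    \<open>w2 s\<close> into one of \<open>w (s / 2)\<close> with \<open>w2 (t + s / 2)\<close>,
    which is continuous at t = 0; on the other hand \<open>w2 s\<close> is - K (w3 s), a test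
    function for which \<open>init\<close> supplies the limit. The datum thus enters although w is
    not yet known to converge.\<close>
  have psiw2: "ip (w (s / 2)) (w2 (s / 2)) = ip \<psi> (w2 s)" if s: "0 < s" for s
  proof (rule tendsto_unique[of "at_right (0::real)"])
    have "((\<lambda>t. - ip (w t) (K (w3 s))) \<longlongrightarrow> - ip \<psi> (K (w3 s))) (at_right 0)"
      by (intro tendsto_minus init c s)
    moreover have "- ip f (K (w3 s)) = ip f (w2 s)" for f
    proof -
      have "ip f (K (w3 s)) = ip f (\<lambda>x. - w2 s x)" by (rule ip_cong) (simp_all only: w3(3)[OF s])
      then show ?thesis by simp
    qed
    ultimately show "((\<lambda>t. ip (w t) (w2 s)) \<longlongrightarrow> ip \<psi> (w2 s)) (at_right 0)" by simp
    have cw: "scont (\<lambda>_. w (s / 2))"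
      unfolding scont_def split_beta by (rule scont_comp[OF solD(1)[OF w(1)]]) (use s in \<open>auto intro!: continuous_intros\<close>)
    have "isCont (\<lambda>t. ip (w (s / 2)) (w2 t)) (s / 2)"
      using ip_time_cont[OF cw solD(1)[OF w2(1)]] s
      by (simp add: continuous_on_eq_continuous_at)
    then have "((\<lambda>t. ip (w (s / 2)) (w2 t)) \<longlongrightarrow> ip (w (s / 2)) (w2 (s / 2))) (at (s / 2))"
      by (simp add: isCont_def)
    then have "((\<lambda>t. ip (w (s / 2)) (w2 (t + s / 2))) \<longlongrightarrow> ip (w (s / 2)) (w2 (s / 2))) (at 0)"
      using LIM_offset_zero_iff[of "s/2" "\<lambda>t. ip (w (s / 2)) (w2 t)"] by (simp add: add.commute)
    then have "((\<lambda>t. ip (w (s / 2)) (w2 (t + s / 2))) \<longlongrightarrow> ip (w (s / 2)) (w2 (s / 2))) (at_right 0)"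
      by (rule tendsto_within_subset) simp
    moreover have "\<forall>\<^sub>F t in at_right 0. ip (w (s / 2)) (w2 (t + s / 2)) = ip (w t) (w2 s)"
      using eventually_at_right_less by eventually_elim (rule diag; use s in simp)
    ultimately show "((\<lambda>t. ip (w t) (w2 s)) \<longlongrightarrow> ip (w (s / 2)) (w2 (s / 2))) (at_right 0)"
      by (simp add: tendsto_cong)
  qed simp
  have w1w1: "ip (w1 t) (w1 t) = ip (w t) (w2 t)" if t: "0 < t" for t
  proof -
    have "ip (w1 t) (w1 t) = ip (w1 t) (\<lambda>x. - K (w2 t) x)"
      by (rule ip_cong) (simp_all only: w2(3)[OF t] minus_minus)
    also have "\<dots> = - ip (K (w1 t)) (w2 t)" using K_sym[OF c(2)[OF t] c(3)[OF t]] by simp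
    also have "ip (K (w1 t)) (w2 t) = ip (\<lambda>x. - w t x) (w2 t)"
      by (rule ip_cong) (simp_all only: w(4)[OF t])
    finally show ?thesis by simp
  qed
  \<comment> \<open>w2 is the second space derivative of w1. One integration by parts moves a
    derivative to \<psi>, a second one is done by \<open>lipschitz_by_parts\<close> at the cost of
    L; the boundary terms cancel because \<psi> and w1 both satisfy the Robin conditions.\<close>
  have psib: "ip \<psi> (w2 s) \<le> L * nrm (w1 s)" if s: "0 < s" for s
  proof -
    note sd = sol_space_deriv[OF w12 s]
    have c1: "continuous_on {0..1} (\<lambda>x. - K1 (w2 s) x)" by (intro continuous_intros K1_cont c s)
    have "((\<lambda>x. \<psi>' x * (- K1 (w2 s) x) + \<psi> x * w2 s x) has_integral
        \<psi> 1 * (- K1 (w2 s) 1) - \<psi> 0 * (- K1 (w2 s) 0)) {0..1}"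
    proof (rule fundamental_theorem_of_calculus)
      fix x :: real assume x: "x \<in> {0..1}"
      show "((\<lambda>x. \<psi> x * (- K1 (w2 s) x)) has_vector_derivative \<psi>' x * (- K1 (w2 s) x) + \<psi> x * w2 s x) (at x within {0..1})"
        unfolding has_real_derivative_iff_has_vector_derivative[symmetric]
        by (rule DERIV_cong[OF DERIV_mult[OF psi[OF x] sd(2)[OF x]]]) (simp add: mult.commute)
    qed simp
    then have "integral {0..1} (\<lambda>x. \<psi>' x * (- K1 (w2 s) x) + \<psi> x * w2 s x)
        = \<psi> 1 * (- K1 (w2 s) 1) - \<psi> 0 * (- K1 (w2 s) 0)" by (rule integral_unique)
    moreover have "integral {0..1} (\<lambda>x. \<psi>' x * (- K1 (w2 s) x) + \<psi> x * w2 s x)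
        = ip \<psi>' (\<lambda>x. - K1 (w2 s) x) + ip \<psi> (w2 s)"
      unfolding ip_def by (intro integral_add integrable_continuous_interval continuous_on_mult cpsi cpsi' c1 c s)
    ultimately have "ip \<psi> (w2 s) = (\<psi>' 1 * w1 s 1 - \<psi>' 0 * w1 s 0) - ip \<psi>' (\<lambda>x. - K1 (w2 s) x)"
      unfolding sd(3,4) bdry by simp
    with lipschitz_by_parts[OF lip sd(1) c1] show ?thesis by linarith
  qed
  have mono: "nrm (w1 (2 * t)) \<le> nrm (w1 t)" if t: "0 < t" for t
    unfolding nrm_def
  proof (rule real_sqrt_le_mono, rule DERIV_nonpos_imp_nonincreasing[of t "2 * t" "\<lambda>t. ip (w1 t) (w1 t)"])
    fix r assume "t \<le> r" "r \<le> 2 * t"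
    then have r: "0 < r" using t by simp
    have "((\<lambda>t. ip (w1 t) (w1 t)) has_real_derivative ip (w2 r) (w1 r) + ip (w1 r) (w2 r)) (at r)"
      by (rule ip_deriv[OF solD(1)[OF w(2)] solD(1)[OF w2(1)] w2(2) solD(1)[OF w(2)] solD(1)[OF w2(1)] w2(2) r])
    moreover have "ip (w1 r) (w2 r) = ip (\<lambda>x. - K (w2 r) x) (w2 r)"
      by (rule ip_cong) (simp_all only: w2(3)[OF r] minus_minus)
    then have "ip (w2 r) (w1 r) + ip (w1 r) (w2 r) \<le> 0"
      using K_pos(1)[OF c(3)[OF r]] ip_commute[of "w2 r" "w1 r"] by simp
    ultimately show "\<exists>y. ((\<lambda>t. ip (w1 t) (w1 t)) has_real_derivative y) (at r) \<and> y \<le> 0" by blast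
  qed (use t in simp)
  \<comment> \<open>The square of \<open>nrm (w1 t)\<close> is at most L times
    \<open>nrm (w1 (2 * t))\<close>, hence at most L times \<open>nrm (w1 t)\<close>; one factor
    cancels.\<close>
  have w1b: "nrm (w1 t) \<le> L" if t: "0 < t" for t
  proof (cases "nrm (w1 t) = 0")
    case False
    have "nrm (w1 t) * nrm (w1 t) = ip \<psi> (w2 (2 * t))"
      using psiw2[of "2 * t"] w1w1[OF t] t by (simp add: nrm_sq[symmetric] power2_eq_square)
    also have "\<dots> \<le> L * nrm (w1 (2 * t))" using psib t by simp
    also have "\<dots> \<le> L * nrm (w1 t)" by (rule mult_left_mono[OF mono[OF t] L])
    finally show ?thesis using False nrm_nonneg[of "w1 t"] by (simp add: mult_le_cancel_right)
  qed (use L in simp)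
  \<comment> \<open>Mean value theorem for the pairing of w with the fixed function
    \<open>?f\<close>, so that only the L^2 bound on w1 enters.\<close>
  have wdiff: "nrm (\<lambda>x. w t x - w s x) \<le> L * (t - s)" if st: "0 < s" "s < t" for s t
  proof -
    let ?f = "\<lambda>x. w t x - w s x"
    have t: "0 < t" using st by simp
    have cf: "continuous_on {0..1} ?f" by (intro continuous_intros c t st)
    have cF: "scont (\<lambda>_. ?f)"
      unfolding scont_def split_beta using st t
      by (intro continuous_on_diff scont_comp[OF solD(1)[OF w(1)]]) (auto intro!: continuous_intros)
    have c0: "scont (\<lambda>_ _. 0)" by (rule scont_const)
    have d0: "tder (\<lambda>_. ?f) (\<lambda>_ _. 0)" by (simp add: tder_def)
    have der: "((\<lambda>t. ip (w t) ?f) has_real_derivative ip (w1 r) ?f) (at r)" if "0 < r" for r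
      using ip_deriv[OF solD(1)[OF w(1)] solD(1)[OF w(2)] w(3) cF c0 d0 that] by (simp add: ip_def)
    have "\<exists>z>s. z < t \<and> ip (w t) ?f - ip (w s) ?f = (t - s) * ip (w1 z) ?f"
      by (rule MVT2[OF st(2)]) (use st in \<open>auto intro!: der\<close>)
    then obtain z where z: "s < z" "ip (w t) ?f - ip (w s) ?f = (t - s) * ip (w1 z) ?f" by auto
    have z0: "0 < z" using z st by simp
    have "ip (w t) ?f - ip (w s) ?f = ip ?f ?f" by (rule ip_diff[symmetric, OF c(1)[OF t] c(1)[OF st(1)] cf])
    then have "nrm ?f * nrm ?f = (t - s) * ip (w1 z) ?f" using z by (simp add: nrm_sq[symmetric] power2_eq_square)
    also have "\<dots> \<le> (t - s) * (L * nrm ?f)"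
    proof (rule mult_left_mono)
      have "ip (w1 z) ?f \<le> nrm (w1 z) * nrm ?f" using cauchy_schwarz[OF c(2)[OF z0] cf] by linarith
      also have "\<dots> \<le> L * nrm ?f" by (intro mult_right_mono w1b z0) simp
      finally show "ip (w1 z) ?f \<le> L * nrm ?f" .
    qed (use st in simp)
    finally have "nrm ?f * nrm ?f \<le> (L * (t - s)) * nrm ?f" by (simp add: algebra_simps)
    then show ?thesis
      by (cases "nrm ?f = 0") (use L st nrm_nonneg[of ?f] in \<open>auto simp: mult_le_cancel_right\<close>)
  qed
  \<comment> \<open>Both roots come from \<open>sobolev\<close>. The first is for w(t) - w(s), whose
    norm is at most L \<eta> and whose derivative has norm at most sqrt (2 L (L \<eta>)); the second
    is for that derivative, whose own derivative has norm at most 2 L.\<close>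
  define E where "E \<eta> = sqrt ((L * \<eta>)\<^sup>2 + 2 * (L * \<eta>) * sqrt (2 * L * (L * \<eta>)))
      + sqrt (2 * L * (L * \<eta>) + 2 * sqrt (2 * L * (L * \<eta>)) * (2 * L))" for \<eta>
  have E0: "(E \<longlongrightarrow> 0) (at_right 0)"
  proof -
    have "isCont E 0" unfolding E_def by (intro continuous_intros)
    then have "(E \<longlongrightarrow> E 0) (at_right 0)" unfolding isCont_def by (rule tendsto_within_subset) simp
    then show ?thesis by (simp add: E_def)
  qed
  have Emono: "E a \<le> E b" if "0 \<le> a" "a \<le> b" for a b
    unfolding E_def using L that
    by (intro add_mono real_sqrt_le_mono mult_mono power_mono mult_nonneg_nonneg) auto
  have close: "\<bar>w t x - w s x\<bar> \<le> E (t - s) \<and> \<bar>- K1 (w1 t) x - - K1 (w1 s) x\<bar> \<le> E (t - s)"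
    if st: "0 < s" "s < t" and x: "x \<in> {0..1}" for s t x
  proof -
    let ?f = "\<lambda>x. w t x - w s x" and ?g = "\<lambda>x. w1 t x - w1 s x" and ?\<eta> = "t - s"
    have t: "0 < t" using st by simp
    have cf: "continuous_on {0..1} ?f" and cg: "continuous_on {0..1} ?g" by (intro continuous_intros c t st)+
    note nf = wdiff[OF st]
    have ng: "nrm ?g \<le> 2 * L"
    proof -
      have "nrm (\<lambda>x. w1 t x + - w1 s x) \<le> nrm (w1 t) + nrm (\<lambda>x. - w1 s x)"
        by (rule nrm_triangle) (intro continuous_intros c t st)+
      then show ?thesis using w1b[OF t] w1b[OF st(1)] by simp
    qed
    have Kg: "K ?g y = - ?f y" "K1 ?g y = K1 (w1 t) y - K1 (w1 s) y" if y: "y \<in> {0..1}" for y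
      using K_diff[OF c(2)[OF t] c(2)[OF st(1)] y] w(4)[OF t y] w(4)[OF st(1) y] by simp_all
    \<comment> \<open>Interpolation: the derivative of \<open>?f\<close>, which is -
      \<open>K ?g\<close>, is controlled by the product of the small norm of \<open>?f\<close> and
      the merely bounded norm of \<open>?g\<close>.\<close>
    have "ip (K1 ?g) (K1 ?g) \<le> ip (K ?g) ?g" by (rule K_pos(2)[OF cg])
    also have "ip (K ?g) ?g = ip (\<lambda>y. - ?f y) ?g" by (rule ip_cong) (simp_all only: Kg)
    also have "\<dots> \<le> nrm ?f * nrm ?g" using cauchy_schwarz[OF cf cg] by (simp only: ip_minus)
    also have "\<dots> \<le> (L * ?\<eta>) * (2 * L)" using nf ng L st by (intro mult_mono) auto
    finally have I: "ip (K1 ?g) (K1 ?g) \<le> 2 * L * (L * ?\<eta>)" by (simp add: algebra_simps)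
    then have nm: "nrm (K1 ?g) \<le> sqrt (2 * L * (L * ?\<eta>))" unfolding nrm_def by (rule real_sqrt_le_mono)
    have cm: "continuous_on {0..1} (\<lambda>y. - K1 ?g y)" by (intro continuous_intros K1_cont cg)
    have df: "(?f has_real_derivative - K1 ?g y) (at y within {0..1})" if y: "y \<in> {0..1}" for y
      by (rule has_field_derivative_transform_within[OF DERIV_minus[OF K_deriv[OF cg y]] zero_less_one y])
        (simp add: Kg(1))
    have "(?f x)\<^sup>2 \<le> ip ?f ?f + 2 * nrm ?f * nrm (\<lambda>y. - K1 ?g y)"
      by (rule sobolev[OF cm df x])
    also have "\<dots> \<le> (L * ?\<eta>)\<^sup>2 + 2 * (L * ?\<eta>) * sqrt (2 * L * (L * ?\<eta>))"
      unfolding nrm_sq[symmetric] nrm_minus using nf nm L st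
      by (intro add_mono power_mono mult_mono) auto
    finally have 1: "\<bar>?f x\<bar> \<le> sqrt ((L * ?\<eta>)\<^sup>2 + 2 * (L * ?\<eta>) * sqrt (2 * L * (L * ?\<eta>)))"
      by (rule real_le_rsqrt[of "\<bar>?f x\<bar>", unfolded power2_abs])
    have cmg: "continuous_on {0..1} (\<lambda>y. - ?g y)" by (intro continuous_on_minus cg)
    have "(K1 ?g x)\<^sup>2 \<le> ip (K1 ?g) (K1 ?g) + 2 * nrm (K1 ?g) * nrm (\<lambda>y. - ?g y)"
      by (rule sobolev[OF cmg K1_deriv[OF cg] x])
    also have "\<dots> \<le> 2 * L * (L * ?\<eta>) + 2 * sqrt (2 * L * (L * ?\<eta>)) * (2 * L)"
      unfolding nrm_minus using I nm ng L st by (intro add_mono mult_mono) auto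
    finally have 2: "\<bar>K1 ?g x\<bar> \<le> sqrt (2 * L * (L * ?\<eta>) + 2 * sqrt (2 * L * (L * ?\<eta>)) * (2 * L))"
      by (rule real_le_rsqrt[of "\<bar>K1 ?g x\<bar>", unfolded power2_abs])
    have "0 \<le> sqrt ((L * ?\<eta>)\<^sup>2 + 2 * (L * ?\<eta>) * sqrt (2 * L * (L * ?\<eta>)))"
      "0 \<le> sqrt (2 * L * (L * ?\<eta>) + 2 * sqrt (2 * L * (L * ?\<eta>)) * (2 * L))"
      using L st by auto
    then show ?thesis using 1 2 Kg(2)[OF x] unfolding E_def by linarith
  qed
  define hh where "hh n = inverse (real (Suc n))" for n
  have hpos: "0 < hh n" for n by (simp add: hh_def)
  have hlim: "hh \<longlonglongrightarrow> 0" unfolding hh_def by (rule LIMSEQ_inverse_real_of_nat)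
  have close2: "\<bar>w t x - w s x\<bar> \<le> E d \<and> \<bar>- K1 (w1 t) x - - K1 (w1 s) x\<bar> \<le> E d"
    if "0 < s" "0 < t" "s \<le> d" "t \<le> d" and x: "x \<in> {0..1}" for s t x d
  proof -
    consider "s < t" | "t < s" | "s = t" by linarith
    then show ?thesis
    proof cases
      case 1
      then show ?thesis using close[OF that(1) 1 x] Emono[of "t - s" d] that by auto
    next
      case 2
      then show ?thesis using close[OF that(2) 2 x] Emono[of "s - t" d] that by auto
    next
      case 3
      then show ?thesis using Emono[of 0 d] that by (simp add: E_def)
    qed
  qed
  have ev: "\<exists>d>0. E d < e" if e: "0 < e" for e
    using order_tendstoD(2)[OF E0 e] unfolding eventually_at_right_field by (meson dense)
  have uc: "uniformly_Cauchy_on {0..1} (\<lambda>n. w (hh n))" "uniformly_Cauchy_on {0..1} (\<lambda>n x. - K1 (w1 (hh n)) x)"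
  proof -
    have "\<exists>M. \<forall>x\<in>{0..1}. \<forall>m\<ge>M. \<forall>n\<ge>M. dist (w (hh m) x) (w (hh n) x) < e
        \<and> dist (- K1 (w1 (hh m)) x) (- K1 (w1 (hh n)) x) < e" if e: "0 < e" for e
    proof -
      obtain d where d: "0 < d" "E d < e" using ev[OF e] by auto
      obtain M where M: "\<And>n. M \<le> n \<Longrightarrow> hh n < d"
        using order_tendstoD(2)[OF hlim d(1)] by (auto simp: eventually_sequentially)
      show ?thesis
      proof (intro exI[of _ M] ballI allI impI)
        fix x :: real and m n assume x: "x \<in> {0..1}" and m: "M \<le> m" and n: "M \<le> n"
        show "dist (w (hh m) x) (w (hh n) x) < e \<and> dist (- K1 (w1 (hh m)) x) (- K1 (w1 (hh n)) x) < e"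
          using close2[OF hpos hpos less_imp_le[OF M[OF n]] less_imp_le[OF M[OF m]] x] d unfolding dist_real_def by linarith
      qed
    qed
    then show "uniformly_Cauchy_on {0..1} (\<lambda>n. w (hh n))" "uniformly_Cauchy_on {0..1} (\<lambda>n x. - K1 (w1 (hh n)) x)"
      unfolding uniformly_Cauchy_on_def by blast+
  qed
  obtain W where W: "uniform_limit {0..1} (\<lambda>n. w (hh n)) W sequentially"
    using Cauchy_uniformly_convergent[OF uc(1)] unfolding uniformly_convergent_on_def by blast
  obtain V where V: "uniform_limit {0..1} (\<lambda>n x. - K1 (w1 (hh n)) x) V sequentially"
    using Cauchy_uniformly_convergent[OF uc(2)] unfolding uniformly_convergent_on_def by blast
  have cW: "continuous_on {0..1} W"
    by (rule uniform_limit_theorem[OF _ W]) (auto intro!: always_eventually c hpos)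
  have hlim': "filterlim hh (at_right 0) sequentially"
    unfolding filterlim_at using hlim hpos by (auto intro: always_eventually simp: less_imp_neq[symmetric])
  \<comment> \<open>Taking f = K (W - \<psi>) in the tested identity gives K (W - \<psi>) = 0, and K
    is injective.\<close>
  have Wpsi: "W x = \<psi> x" if x: "x \<in> {0..1}" for x
  proof -
    have KW: "ip (\<lambda>x. W x - \<psi> x) (K f) = 0" if f: "continuous_on {0..1} f" for f
    proof -
      have "(\<lambda>n. ip (w (hh n)) (K f)) \<longlonglongrightarrow> ip W (K f)"
        by (rule ip_tendsto[OF W _ cW K_cont[OF f]]) (intro c hpos)
      moreover have "(\<lambda>n. ip (w (hh n)) (K f)) \<longlonglongrightarrow> ip \<psi> (K f)"
        by (rule filterlim_compose[OF init[OF f] hlim'])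
      ultimately have "ip W (K f) = ip \<psi> (K f)" by (rule LIMSEQ_unique)
      then show ?thesis by (simp add: ip_diff[OF cW cpsi K_cont[OF f]])
    qed
    have cd: "continuous_on {0..1} (\<lambda>x. W x - \<psi> x)" by (intro continuous_intros cW cpsi)
    have "ip (K (\<lambda>x. W x - \<psi> x)) (K (\<lambda>x. W x - \<psi> x)) = 0"
      using KW[OF K_cont[OF cd]] K_sym[OF cd K_cont[OF cd]] by simp
    then have "K (\<lambda>x. W x - \<psi> x) y = 0" if "y \<in> {0..1}" for y
      by (rule ip_eq_0D[OF K_cont[OF cd] _ that])
    from K_inj[OF cd this x] show ?thesis by simp
  qed
  have Vpsi: "V x = \<psi>' x" if x: "x \<in> {0..1}" for x
  proof -
    have "\<exists>g. \<forall>x\<in>{0..1}. (\<lambda>n. w (hh n) x) \<longlonglongrightarrow> g x \<and> (g has_derivative (\<lambda>h. V x * h)) (at x within {0..1})"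
    proof (rule has_derivative_sequence[where ?x0.0 = 0])
      show "(\<lambda>n. w (hh n) 0) \<longlonglongrightarrow> W 0" by (rule tendsto_uniform_limitI[OF W]) simp
      fix n and x :: real assume x: "x \<in> {0..1}"
      show "(w (hh n) has_derivative (\<lambda>h. - K1 (w1 (hh n)) x * h)) (at x within {0..1})"
        using sol_space_deriv(1)[OF ww1 hpos x] unfolding has_field_derivative_def .
    next
      fix e :: real assume e: "0 < e"
      show "\<forall>\<^sub>F n in sequentially. \<forall>x\<in>{0..1}. \<forall>h. norm (- K1 (w1 (hh n)) x * h - V x * h) \<le> e * norm h"
        using uniform_limitD[OF V e]
      proof eventually_elim
        case (elim n)
        show ?case
        proof (intro ballI allI)
          fix x h :: real assume x: "x \<in> {0..1}"
          have "\<bar>- K1 (w1 (hh n)) x - V x\<bar> * \<bar>h\<bar> \<le> e * \<bar>h\<bar>"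
            by (rule mult_right_mono) (use elim x in \<open>auto simp: dist_real_def intro: less_imp_le\<close>)
          then show "norm (- K1 (w1 (hh n)) x * h - V x * h) \<le> e * norm h"
            by (simp only: real_norm_def left_diff_distrib[symmetric] abs_mult)
        qed
      qed
    qed simp_all
    then obtain g where g: "\<And>x. x \<in> {0..1} \<Longrightarrow> (\<lambda>n. w (hh n) x) \<longlonglongrightarrow> g x"
      "\<And>x. x \<in> {0..1} \<Longrightarrow> (g has_derivative (\<lambda>h. V x * h)) (at x within {0..1})" by blast
    have "g y = \<psi> y" if y: "y \<in> {0..1}" for y
      using LIMSEQ_unique[OF g(1)[OF y] tendsto_uniform_limitI[OF W y]] Wpsi[OF y] by simp
    then have "(\<psi> has_real_derivative V x) (at x within {0..1})"
      using has_derivative_transform[OF x _ g(2)[OF x], of \<psi>] by (simp add: has_field_derivative_def)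
    from deriv01_unique[OF this psi[OF x] x] show ?thesis .
  qed
  have fin: "\<bar>w t x - \<psi> x\<bar> \<le> E d \<and> \<bar>- K1 (w1 t) x - \<psi>' x\<bar> \<le> E d"
    if t: "0 < t" "t \<le> d" and x: "x \<in> {0..1}" for t d x
  proof -
    have "\<forall>\<^sub>F n in sequentially. hh n < d" using order_tendstoD(2)[OF hlim, of d] t by simp
    then have evc: "\<forall>\<^sub>F n in sequentially. \<bar>w t x - w (hh n) x\<bar> \<le> E d \<and> \<bar>- K1 (w1 t) x - - K1 (w1 (hh n)) x\<bar> \<le> E d"
      by eventually_elim (rule close2[OF hpos t(1) less_imp_le t(2) x])
    have "\<bar>w t x - W x\<bar> \<le> E d"
      by (rule tendsto_upperbound[OF tendsto_rabs[OF tendsto_diff[OF tendsto_const tendsto_uniform_limitI[OF W x]]]])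
        (use evc in \<open>auto elim: eventually_mono\<close>)
    moreover have "\<bar>- K1 (w1 t) x - V x\<bar> \<le> E d"
      by (rule tendsto_upperbound[OF tendsto_rabs[OF tendsto_diff[OF tendsto_const tendsto_uniform_limitI[OF V x]]]])
        (use evc in \<open>auto elim: eventually_mono\<close>)
    ultimately show ?thesis by (simp add: Wpsi[OF x] Vpsi[OF x])
  qed
  have "\<forall>\<^sub>F t in at_right 0. \<forall>x\<in>{0..1}. dist (w t x) (\<psi> x) < e \<and> dist (- K1 (w1 t) x) (\<psi>' x) < e"
    if e: "0 < e" for e
  proof -
    obtain d where d: "0 < d" "E d < e" using ev[OF e] by auto
    have "\<forall>\<^sub>F t in at_right 0. 0 < t \<and> t < d"
      using d(1) unfolding eventually_at_right_field by blast
    then show ?thesis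
    proof eventually_elim
      case (elim t)
      show ?case
      proof
        fix x :: real assume "x \<in> {0..1}"
        from fin[OF _ _ this, of t d] elim d
        show "dist (w t x) (\<psi> x) < e \<and> dist (- K1 (w1 t) x) (\<psi>' x) < e" unfolding dist_real_def by linarith
      qed
    qed
  qed
  note * = this
  show "uniform_limit {0..1} w \<psi> (at_right 0)"
    by (rule uniform_limitI, rule eventually_mono[OF *]) auto
  show "uniform_limit {0..1} (\<lambda>t x. - K1 (w1 t) x) \<psi>' (at_right 0)"
    by (rule uniform_limitI, rule eventually_mono[OF *]) auto
qed

end

section \<open>Maximum principle\<close>

text \<open>Consider a negative minimum of z + e (r - s). The initial values and the slope
  hypotheses place it at a later time and in the interior; there z_xx \<ge> 0, so the time
  derivative is at least e and the function was smaller just before. The boundary hypotheses are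
  implications from z < 0, which covers Robin conditions as well as known nonnegative boundary
  values.\<close>

lemma heat_min_principle:
  fixes z zx zt :: "real \<Rightarrow> real \<Rightarrow> real"
  assumes cont: "continuous_on ({s..T} \<times> {0..1}) (\<lambda>(t, x). z t x)"
    and dt: "\<And>t x. s < t \<Longrightarrow> t \<le> T \<Longrightarrow> x \<in> {0..1} \<Longrightarrow> ((\<lambda>r. z r x) has_real_derivative zt t x) (at t)"
    and dx: "\<And>t x. s < t \<Longrightarrow> t \<le> T \<Longrightarrow> x \<in> {0..1} \<Longrightarrow> (z t has_real_derivative zx t x) (at x within {0..1})"
    and dxx: "\<And>t x. s < t \<Longrightarrow> t \<le> T \<Longrightarrow> x \<in> {0..1} \<Longrightarrow> (zx t has_real_derivative zt t x) (at x within {0..1})"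
    and init: "\<And>x. x \<in> {0..1} \<Longrightarrow> 0 \<le> z s x"
    and left: "\<And>t. s < t \<Longrightarrow> t \<le> T \<Longrightarrow> z t 0 < 0 \<Longrightarrow> zx t 0 < 0"
    and right: "\<And>t. s < t \<Longrightarrow> t \<le> T \<Longrightarrow> z t 1 < 0 \<Longrightarrow> 0 < zx t 1"
    and t: "s \<le> t" "t \<le> T" and x: "x \<in> {0..1}"
  shows "0 \<le> z t x"
proof (rule ccontr)
  assume neg: "\<not> 0 \<le> z t x"
  \<comment> \<open>The perturbation at time t is at most half of - z t x, so the value there stays
    negative.\<close>
  define e where "e = - z t x / (2 * (t - s + 1))"
  have e: "0 < e" unfolding e_def using neg t by (intro divide_pos_pos) auto
  define v where "v r y = z r y + e * (r - s)" for r y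
  have "e * (t - s) \<le> e * (t - s + 1)" using e by simp
  also have "\<dots> = - z t x / 2" using t by (simp add: e_def) (simp add: field_simps)
  finally have vneg: "v t x < 0" using neg by (simp add: v_def)
  have cv: "continuous_on ({s..T} \<times> {0..1}) (\<lambda>p. v (fst p) (snd p))"
    unfolding v_def using cont by (intro continuous_intros) (simp add: split_beta)
  have comp: "compact ({s..T} \<times> {0..1::real})" by (intro compact_Times) auto
  have ne: "{s..T} \<times> {0..1::real} \<noteq> {}" using t by auto
  obtain p where p: "p \<in> {s..T} \<times> {0..1}"
    "\<forall>q\<in>{s..T} \<times> {0..1}. v (fst p) (snd p) \<le> v (fst q) (snd q)"
    using continuous_attains_inf[OF comp ne cv] by blast
  define t0 x0 where "t0 = fst p" and "x0 = snd p"
  have t0: "s \<le> t0" "t0 \<le> T" and x0: "x0 \<in> {0..1}" using p(1) by (auto simp: t0_def x0_def)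
  have vmin: "v t0 x0 \<le> v r y" if "s \<le> r" "r \<le> T" "y \<in> {0..1}" for r y
    using p(2)[rule_format, of "(r, y)"] that by (simp add: t0_def x0_def)
  have v0: "v t0 x0 < 0" using vmin[OF t x] vneg by simp
  have ts: "s < t0"
    using v0 init[OF x0] t0 by (cases "t0 = s") (auto simp: v_def)
  have z0: "z t0 x0 < 0" using v0 e ts unfolding v_def by (smt (verit) mult_pos_pos)
  have zmin: "z t0 x0 \<le> z t0 y" if "y \<in> {0..1}" for y
    using vmin[OF t0 that] by (simp add: v_def)
  note dx0 = dx[OF ts t0(2) x0] and dxx0 = dxx[OF ts t0(2) x0]
  have "x0 \<noteq> 0"
  proof
    assume x00: "x0 = 0"
    have "zx t0 x0 < 0" using left[OF ts t0(2)] z0 x00 by simp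
    from has_real_derivative_neg_dec_right[OF dx0 this] obtain d where d: "0 < d"
      "\<And>h. 0 < h \<Longrightarrow> x0 + h \<in> {0..1} \<Longrightarrow> h < d \<Longrightarrow> z t0 (x0 + h) < z t0 x0" by blast
    have "z t0 (x0 + min (d / 2) 1) < z t0 x0" using d(1) x00 by (intro d(2)) auto
    then show False using zmin[of "x0 + min (d / 2) 1"] d(1) x00 by simp
  qed
  moreover have "x0 \<noteq> 1"
  proof
    assume x01: "x0 = 1"
    have "0 < zx t0 x0" using right[OF ts t0(2)] z0 x01 by simp
    from has_real_derivative_pos_inc_left[OF dx0 this] obtain d where d: "0 < d"
      "\<And>h. 0 < h \<Longrightarrow> x0 - h \<in> {0..1} \<Longrightarrow> h < d \<Longrightarrow> z t0 (x0 - h) < z t0 x0" by blast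
    have "z t0 (x0 - min (d / 2) 1) < z t0 x0" using d(1) x01 by (intro d(2)) auto
    then show False using zmin[of "x0 - min (d / 2) 1"] d(1) x01 by simp
  qed
  ultimately have xi: "0 < x0" "x0 < 1" using x0 by auto
  have at: "at x0 within {0..1} = at x0" using xi by (simp add: at_within_Icc_at)
  have zx0: "zx t0 x0 = 0"
    by (rule DERIV_local_min[OF dx0[unfolded at], of "min x0 (1 - x0)"])
      (use xi in \<open>auto simp: abs_less_iff intro!: zmin\<close>)
  \<comment> \<open>\<open>zt\<close> is also the second space derivative, by \<open>dxx\<close>:
    were it negative, z would decrease to the right of its minimum.\<close>
  have zt: "0 \<le> zt t0 x0"
  proof (rule ccontr)
    assume "\<not> 0 \<le> zt t0 x0"
    then have n: "zt t0 x0 < 0" by simp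
    from has_real_derivative_neg_dec_right[OF dxx0 n] obtain d where d: "0 < d"
      "\<And>h. 0 < h \<Longrightarrow> x0 + h \<in> {0..1} \<Longrightarrow> h < d \<Longrightarrow> zx t0 (x0 + h) < zx t0 x0" by blast
    define h where "h = min (d / 2) ((1 - x0) / 2)"
    have h: "0 < h" "h < d" "x0 + h < 1" using d(1) xi by (auto simp: h_def field_simps min_def)
    have "\<exists>y>x0. y < x0 + h \<and> z t0 (x0 + h) - z t0 x0 = (x0 + h - x0) * zx t0 y"
    proof (rule MVT2)
      fix y assume "x0 \<le> y" "y \<le> x0 + h"
      then have "0 < y" "y < 1" using xi h by auto
      then show "(z t0 has_real_derivative zx t0 y) (at y)"
        using dx[OF ts t0(2), of y] by (simp add: at_within_Icc_at)
    qed (use h in simp)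
    then obtain y where y: "x0 < y" "y < x0 + h" "z t0 (x0 + h) - z t0 x0 = h * zx t0 y" by auto
    have "zx t0 (x0 + (y - x0)) < 0" using d(2)[of "y - x0"] y h xi zx0 by auto
    then have "h * zx t0 y < 0" using h by (simp add: mult_pos_neg)
    then show False using y zmin[of "x0 + h"] h xi by auto
  qed
  \<comment> \<open>The minimum may lie at the final time T, so it is compared with earlier times
    only.\<close>
  have "((\<lambda>r. v r x0) has_real_derivative zt t0 x0 + e) (at t0)"
    unfolding v_def using dt[OF ts t0(2) x0] by (auto intro!: derivative_eq_intros)
  from has_real_derivative_pos_inc_left[OF this] obtain d where d: "0 < d"
      "\<And>h. 0 < h \<Longrightarrow> h < d \<Longrightarrow> v (t0 - h) x0 < v t0 x0" using zt e by auto
  have "v (t0 - min (d / 2) (t0 - s)) x0 < v t0 x0" using d(1) ts by (intro d(2)) auto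
  moreover have "v t0 x0 \<le> v (t0 - min (d / 2) (t0 - s)) x0" using d(1) ts t0 by (intro vmin x0) auto
  ultimately show False by simp
qed

context robin
begin

text \<open>With F = w + \<alpha> + c (A + x), compare F - \<alpha> and \<beta> - F with the
  fraction \<theta> of the same quantities for the stationary solution; this makes the inequalities
  strict. At both end points the comparison gives \<nabla>F \<ge> \<theta> c, the boundary input for
  the principle applied to \<nabla>F.\<close>

lemma heat_bounds:
  fixes \<alpha> \<beta> :: real
  defines "c \<equiv> (\<beta> - \<alpha>) / (1 + A + B)"
  assumes ab: "\<alpha> < \<beta>" and ww1: "sol_deriv w w1"
    and phi: "continuous_on {0..1} \<phi>" "continuous_on {0..1} \<phi>'"
      "\<And>x. x \<in> {0..1} \<Longrightarrow> \<alpha> < \<phi> x" "\<And>x. x \<in> {0..1} \<Longrightarrow> \<phi> x < \<beta>" "\<And>x. x \<in> {0..1} \<Longrightarrow> 0 < \<phi>' x"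
    and lim: "uniform_limit {0..1} w (\<lambda>x. \<phi> x - (\<alpha> + c * (A + x))) (at_right 0)"
      "uniform_limit {0..1} (\<lambda>t x. - K1 (w1 t) x) (\<lambda>x. \<phi>' x - c) (at_right 0)"
    and t: "0 < t" and x: "x \<in> {0..1}"
  shows "\<alpha> < w t x + (\<alpha> + c * (A + x))" "w t x + (\<alpha> + c * (A + x)) < \<beta>" "0 < - K1 (w1 t) x + c"
proof -
  note w = sol_derivD[OF ww1]
  obtain w2 where w12: "sol_deriv w1 w2" by (rule sol_time_deriv[OF w(2)])
  note w2 = sol_derivD(2-)[OF w12]
  have c: "0 < c" using ab S_pos by (simp add: c_def)
  have cS: "c * (1 + A + B) = \<beta> - \<alpha>" using S_pos by (simp add: c_def)
  have pos_min: "\<exists>m>0. \<forall>x\<in>{0..1}. m \<le> g x" if cg: "continuous_on {0..1} g" and pg: "\<And>x. x \<in> {0..1} \<Longrightarrow> 0 < g x" for g :: "real \<Rightarrow> real"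
  proof -
    obtain y where y: "y \<in> {0..1}" "\<forall>x\<in>{0..1}. g y \<le> g x"
      using continuous_attains_inf[OF compact_Icc _ cg] by auto
    then show ?thesis using pg[OF y(1)] by blast
  qed
  have "continuous_on {0..1} (\<lambda>x. \<phi> x - \<alpha>)" "continuous_on {0..1} (\<lambda>x. \<beta> - \<phi> x)"
    by (intro continuous_intros phi)+
  note cphi = this
  obtain m1 where m1: "0 < m1" "\<And>x. x \<in> {0..1} \<Longrightarrow> m1 \<le> \<phi> x - \<alpha>"
    using pos_min[OF cphi(1)] phi(3) by auto
  obtain m2 where m2: "0 < m2" "\<And>x. x \<in> {0..1} \<Longrightarrow> m2 \<le> \<beta> - \<phi> x"
    using pos_min[OF cphi(2)] phi(4) by auto
  obtain m3 where m3: "0 < m3" "\<And>x. x \<in> {0..1} \<Longrightarrow> m3 \<le> \<phi>' x"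
    using pos_min[OF phi(2,5)] by auto
  note m = m1(1) m2(1) m3(1) m1(2) m2(2) m3(2)
  define M where "M = min m1 (min m2 m3)"
  have M: "0 < M" "M \<le> m1" "M \<le> m2" "M \<le> m3" using m(1-3) by (auto simp: M_def)
  \<comment> \<open>The barriers are at most \<beta> - \<alpha>, so \<theta> times a barrier uses at
    most half of the initial margin M; the other half absorbs the deviation from the datum at the
    starting time.\<close>
  define \<theta> where "\<theta> = min 1 (M / (2 * (\<beta> - \<alpha>)))"
  have th: "0 < \<theta>" "\<theta> \<le> 1" using M ab by (auto simp: \<theta>_def)
  have thM: "\<theta> * r \<le> M / 2" if "0 \<le> r" "r \<le> \<beta> - \<alpha>" for r
  proof -
    have "\<theta> * r \<le> M / (2 * (\<beta> - \<alpha>)) * (\<beta> - \<alpha>)"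
      using that th M ab by (intro mult_mono) (auto simp: \<theta>_def)
    moreover have "M / (2 * d) * d = M / 2" if "d \<noteq> 0" for d :: real using that by simp
    from this[of "\<beta> - \<alpha>"] have "M / (2 * (\<beta> - \<alpha>)) * (\<beta> - \<alpha>) = M / 2" using ab by linarith
    ultimately show ?thesis by (simp only:)
  qed
  have cAx: "0 < c * (A + y)" "c * (A + y) \<le> \<beta> - \<alpha>" "0 < \<beta> - \<alpha> - c * (A + y)" if "y \<in> {0..1}" for y
  proof -
    show "0 < c * (A + y)" using c A_pos that by (intro mult_pos_pos) auto
    have "c * (A + y) < c * (1 + A + B)" using c B_pos that by (intro mult_strict_left_mono) auto
    then show "c * (A + y) \<le> \<beta> - \<alpha>" "0 < \<beta> - \<alpha> - c * (A + y)" using cS by auto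
  qed
  \<comment> \<open>Classical derivatives exist for positive times only, so the principle is started
    at some small s > 0.\<close>
  have "\<forall>\<^sub>F s in at_right 0. 0 < s \<and> s < t"
    using t unfolding eventually_at_right_field by blast
  moreover have "\<forall>\<^sub>F s in at_right 0. \<forall>x\<in>{0..1}. dist (w s x) (\<phi> x - (\<alpha> + c * (A + x))) < M / 2"
    by (rule uniform_limitD[OF lim(1)]) (use M in simp)
  moreover have "\<forall>\<^sub>F s in at_right 0. \<forall>x\<in>{0..1}. dist (- K1 (w1 s) x) (\<phi>' x - c) < M / 2"
    by (rule uniform_limitD[OF lim(2)]) (use M in simp)
  ultimately have "\<forall>\<^sub>F s in at_right 0. 0 < s \<and> s < t
      \<and> (\<forall>x\<in>{0..1}. dist (w s x) (\<phi> x - (\<alpha> + c * (A + x))) < M / 2)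
      \<and> (\<forall>x\<in>{0..1}. dist (- K1 (w1 s) x) (\<phi>' x - c) < M / 2)"
    by eventually_elim simp
  from eventually_happens'[OF _ this] obtain s where s: "0 < s" "s < t"
    "\<And>x. x \<in> {0..1} \<Longrightarrow> \<bar>w s x - (\<phi> x - (\<alpha> + c * (A + x)))\<bar> < M / 2"
    "\<And>x. x \<in> {0..1} \<Longrightarrow> \<bar>- K1 (w1 s) x - (\<phi>' x - c)\<bar> < M / 2"
    by (auto simp: dist_real_def)
  have sub: "{s..T} \<times> {0..1::real} \<subseteq> {0<..} \<times> {0..1}" for T using s by auto
  note cw = continuous_on_subset[OF solD(1)[OF w(1), unfolded scont_def] sub, unfolded split_beta]
  note cK = continuous_on_subset[OF scont_K(2)[OF solD(1)[OF w(2)], unfolded scont_def] sub, unfolded split_beta]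
  have low: "0 \<le> w r y + c * (A + y) - \<theta> * (c * (A + y))" if r: "s \<le> r" and y: "y \<in> {0..1}" for r y
  proof (rule heat_min_principle[where s = s and T = r and zt = w1
        and z = "\<lambda>r y. w r y + c * (A + y) - \<theta> * (c * (A + y))" and zx = "\<lambda>r y. - K1 (w1 r) y + c - \<theta> * c"])
    show "continuous_on ({s..r} \<times> {0..1}) (\<lambda>(r, y). w r y + c * (A + y) - \<theta> * (c * (A + y)))"
      unfolding split_beta by (intro continuous_intros cw)
    fix r y :: real assume r: "s < r" and y: "y \<in> {0..1}"
    then have r0: "0 < r" using s by simp
    note sd = sol_space_deriv[OF ww1 r0]
    show "((\<lambda>r. w r y + c * (A + y) - \<theta> * (c * (A + y))) has_real_derivative w1 r y) (at r)"
      using tderD[OF w(3) r0 y] by (auto intro!: derivative_eq_intros)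
    show "((\<lambda>y. w r y + c * (A + y) - \<theta> * (c * (A + y))) has_real_derivative - K1 (w1 r) y + c - \<theta> * c) (at y within {0..1})"
      using sd(1)[OF y] by (auto intro!: derivative_eq_intros)
    show "((\<lambda>y. - K1 (w1 r) y + c - \<theta> * c) has_real_derivative w1 r y) (at y within {0..1})"
      using DERIV_diff[OF DERIV_add[OF sd(2)[OF y] DERIV_const[of c]] DERIV_const[of "\<theta> * c"]] by simp
  next
    fix y :: real assume y: "y \<in> {0..1}"
    show "0 \<le> w s y + c * (A + y) - \<theta> * (c * (A + y))"
      using s(3)[OF y] m(4)[OF y] M thM[OF less_imp_le[OF cAx(1)[OF y]] cAx(2)[OF y]] by linarith
  next
    fix r assume r: "s < r" and neg: "w r 0 + c * (A + 0) - \<theta> * (c * (A + 0)) < 0"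
    then have r0: "0 < r" using s by simp
    have "- K1 (w1 r) 0 + c - \<theta> * c = (w r 0 + c * (A + 0) - \<theta> * (c * (A + 0))) / A"
      unfolding sol_space_deriv(3)[OF ww1 r0] using A_pos by (simp add: field_simps)
    then show "- K1 (w1 r) 0 + c - \<theta> * c < 0" using neg A_pos by (simp only:) (simp add: divide_less_0_iff)
  next
    fix r assume r: "s < r" and neg: "w r 1 + c * (A + 1) - \<theta> * (c * (A + 1)) < 0"
    then have r0: "0 < r" using s by simp
    \<comment> \<open>At this end the barrier misses the Robin data, but the defect (1 - \<theta>)
      (\<beta> - \<alpha>) has the favourable sign.\<close>
    have "- K1 (w1 r) 1 + c - \<theta> * c = ((1 - \<theta>) * (\<beta> - \<alpha>) - (w r 1 + c * (A + 1) - \<theta> * (c * (A + 1)))) / B"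
      unfolding sol_space_deriv(4)[OF ww1 r0] cS[symmetric] using B_pos by (simp add: field_simps)
    moreover have "0 \<le> (1 - \<theta>) * (\<beta> - \<alpha>)" using th ab by simp
    ultimately show "0 < - K1 (w1 r) 1 + c - \<theta> * c" using neg B_pos by (simp only:) (simp add: zero_less_divide_iff)
  qed (use r y in auto)
  have high: "0 \<le> \<beta> - \<alpha> - (w r y + c * (A + y)) - \<theta> * (\<beta> - \<alpha> - c * (A + y))" if r: "s \<le> r" and y: "y \<in> {0..1}" for r y
  proof (rule heat_min_principle[where s = s and T = r and zt = "\<lambda>r y. - w1 r y"
        and z = "\<lambda>r y. \<beta> - \<alpha> - (w r y + c * (A + y)) - \<theta> * (\<beta> - \<alpha> - c * (A + y))"
        and zx = "\<lambda>r y. K1 (w1 r) y - c + \<theta> * c"])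
    show "continuous_on ({s..r} \<times> {0..1}) (\<lambda>(r, y). \<beta> - \<alpha> - (w r y + c * (A + y)) - \<theta> * (\<beta> - \<alpha> - c * (A + y)))"
      unfolding split_beta by (intro continuous_intros cw)
    fix r y :: real assume r: "s < r" and y: "y \<in> {0..1}"
    then have r0: "0 < r" using s by simp
    note sd = sol_space_deriv[OF ww1 r0]
    show "((\<lambda>r. \<beta> - \<alpha> - (w r y + c * (A + y)) - \<theta> * (\<beta> - \<alpha> - c * (A + y))) has_real_derivative - w1 r y) (at r)"
      using tderD[OF w(3) r0 y] by (auto intro!: derivative_eq_intros)
    show "((\<lambda>y. \<beta> - \<alpha> - (w r y + c * (A + y)) - \<theta> * (\<beta> - \<alpha> - c * (A + y))) has_real_derivative K1 (w1 r) y - c + \<theta> * c) (at y within {0..1})"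
      using sd(1)[OF y] by (auto intro!: derivative_eq_intros)
    show "((\<lambda>y. K1 (w1 r) y - c + \<theta> * c) has_real_derivative - w1 r y) (at y within {0..1})"
      using DERIV_add[OF DERIV_diff[OF DERIV_minus[OF sd(2)[OF y]] DERIV_const[of c]] DERIV_const[of "\<theta> * c"]] by simp
  next
    fix y :: real assume y: "y \<in> {0..1}"
    show "0 \<le> \<beta> - \<alpha> - (w s y + c * (A + y)) - \<theta> * (\<beta> - \<alpha> - c * (A + y))"
      using s(3)[OF y] m(5)[OF y] M thM[OF less_imp_le[OF cAx(3)[OF y]]] cAx(1)[OF y] by linarith
  next
    fix r assume r: "s < r" and neg: "\<beta> - \<alpha> - (w r 0 + c * (A + 0)) - \<theta> * (\<beta> - \<alpha> - c * (A + 0)) < 0"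
    then have r0: "0 < r" using s by simp
    have "- (- K1 (w1 r) 0) - c + \<theta> * c
        = ((\<beta> - \<alpha> - (w r 0 + c * (A + 0)) - \<theta> * (\<beta> - \<alpha> - c * (A + 0))) - (1 - \<theta>) * (\<beta> - \<alpha>)) / A"
      unfolding sol_space_deriv(3)[OF ww1 r0] using A_pos by (simp add: field_simps)
    moreover have "0 \<le> (1 - \<theta>) * (\<beta> - \<alpha>)" using th ab by simp
    ultimately show "K1 (w1 r) 0 - c + \<theta> * c < 0" using neg A_pos by (simp only: minus_minus) (simp add: divide_less_0_iff)
  next
    fix r assume r: "s < r" and neg: "\<beta> - \<alpha> - (w r 1 + c * (A + 1)) - \<theta> * (\<beta> - \<alpha> - c * (A + 1)) < 0"
    then have r0: "0 < r" using s by simp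
    have "- (- K1 (w1 r) 1) - c + \<theta> * c
        = - (\<beta> - \<alpha> - (w r 1 + c * (A + 1)) - \<theta> * (\<beta> - \<alpha> - c * (A + 1))) / B"
      unfolding sol_space_deriv(4)[OF ww1 r0] cS[symmetric] using B_pos by (simp add: field_simps)
    then show "0 < K1 (w1 r) 1 - c + \<theta> * c" using neg B_pos by (simp only: minus_minus) (simp add: zero_less_divide_iff divide_less_0_iff)
  qed (use r y in auto)
  \<comment> \<open>M / 2 serves the starting time, \<theta> c the two end points.\<close>
  define c0 where "c0 = min (M / 2) (\<theta> * c)"
  have c0: "0 < c0" using M th c by (simp add: c0_def)
  have grad: "0 \<le> - K1 (w1 r) y + c - c0" if r: "s \<le> r" and y: "y \<in> {0..1}" for r y
  proof (rule heat_min_principle[where s = s and T = r and zt = "\<lambda>r y. - K1 (w2 r) y"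
        and z = "\<lambda>r y. - K1 (w1 r) y + c - c0" and zx = w1])
    show "continuous_on ({s..r} \<times> {0..1}) (\<lambda>(r, y). - K1 (w1 r) y + c - c0)"
      unfolding split_beta by (intro continuous_intros cK)
    fix r y :: real assume r: "s < r" and y: "y \<in> {0..1}"
    then have r0: "0 < r" using s by simp
    have "((\<lambda>r. K1 (w1 r) y) has_real_derivative K1 (w2 r) y) (at r)"
      by (rule tderD[OF K_tder(2) r0 y]) (intro solD w w2)+
    then show "((\<lambda>r. - K1 (w1 r) y + c - c0) has_real_derivative - K1 (w2 r) y) (at r)"
      by (auto intro!: derivative_eq_intros)
    show "((\<lambda>y. - K1 (w1 r) y + c - c0) has_real_derivative w1 r y) (at y within {0..1})"
      using DERIV_diff[OF DERIV_add[OF sol_space_deriv(2)[OF ww1 r0 y] DERIV_const[of c]] DERIV_const[of c0]] by simp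
    show "(w1 r has_real_derivative - K1 (w2 r) y) (at y within {0..1})"
      by (rule sol_space_deriv(1)[OF w12 r0 y])
  next
    fix y :: real assume y: "y \<in> {0..1}"
    have "c0 \<le> M / 2" by (simp add: c0_def)
    then show "0 \<le> - K1 (w1 s) y + c - c0"
      using s(4)[OF y] m(6)[OF y] M by linarith
  next
    fix r assume r: "s < r" and neg: "- K1 (w1 r) 0 + c - c0 < 0"
    then have r0: "0 < r" using s by simp
    \<comment> \<open>\<open>low\<close> puts the boundary value above \<open>c0\<close>, so
      \<open>neg\<close> is refuted; at the other end \<open>high\<close> does the same.\<close>
    have "- K1 (w1 r) 0 + c - \<theta> * c = (w r 0 + c * (A + 0) - \<theta> * (c * (A + 0))) / A"
      unfolding sol_space_deriv(3)[OF ww1 r0] using A_pos by (simp add: field_simps)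
    moreover have "0 \<le> (w r 0 + c * (A + 0) - \<theta> * (c * (A + 0))) / A"
      by (rule divide_nonneg_pos[OF low A_pos]) (use r in auto)
    moreover have "c0 \<le> \<theta> * c" by (simp add: c0_def)
    ultimately show "w1 r 0 < 0" using neg by linarith
  next
    fix r assume r: "s < r" and neg: "- K1 (w1 r) 1 + c - c0 < 0"
    then have r0: "0 < r" using s by simp
    have "- K1 (w1 r) 1 + c - \<theta> * c = (\<beta> - \<alpha> - (w r 1 + c * (A + 1)) - \<theta> * (\<beta> - \<alpha> - c * (A + 1))) / B"
      unfolding sol_space_deriv(4)[OF ww1 r0] cS[symmetric] using B_pos by (simp add: field_simps)
    moreover have "0 \<le> (\<beta> - \<alpha> - (w r 1 + c * (A + 1)) - \<theta> * (\<beta> - \<alpha> - c * (A + 1))) / B"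
      by (rule divide_nonneg_pos[OF high B_pos]) (use r in auto)
    moreover have "c0 \<le> \<theta> * c" by (simp add: c0_def)
    ultimately show "0 < w1 r 1" using neg by linarith
  qed (use r y in auto)
  have st: "s \<le> t" using s by simp
  have "0 < \<theta> * (c * (A + x))" "0 < \<theta> * (\<beta> - \<alpha> - c * (A + x))" using th cAx[OF x] by simp_all
  with low[OF st x] high[OF st x] grad[OF st x] c0
  show "\<alpha> < w t x + (\<alpha> + c * (A + x))" "w t x + (\<alpha> + c * (A + x)) < \<beta>" "0 < - K1 (w1 t) x + c"
    by linarith+
qed

end

section \<open>Generalized solutions\<close>

lemma LINT_continuous:
  fixes f :: "real \<Rightarrow> real"
  assumes "continuous_on {a..b} f"
  shows "set_integrable lebesgue {a..b} f" "(LINT x:{a..b}|lebesgue. f x) = integral {a..b} f"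
proof -
  show *: "set_integrable lebesgue {a..b} f" by (rule absolutely_integrable_continuous_real[OF assms])
  show "(LINT x:{a..b}|lebesgue. f x) = integral {a..b} f" by (rule set_lebesgue_integral_eq_integral(2)[OF *])
qed

text \<open>The point p may be an end point, with all the mass on one side of it; this is how
  boundary values are extracted below.\<close>

lemma approximate_identity:
  fixes F :: "real \<Rightarrow> real"
  assumes F: "continuous_on {0..1} F" and p: "p \<in> {0..1}"
    and rc: "\<And>n. continuous_on {0..1} (\<rho> n)" and pos: "\<And>n x. x \<in> {0..1} \<Longrightarrow> 0 \<le> \<rho> n x"
    and one: "\<And>n. integral {0..1} (\<rho> n) = 1"
    and supp: "\<And>n x. x \<in> {0..1} \<Longrightarrow> r n < \<bar>x - p\<bar> \<Longrightarrow> \<rho> n x = 0" and r: "r \<longlonglongrightarrow> 0"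
  shows "(\<lambda>n. integral {0..1} (\<lambda>x. F x * \<rho> n x)) \<longlonglongrightarrow> F p"
proof (rule LIMSEQ_I)
  fix e :: real assume e: "0 < e"
  obtain d where d: "0 < d" "\<And>x. x \<in> {0..1} \<Longrightarrow> dist x p < d \<Longrightarrow> dist (F x) (F p) < e / 2"
    using F p e unfolding continuous_on_iff by (meson half_gt_zero)
  obtain N where N: "\<And>n. N \<le> n \<Longrightarrow> r n < d"
    using order_tendstoD(2)[OF r d(1)] by (auto simp: eventually_sequentially)
  show "\<exists>N. \<forall>n\<ge>N. norm (integral {0..1} (\<lambda>x. F x * \<rho> n x) - F p) < e"
  proof (intro exI[of _ N] allI impI)
    fix n assume n: "N \<le> n"
    have i: "(\<lambda>x. F x * \<rho> n x) integrable_on {0..1}" "(\<lambda>x. F p * \<rho> n x) integrable_on {0..1}"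
      by (intro integrable_continuous_interval continuous_intros F rc)+
    have "integral {0..1} (\<lambda>x. F x * \<rho> n x) - F p = integral {0..1} (\<lambda>x. F x * \<rho> n x - F p * \<rho> n x)"
      using one[of n] by (simp add: integral_diff[OF i])
    also have "norm \<dots> \<le> integral {0..1} (\<lambda>x. e / 2 * \<rho> n x)"
    proof (rule integral_norm_bound_integral)
      fix x :: real assume x: "x \<in> {0..1}"
      show "norm (F x * \<rho> n x - F p * \<rho> n x) \<le> e / 2 * \<rho> n x"
      proof (cases "r n < \<bar>x - p\<bar>")
        case False
        then have "\<bar>F x - F p\<bar> \<le> e / 2" using d(2)[OF x] N[OF n] by (simp add: dist_real_def)
        from mult_right_mono[OF this pos[OF x, of n]] show ?thesis
          unfolding left_diff_distrib[symmetric] real_norm_def abs_mult using pos[OF x, of n] by simp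
      qed (simp add: supp[OF x])
    qed (intro integrable_continuous_interval continuous_intros F rc)+
    also have "\<dots> = e / 2" using one[of n] by simp
    finally show "norm (integral {0..1} (\<lambda>x. F x * \<rho> n x) - F p) < e" using e by simp
  qed
qed

section \<open>Cut-offs and integration by parts for weak derivatives\<close>

definition ramp :: "real \<Rightarrow> real"
  where "ramp r = 2 * (max 0 r)\<^sup>2 - 4 * (max 0 (r - 1 / 2))\<^sup>2 + 2 * (max 0 (r - 1))\<^sup>2"

text \<open>A tent over [0, 1] of height 2 and mass 1. Its primitive \<open>ramp\<close> is a C^1
  step from 0 to 1, smooth enough to build test functions.\<close>

definition ramp' :: "real \<Rightarrow> real"
  where "ramp' r = 4 * max 0 r - 8 * max 0 (r - 1 / 2) + 4 * max 0 (r - 1)"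

lemma pospart_sq_deriv: "((\<lambda>r::real. (max 0 r)\<^sup>2) has_real_derivative 2 * max 0 r) (at r)"
proof -
  consider "r < 0" | "r = 0" | "0 < r" by linarith
  then show ?thesis
  proof cases
    case 1
    have "((\<lambda>_. 0) has_real_derivative 0) (at r)" by simp
    from has_field_derivative_transform_within_open[OF this open_lessThan[of 0], of "\<lambda>r. (max 0 r)\<^sup>2"] 1
    show ?thesis by simp
  next
    case 3
    have "((\<lambda>r. r\<^sup>2) has_real_derivative 2 * r) (at r)" by (auto intro!: derivative_eq_intros)
    from has_field_derivative_transform_within_open[OF this open_greaterThan[of 0], of "\<lambda>r. (max 0 r)\<^sup>2"] 3
    show ?thesis by simp
  next
    case 2
    have "((\<lambda>h. ((max 0 (0 + h))\<^sup>2 - (max 0 (0::real))\<^sup>2) / h) \<longlongrightarrow> 0) (at 0)"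
    proof (rule Lim_null_comparison)
      show "\<forall>\<^sub>F h in at 0. norm (((max 0 (0 + h))\<^sup>2 - (max 0 (0::real))\<^sup>2) / h) \<le> \<bar>h\<bar>"
        by (intro always_eventually allI) (auto simp: max_def power2_eq_square)
      show "((\<lambda>h::real. \<bar>h\<bar>) \<longlongrightarrow> 0) (at 0)" by (intro tendsto_rabs_zero tendsto_ident_at)
    qed
    then show ?thesis using 2 by (simp add: DERIV_def)
  qed
qed

lemma ramp_deriv: "(ramp has_real_derivative ramp' r) (at r)"
proof -
  have s: "((\<lambda>r. (max 0 (r - a))\<^sup>2) has_real_derivative 2 * max 0 (r - a)) (at r)" for a :: real
    using DERIV_shift[of "\<lambda>r. (max 0 r)\<^sup>2" "2 * max 0 (r - a)" r "- a"] pospart_sq_deriv[of "r - a"] by simp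
  have "(ramp has_real_derivative 2 * (2 * max 0 r) - 4 * (2 * max 0 (r - 1 / 2)) + 2 * (2 * max 0 (r - 1))) (at r)"
    unfolding ramp_def[abs_def] by (intro DERIV_add DERIV_diff DERIV_cmult s pospart_sq_deriv)
  then show ?thesis by (simp add: ramp'_def)
qed

lemma ramp_props:
  "r \<le> 0 \<Longrightarrow> ramp r = 0" "1 \<le> r \<Longrightarrow> ramp r = 1" "0 \<le> ramp' r" "r \<le> 0 \<Longrightarrow> ramp' r = 0" "1 \<le> r \<Longrightarrow> ramp' r = 0"
  by (auto simp: ramp_def ramp'_def max_def power2_eq_square algebra_simps)

lemma ramp_mono: "r \<le> s \<Longrightarrow> ramp r \<le> ramp s"
  by (rule DERIV_nonneg_imp_nondecreasing) (auto intro!: exI ramp_deriv ramp_props)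

lemma ramp_range: "0 \<le> ramp r" "ramp r \<le> 1"
  using ramp_mono[of "min 0 r" r] ramp_mono[of r "max 1 r"] by (auto simp: ramp_props)

lemma ramp'_cont: "continuous_on S ramp'"
  unfolding ramp'_def[abs_def] by (intro continuous_intros)

text \<open>Test functions for the weak derivative vanish near 0 and 1, so k is multiplied by a
  cut-off. The derivative of the cut-off consists of two bumps tending to unit masses at the end
  points, which produce the boundary terms; the rest passes to the limit by dominated
  convergence.\<close>

lemma weak_deriv_by_parts:
  assumes H: "H1_weak_deriv f g" and f: "continuous_on {0..1} f"
    and k: "\<And>x. x \<in> {0..1} \<Longrightarrow> (k has_real_derivative k' x) (at x within {0..1})" and k': "continuous_on {0..1} k'"
  shows "set_integrable lebesgue {0..1} (\<lambda>x. g x * k x)"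
    "(LINT x:{0..1}|lebesgue. g x * k x) = f 1 * k 1 - f 0 * k 0 - ip f k'"
proof -
  have ck: "continuous_on {0..1} k" by (rule DERIV_continuous_on[OF k])
  have gm: "g \<in> borel_measurable (lebesgue_on {0..1})" and g2: "set_integrable lebesgue {0..1} (\<lambda>x. (g x)\<^sup>2)"
    using H by (auto simp: H1_weak_deriv_def)
  have gm': "(\<lambda>x. indicator {0..1} x * g x) \<in> borel_measurable lebesgue"
    using gm by (subst (asm) borel_measurable_restrict_space_iff) simp_all
  \<comment> \<open>g is only known to be square integrable; |g| \<le> 1 + g^2 gives an integrable
    majorant.\<close>
  have int_mult: "integrable lebesgue (\<lambda>x. indicator {0..1} x * (g x * h x))"
    if h: "(\<lambda>x. indicator {0..1} x * h x) \<in> borel_measurable lebesgue" and b: "\<And>x. x \<in> {0..1} \<Longrightarrow> \<bar>h x\<bar> \<le> C" for h C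
  proof (rule Bochner_Integration.integrable_bound)
    have "integrable lebesgue (\<lambda>x::real. indicator {0..1} x * (1::real))"
      using LINT_continuous(1)[OF continuous_on_const[of "{0..1}" "1::real"]]
      unfolding set_integrable_def real_scaleR_def .
    then show "integrable lebesgue (\<lambda>x. C * (indicator {0..1} x * 1 + indicator {0..1} x * (g x)\<^sup>2))"
      using g2 by (intro integrable_mult_right integrable_add) (simp_all add: set_integrable_def)
    have "(\<lambda>x. (indicator {0..1} x * g x) * (indicator {0..1} x * h x)) \<in> borel_measurable lebesgue"
      by (intro borel_measurable_times gm' h)
    also have "(\<lambda>x. (indicator {0..1} x * g x) * (indicator {0..1} x * h x)) = (\<lambda>x. indicator {0..1} x * (g x * h x))"
      by (auto simp: fun_eq_iff indicator_def)
    finally show "(\<lambda>x. indicator {0..1} x * (g x * h x)) \<in> borel_measurable lebesgue" .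
    show "AE x in lebesgue. norm (indicator {0..1} x * (g x * h x)) \<le> norm (C * (indicator {0..1} x * 1 + indicator {0..1} x * (g x)\<^sup>2))"
    proof (intro AE_I2)
      fix x :: real
      show "norm (indicator {0..1} x * (g x * h x)) \<le> norm (C * (indicator {0..1} x * 1 + indicator {0..1} x * (g x)\<^sup>2))"
      proof (cases "x \<in> {0..1}")
        case True
        have C: "0 \<le> C" using b[OF True] by simp
        have "0 \<le> (\<bar>g x\<bar> - 1)\<^sup>2 + (\<bar>g x\<bar>)\<^sup>2 + 1" by (intro add_nonneg_nonneg) auto
        then have "\<bar>g x\<bar> \<le> 1 + (g x)\<^sup>2" by (simp add: power2_diff)
        then have "\<bar>g x\<bar> * \<bar>h x\<bar> \<le> (1 + (g x)\<^sup>2) * C" using b[OF True] by (intro mult_mono) auto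
        then show ?thesis using True C by (simp add: abs_mult mult.commute)
      qed simp
    qed
  qed
  have contm: "(\<lambda>x. indicator {0..1} x * h x) \<in> borel_measurable lebesgue" if "continuous_on {0..1} h" for h :: "real \<Rightarrow> real"
    using borel_measurable_integrable[OF LINT_continuous(1)[OF that, unfolded set_integrable_def]] by simp
  obtain C where C: "\<And>x. x \<in> {0..1} \<Longrightarrow> \<bar>k x\<bar> \<le> C"
    using compact_imp_bounded[OF compact_continuous_image[OF ck compact_Icc]] unfolding bounded_iff real_norm_def by blast
  show sk: "set_integrable lebesgue {0..1} (\<lambda>x. g x * k x)"
    using int_mult[OF contm[OF ck] C] by (simp add: set_integrable_def)
  \<comment> \<open>The offset 4 ensures 2 d n \<le> 1 - 2 d n, so the rise on [d n, 2 d n] and the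
    fall on [1 - 2 d n, 1 - d n] do not overlap.\<close>
  define d where "d n = inverse (real (n + 4))" for n
  have d: "0 < d n" "d n \<le> 1 / 4" for n
    by (auto simp: d_def inverse_eq_divide intro!: divide_left_mono)
  have dlim: "d \<longlonglongrightarrow> 0"
    unfolding d_def using LIMSEQ_ignore_initial_segment[OF tendsto_inverse_0_at_top[OF filterlim_real_sequentially], of 4] by simp
  define s1 where "s1 n x = ramp ((x - d n) / d n)" for n x
  define s2 where "s2 n x = ramp ((1 - d n - x) / d n)" for n x
  \<comment> \<open>At every point one of the two steps equals 1, so this sum agrees with their
    product, and its derivative splits directly into the two bumps.\<close>
  define cut where "cut n x = s1 n x + s2 n x - 1" for n x
  define \<rho>1 where "\<rho>1 n x = ramp' ((x - d n) / d n) / d n" for n x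
  define \<rho>2 where "\<rho>2 n x = ramp' ((1 - d n - x) / d n) / d n" for n x
  have ds1: "(s1 n has_real_derivative \<rho>1 n x) (at x)" for n x
  proof -
    have "((\<lambda>x. (x - d n) / d n) has_real_derivative 1 / d n) (at x)"
      using d(1)[of n] by (auto intro!: derivative_eq_intros)
    from DERIV_chain2[OF ramp_deriv this] show ?thesis by (simp add: s1_def[abs_def] \<rho>1_def)
  qed
  have ds2: "(s2 n has_real_derivative - \<rho>2 n x) (at x)" for n x
  proof -
    have "((\<lambda>x. (1 - d n - x) / d n) has_real_derivative - 1 / d n) (at x)"
      using d(1)[of n] by (auto intro!: derivative_eq_intros)
    from DERIV_chain2[OF ramp_deriv this] show ?thesis by (simp add: s2_def[abs_def] \<rho>2_def)
  qed
  have dchi: "(cut n has_real_derivative \<rho>1 n x - \<rho>2 n x) (at x)" for n x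
    unfolding cut_def[abs_def] using DERIV_diff[OF DERIV_add[OF ds1 ds2] DERIV_const] by simp
  have crho: "continuous_on S (\<rho>1 n)" "continuous_on S (\<rho>2 n)" for S n
    unfolding \<rho>1_def[abs_def] \<rho>2_def[abs_def] using d(1)[of n]
    by (auto intro!: continuous_intros continuous_on_compose2[OF ramp'_cont[of UNIV]])
  have cchi: "continuous_on S (cut n)" for S n
    using dchi by (meson DERIV_continuous continuous_at_imp_continuous_on)
  have rpos: "0 \<le> \<rho>1 n x" "0 \<le> \<rho>2 n x" for n x
    using d(1)[of n] by (auto simp: \<rho>1_def \<rho>2_def ramp_props)
  have arg1: "x \<le> d n \<Longrightarrow> (x - d n) / d n \<le> 0" "2 * d n \<le> x \<Longrightarrow> 1 \<le> (x - d n) / d n" for n x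
    using d(1)[of n] by (auto simp: divide_le_0_iff le_divide_eq)
  have arg2: "1 - d n \<le> x \<Longrightarrow> (1 - d n - x) / d n \<le> 0" "x \<le> 1 - 2 * d n \<Longrightarrow> 1 \<le> (1 - d n - x) / d n" for n x
    using d(1)[of n] by (auto simp: divide_le_0_iff le_divide_eq)
  have rsupp: "\<rho>1 n x = 0" if "x \<le> d n \<or> 2 * d n \<le> x" for n x
    using that ramp_props(4)[OF arg1(1)] ramp_props(5)[OF arg1(2)] by (auto simp: \<rho>1_def)
  have rsupp2: "\<rho>2 n x = 0" if "1 - d n \<le> x \<or> x \<le> 1 - 2 * d n" for n x
    using that ramp_props(4)[OF arg2(1)] ramp_props(5)[OF arg2(2)] by (auto simp: \<rho>2_def)
  have s1v: "x \<le> d n \<Longrightarrow> s1 n x = 0" "2 * d n \<le> x \<Longrightarrow> s1 n x = 1" for n x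
    using ramp_props(1)[OF arg1(1)] ramp_props(2)[OF arg1(2)] by (auto simp: s1_def)
  have s2v: "1 - d n \<le> x \<Longrightarrow> s2 n x = 0" "x \<le> 1 - 2 * d n \<Longrightarrow> s2 n x = 1" for n x
    using ramp_props(1)[OF arg2(1)] ramp_props(2)[OF arg2(2)] by (auto simp: s2_def)
  have chi0: "cut n x = 0" if "x \<le> d n \<or> 1 - d n \<le> x" for n x
    using that d[of n] s1v(1)[of x n] s1v(2)[of n x] s2v(1)[of n x] s2v(2)[of x n] by (auto simp: cut_def)
  have chi1: "cut n x = 1" if "2 * d n \<le> x" "x \<le> 1 - 2 * d n" for n x
    using that s1v s2v by (simp add: cut_def)
  have chib: "\<bar>cut n x\<bar> \<le> 1" for n x
    using ramp_range[of "(x - d n) / d n"] ramp_range[of "(1 - d n - x) / d n"]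
    by (simp add: cut_def s1_def s2_def abs_le_iff)
  define \<phi> where "\<phi> n x = (if x \<in> {0..1} then k x * cut n x else 0)" for n x
  define D where "D n x = (if x \<in> {0..1} then k' x * cut n x + k x * (\<rho>1 n x - \<rho>2 n x) else 0)" for n x
  have phi0: "\<phi> n x = 0" if "x \<notin> {d n..1 - d n}" for n x
    using that chi0[of x n] by (auto simp: \<phi>_def)
  have D0: "D n x = 0" if "x \<notin> {d n..1 - d n}" for n x
    using that chi0[of x n] rsupp[of x n] rsupp2[of n x] d[of n] by (auto simp: D_def)
  have dphi: "(\<phi> n has_real_derivative D n x) (at x)" for n x
  proof (cases "x \<in> {0<..<1}")
    case True
    have "(k has_real_derivative k' x) (at x)" using k[of x] True by (simp add: at_within_Icc_at)
    from DERIV_mult[OF this dchi[of n x]]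
    have "((\<lambda>x. k x * cut n x) has_real_derivative D n x) (at x)"
      using True by (simp add: D_def mult.commute add.commute)
    then show ?thesis
      by (rule has_field_derivative_transform_within_open[OF _ open_greaterThanLessThan True]) (auto simp: \<phi>_def)
  next
    case False
    then have x: "x \<in> - {d n..1 - d n}" using d(1)[of n] by auto
    have "((\<lambda>_. 0) has_real_derivative D n x) (at x)" using D0[of x n] x by simp
    then show ?thesis
      by (rule has_field_derivative_transform_within_open[OF _ _ x]) (auto simp: phi0)
  qed
  \<comment> \<open>Two open sets cover the line: on one the formula for \<open>D\<close> applies,
    on the other \<open>D\<close> is 0.\<close>
  have cD: "continuous_on UNIV (D n)" for n
  proof -
    have "continuous_on {0<..<1} (D n)"
    proof (rule continuous_on_eq)
      show "continuous_on {0<..<1} (\<lambda>x. k' x * cut n x + k x * (\<rho>1 n x - \<rho>2 n x))"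
        by (intro continuous_intros crho cchi continuous_on_subset[OF k'] continuous_on_subset[OF ck]) auto
    qed (simp add: D_def)
    moreover have "continuous_on (- {d n..1 - d n}) (D n)"
      by (rule continuous_on_eq[of _ "\<lambda>_. 0"]) (auto simp: D0)
    ultimately have "continuous_on ({0<..<1} \<union> - {d n..1 - d n}) (D n)"
      by (intro continuous_on_open_Un) auto
    also have "{0<..<1} \<union> - {d n..1 - d n} = UNIV" using d(1)[of n] by auto
    finally show ?thesis .
  qed
  have C1: "\<phi> n C1_differentiable_on UNIV" for n
    unfolding C1_differentiable_on_def
    using dphi cD by (auto simp: has_real_derivative_iff_has_vector_derivative[symmetric])
  have id: "(LINT x:{0..1}|lebesgue. f x * D n x) = - (LINT x:{0..1}|lebesgue. g x * \<phi> n x)" for n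
  proof -
    have "\<forall>\<phi> a b. 0 < a \<longrightarrow> b < 1 \<longrightarrow> (\<forall>x. x \<notin> {a..b} \<longrightarrow> \<phi> x = 0) \<longrightarrow> \<phi> C1_differentiable_on UNIV \<longrightarrow>
      (LINT x:{0..1}|lebesgue. f x * deriv \<phi> x) = - (LINT x:{0..1}|lebesgue. g x * \<phi> x)"
      using H by (simp add: H1_weak_deriv_def)
    from this[rule_format, of "d n" "1 - d n" "\<phi> n"] C1 phi0 d(1)
    have "(LINT x:{0..1}|lebesgue. f x * deriv (\<phi> n) x) = - (LINT x:{0..1}|lebesgue. g x * \<phi> n x)" by simp
    then show ?thesis using DERIV_imp_deriv[OF dphi] by simp
  qed
  have ptw: "(\<lambda>n. indicator {0..1} x * (h x * cut n x)) \<longlonglongrightarrow> indicator {0..1} x * h x"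
    if "x \<noteq> 0" "x \<noteq> 1" for x and h :: "real \<Rightarrow> real"
  proof (cases "x \<in> {0..1}")
    case True
    then have "0 < min x (1 - x) / 2" using that by auto
    from order_tendstoD(2)[OF dlim this] have "\<forall>\<^sub>F n in sequentially. cut n x = 1"
      by eventually_elim (auto intro!: chi1)
    then have "\<forall>\<^sub>F n in sequentially. indicator {0..1} x * (h x * cut n x) = indicator {0..1} x * h x"
      by eventually_elim simp
    then show ?thesis by (rule tendsto_eventually)
  qed simp
  have ne: "AE x in lebesgue. x \<noteq> 0 \<and> x \<noteq> (1::real)"
    using AE_completion[OF AE_lborel_singleton[of "0::real"]] AE_completion[OF AE_lborel_singleton[of "1::real"]] by eventually_elim simp
  have L1: "(\<lambda>n. LINT x:{0..1}|lebesgue. g x * \<phi> n x) \<longlonglongrightarrow> (LINT x:{0..1}|lebesgue. g x * k x)"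
    unfolding set_lebesgue_integral_def real_scaleR_def
  proof (rule integral_dominated_convergence)
    have cphi: "continuous_on {0..1} (\<lambda>x. k x * cut n x)" for n by (intro continuous_intros ck cchi)
    have eq: "indicator {0..1} x * (g x * \<phi> n x) = indicator {0..1} x * (g x * (k x * cut n x))" for n x
      by (simp add: \<phi>_def indicator_def)
    have kchi: "\<bar>k x * cut n x\<bar> \<le> C" if "x \<in> {0..1}" for n x
      using mult_mono[OF C[OF that] chib[of n x]] order_trans[OF abs_ge_zero C[OF that]] by (simp add: abs_mult)
    show "(\<lambda>x. indicator {0..1} x * (g x * k x)) \<in> borel_measurable lebesgue"
      using borel_measurable_integrable[OF int_mult[OF contm[OF ck] C]] .
    show "(\<lambda>x. indicator {0..1} x * (g x * \<phi> n x)) \<in> borel_measurable lebesgue" for n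
      unfolding eq using borel_measurable_integrable[OF int_mult[OF contm[OF cphi] kchi]] .
    show "integrable lebesgue (\<lambda>x. \<bar>indicator {0..1} x * (g x * k x)\<bar>)"
      using int_mult[OF contm[OF ck] C] by (rule integrable_abs)
    show "AE x in lebesgue. (\<lambda>n. indicator {0..1} x * (g x * \<phi> n x)) \<longlonglongrightarrow> indicator {0..1} x * (g x * k x)"
      using ne
    proof eventually_elim
      case (elim x)
      then show ?case unfolding eq using ptw[of x "\<lambda>x. g x * k x"] by (simp add: mult.assoc)
    qed
    show "AE x in lebesgue. norm (indicator {0..1} x * (g x * \<phi> n x)) \<le> \<bar>indicator {0..1} x * (g x * k x)\<bar>" for n
    proof (intro AE_I2)
      fix x :: real
      have "\<bar>g x * k x\<bar> * \<bar>cut n x\<bar> \<le> \<bar>g x * k x\<bar> * 1" by (rule mult_left_mono[OF chib]) simp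
      then show "norm (indicator {0..1} x * (g x * \<phi> n x)) \<le> \<bar>indicator {0..1} x * (g x * k x)\<bar>"
        unfolding eq by (auto simp: abs_mult indicator_def mult.assoc)
    qed
  qed
  have L2: "(\<lambda>n. LINT x:{0..1}|lebesgue. f x * D n x) \<longlonglongrightarrow> ip f k' + (f 0 * k 0 - f 1 * k 1)"
  proof -
    have cfk': "continuous_on {0..1} (\<lambda>x. f x * k' x)" by (intro continuous_intros f k')
    have cfk: "continuous_on {0..1} (\<lambda>x. f x * k x)" by (intro continuous_intros f ck)
    have c3: "continuous_on {0..1} (\<lambda>x. (f x * k' x) * cut n x)" for n by (intro continuous_intros f k' cchi)
    have split: "(LINT x:{0..1}|lebesgue. f x * D n x) = (LINT x:{0..1}|lebesgue. (f x * k' x) * cut n x)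
      + (integral {0..1} (\<lambda>x. (f x * k x) * \<rho>1 n x) - integral {0..1} (\<lambda>x. (f x * k x) * \<rho>2 n x))" for n
    proof -
      have "(LINT x:{0..1}|lebesgue. f x * D n x) = integral {0..1} (\<lambda>x. f x * D n x)"
        by (intro LINT_continuous(2) continuous_intros f continuous_on_subset[OF cD]) simp
      also have "\<dots> = integral {0..1} (\<lambda>x. (f x * k' x) * cut n x + ((f x * k x) * \<rho>1 n x - (f x * k x) * \<rho>2 n x))"
        by (rule integral_cong) (simp add: D_def algebra_simps)
      also have "\<dots> = integral {0..1} (\<lambda>x. (f x * k' x) * cut n x) + integral {0..1} (\<lambda>x. (f x * k x) * \<rho>1 n x - (f x * k x) * \<rho>2 n x)"
        by (rule integral_add) (intro integrable_continuous_interval continuous_intros f k' ck cchi crho)+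
      also have "integral {0..1} (\<lambda>x. (f x * k x) * \<rho>1 n x - (f x * k x) * \<rho>2 n x)
          = integral {0..1} (\<lambda>x. (f x * k x) * \<rho>1 n x) - integral {0..1} (\<lambda>x. (f x * k x) * \<rho>2 n x)"
        by (rule integral_diff) (intro integrable_continuous_interval continuous_intros f ck crho)+
      finally show ?thesis by (simp add: LINT_continuous(2)[OF c3])
    qed
    have r2: "(\<lambda>n. 2 * d n) \<longlonglongrightarrow> 0" using tendsto_mult_right_zero[OF dlim] by simp
    have I1: "integral {0..1} (\<rho>1 n) = 1" for n
    proof -
      have "(\<rho>1 n has_integral s1 n 1 - s1 n 0) {0..1}"
        by (rule fundamental_theorem_of_calculus)
          (auto simp: has_real_derivative_iff_has_vector_derivative[symmetric] intro!: has_field_derivative_at_within[OF ds1])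
      then show ?thesis using s1v(1)[of 0 n] s1v(2)[of n 1] d[of n] by (auto dest: integral_unique)
    qed
    have I2: "integral {0..1} (\<rho>2 n) = 1" for n
    proof -
      have "((\<lambda>x. - \<rho>2 n x) has_integral s2 n 1 - s2 n 0) {0..1}"
        by (rule fundamental_theorem_of_calculus)
          (auto simp: has_real_derivative_iff_has_vector_derivative[symmetric] intro!: has_field_derivative_at_within[OF ds2])
      then have "integral {0..1} (\<lambda>x. - \<rho>2 n x) = - 1" using s2v(1)[of n 1] s2v(2)[of 0 n] d[of n] by (auto dest: integral_unique)
      then show ?thesis by simp
    qed
    have A1: "(\<lambda>n. integral {0..1} (\<lambda>x. (f x * k x) * \<rho>1 n x)) \<longlonglongrightarrow> f 0 * k 0"
      by (rule approximate_identity[OF cfk _ crho(1) rpos(1) I1 _ r2]) (auto intro!: rsupp)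
    have A2: "(\<lambda>n. integral {0..1} (\<lambda>x. (f x * k x) * \<rho>2 n x)) \<longlonglongrightarrow> f 1 * k 1"
      by (rule approximate_identity[OF cfk _ crho(2) rpos(2) I2 _ r2]) (auto intro!: rsupp2)
    have A3: "(\<lambda>n. LINT x:{0..1}|lebesgue. (f x * k' x) * cut n x) \<longlonglongrightarrow> (LINT x:{0..1}|lebesgue. f x * k' x)"
      unfolding set_lebesgue_integral_def real_scaleR_def
    proof (rule integral_dominated_convergence)
      show "(\<lambda>x. indicator {0..1} x * (f x * k' x)) \<in> borel_measurable lebesgue" by (rule contm[OF cfk'])
      show "(\<lambda>x. indicator {0..1} x * (f x * k' x * cut n x)) \<in> borel_measurable lebesgue" for n by (rule contm[OF c3])
      have "integrable lebesgue (\<lambda>x. indicator {0..1} x * (f x * k' x))"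
        using LINT_continuous(1)[OF cfk'] by (simp add: set_integrable_def)
      then show "integrable lebesgue (\<lambda>x. \<bar>indicator {0..1} x * (f x * k' x)\<bar>)" by (rule integrable_abs)
      show "AE x in lebesgue. (\<lambda>n. indicator {0..1} x * (f x * k' x * cut n x)) \<longlonglongrightarrow> indicator {0..1} x * (f x * k' x)"
        using ne
      proof eventually_elim
        case (elim x)
        then show ?case by (intro ptw) simp_all
      qed
      show "AE x in lebesgue. norm (indicator {0..1} x * (f x * k' x * cut n x)) \<le> \<bar>indicator {0..1} x * (f x * k' x)\<bar>" for n
      proof (intro AE_I2)
        fix x :: real
        have "\<bar>f x * k' x\<bar> * \<bar>cut n x\<bar> \<le> \<bar>f x * k' x\<bar> * 1" by (rule mult_left_mono[OF chib]) simp
        then show "norm (indicator {0..1} x * (f x * k' x * cut n x)) \<le> \<bar>indicator {0..1} x * (f x * k' x)\<bar>"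
          by (auto simp: abs_mult indicator_def)
      qed
    qed
    have "(LINT x:{0..1}|lebesgue. f x * k' x) = ip f k'"
      by (simp add: LINT_continuous(2)[OF cfk'] ip_def)
    then show ?thesis unfolding split using tendsto_add[OF A3 tendsto_diff[OF A1 A2]] by simp
  qed
  have "(\<lambda>n. - (LINT x:{0..1}|lebesgue. g x * \<phi> n x)) \<longlonglongrightarrow> - (LINT x:{0..1}|lebesgue. g x * k x)"
    by (rule tendsto_minus[OF L1])
  then have "(\<lambda>n. LINT x:{0..1}|lebesgue. f x * D n x) \<longlonglongrightarrow> - (LINT x:{0..1}|lebesgue. g x * k x)"
    by (simp only: id)
  from LIMSEQ_unique[OF this L2] show "(LINT x:{0..1}|lebesgue. g x * k x) = f 1 * k 1 - f 0 * k 0 - ip f k'" by simp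
qed

section \<open>Integrability in time of slices and traces\<close>

lemma LINT_AE_eq:
  fixes F G :: "real \<Rightarrow> real"
  assumes G: "set_integrable lebesgue S G" and ae: "AE x in lebesgue. x \<in> S \<longrightarrow> F x = G x"
  shows "set_integrable lebesgue S F" "(LINT x:S|lebesgue. F x) = (LINT x:S|lebesgue. G x)"
proof -
  obtain N where "{x \<in> space lebesgue. \<not> (x \<in> S \<longrightarrow> F x = G x)} \<subseteq> N" "N \<in> null_sets lebesgue"
    using AE_E[OF ae] by (metis null_setsI)
  then have N: "negligible N" "\<And>x. x \<in> S - N \<Longrightarrow> F x = G x"
    by (auto simp: negligible_iff_null_sets)
  show F: "set_integrable lebesgue S F" by (rule absolutely_integrable_spike[OF G N])
  show "(LINT x:S|lebesgue. F x) = (LINT x:S|lebesgue. G x)"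
    unfolding set_lebesgue_integral_eq_integral(2)[OF F] set_lebesgue_integral_eq_integral(2)[OF G]
    by (rule integral_spike[OF N(1)]) (simp add: N(2))
qed

lemma AE_lebesgue_neq: "AE x in lebesgue. x \<noteq> (a::real)"
  by (rule AE_completion[OF AE_lborel_singleton])

text \<open>Continuity gives measurability, the majorant gives integrability near 0, and the point 0
  is null. Functions built from the solution are known to be continuous for positive times
  only.\<close>

lemma set_integrable_open_start:
  fixes G N :: "real \<Rightarrow> real"
  assumes G: "continuous_on {0<..t} G" and N: "set_integrable lebesgue {0..t} N"
    and b: "AE s in lebesgue. s \<in> {0<..t} \<longrightarrow> \<bar>G s\<bar> \<le> N s"
  shows "set_integrable lebesgue {0..t} G"
proof -
  define G' where "G' s = indicator {0<..t} s * G s" for s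
  have "integrable lebesgue G'"
  proof (rule Bochner_Integration.integrable_bound)
    show "integrable lebesgue (\<lambda>s. indicator {0..t} s * N s)" using N by (simp add: set_integrable_def)
    have "(\<lambda>s. indicator {0<..t} s *\<^sub>R G s) \<in> borel_measurable borel"
      by (rule borel_measurable_continuous_on_indicator[OF _ G]) simp
    then show "G' \<in> borel_measurable lebesgue"
      unfolding G'_def by (intro measurable_completion) simp
    show "AE s in lebesgue. norm (G' s) \<le> norm (indicator {0..t} s * N s)"
      using b by eventually_elim (auto simp: G'_def indicator_def)
  qed
  then have "set_integrable lebesgue {0..t} G'"
    unfolding set_integrable_def by (rule Bochner_Integration.integrable_cong[THEN iffD1, rotated 2])
      (auto simp: G'_def indicator_def)
  moreover have "AE s in lebesgue. s \<in> {0..t} \<longrightarrow> G s = G' s"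
    using AE_lebesgue_neq[of 0] by eventually_elim (auto simp: G'_def)
  ultimately show ?thesis by (rule LINT_AE_eq(1))
qed

text \<open>By |r| \<le> 1 + r^2, a linear functional of f and its weak derivative is bounded by the
  squared H^1 norm, which is integrable in time along a generalized solution.\<close>

lemma slice_bound:
  assumes H: "H1_weak_deriv f g" and f: "continuous_on {0..1} f"
    and a: "continuous_on {0..1} a" "\<And>x. x \<in> {0..1} \<Longrightarrow> \<bar>a x\<bar> \<le> C"
    and gb: "set_integrable lebesgue {0..1} (\<lambda>x. g x * b x)" "\<And>x. x \<in> {0..1} \<Longrightarrow> \<bar>b x\<bar> \<le> C"
  shows "\<bar>ip f a + (LINT x:{0..1}|lebesgue. g x * b x)\<bar> \<le> C * (2 + (LINT x:{0..1}|lebesgue. (f x)\<^sup>2 + (g x)\<^sup>2))"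
proof -
  have f2: "set_integrable lebesgue {0..1} (\<lambda>x. (f x)\<^sup>2)" and g2: "set_integrable lebesgue {0..1} (\<lambda>x. (g x)\<^sup>2)"
    using H by (auto simp: H1_weak_deriv_def)
  have cfa: "continuous_on {0..1} (\<lambda>x. f x * a x)" by (intro continuous_intros f a)
  have c2: "set_integrable lebesgue {0..1} (\<lambda>x::real. 2::real)"
    by (rule LINT_continuous(1)[OF continuous_on_const])
  have fg: "set_integrable lebesgue {0..1} (\<lambda>x. (f x)\<^sup>2 + (g x)\<^sup>2)" by (rule set_integral_add(1)[OF f2 g2])
  have rhs: "set_integrable lebesgue {0..1} (\<lambda>x. C * (2 + ((f x)\<^sup>2 + (g x)\<^sup>2)))"
    by (intro set_integrable_mult_right set_integral_add(1) c2 fg)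
  have lhs: "set_integrable lebesgue {0..1} (\<lambda>x. f x * a x + g x * b x)"
    by (intro set_integral_add(1) LINT_continuous(1)[OF cfa] gb)
  have "ip f a + (LINT x:{0..1}|lebesgue. g x * b x) = (LINT x:{0..1}|lebesgue. f x * a x + g x * b x)"
    by (simp add: set_integral_add(2)[OF LINT_continuous(1)[OF cfa] gb(1)] LINT_continuous(2)[OF cfa] ip_def)
  also have "\<bar>\<dots>\<bar> \<le> (LINT x:{0..1}|lebesgue. \<bar>f x * a x + g x * b x\<bar>)"
    using set_integral_norm_bound[OF lhs] by simp
  also have "\<dots> \<le> (LINT x:{0..1}|lebesgue. C * (2 + ((f x)\<^sup>2 + (g x)\<^sup>2)))"
  proof (rule set_integral_mono[OF set_integrable_abs[OF lhs] rhs])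
    fix x :: real assume x: "x \<in> {0..1}"
    have "0 \<le> C" using a(2)[OF x] by simp
    have sq: "\<bar>r\<bar> \<le> 1 + r\<^sup>2" for r :: real
    proof -
      have "0 \<le> (\<bar>r\<bar> - 1)\<^sup>2 + (\<bar>r\<bar>)\<^sup>2 + 1" by (intro add_nonneg_nonneg) auto
      then show ?thesis by (simp add: power2_diff)
    qed
    have "\<bar>f x * a x\<bar> \<le> (1 + (f x)\<^sup>2) * C" "\<bar>g x * b x\<bar> \<le> (1 + (g x)\<^sup>2) * C"
      unfolding abs_mult using a(2)[OF x] gb(2)[OF x] sq by (auto intro!: mult_mono)
    then show "\<bar>f x * a x + g x * b x\<bar> \<le> C * (2 + ((f x)\<^sup>2 + (g x)\<^sup>2))"
      using abs_triangle_ineq[of "f x * a x" "g x * b x"] by (simp add: algebra_simps)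
  qed
  also have "\<dots> = C * (2 + (LINT x:{0..1}|lebesgue. (f x)\<^sup>2 + (g x)\<^sup>2))"
    using set_integral_add(2)[OF c2 fg] LINT_continuous(2)[OF continuous_on_const[of "{0..1}" "2::real"]]
    by simp
  finally show ?thesis .
qed

text \<open>Lebesgue measure on the plane is the completion of the product measure, so Fubini is
  applied to a Borel version, whose slices agree with the original ones for almost every
  time.\<close>

lemma L2_H1_slices:
  assumes L: "L2_H1 T u g"
  obtains N where "set_integrable lebesgue {0..T} N"
    "AE s in lebesgue. s \<in> {0..T} \<longrightarrow> H1_weak_deriv (u s) (g s) \<and>
      N s = (LINT x:{0..1}|lebesgue. (u s x)\<^sup>2 + (g s x)\<^sup>2)"
proof -
  define \<Phi> where "\<Phi> p = indicator ({0..T} \<times> {0..1}) p * ((u (fst p) (snd p))\<^sup>2 + (g (fst p) (snd p))\<^sup>2)" for p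
  have Phi: "integrable lebesgue \<Phi>"
    using L unfolding L2_H1_def set_integrable_def by (simp add: \<Phi>_def[abs_def] split_beta)
  have "\<Phi> \<in> borel_measurable (completion lborel)" using borel_measurable_integrable[OF Phi] .
  from completion_ex_borel_measurable_real[OF this] obtain \<Phi>' where
    P'm: "\<Phi>' \<in> borel_measurable lborel" and P': "AE p in lborel. \<Phi> p = \<Phi>' p" by blast
  have "integrable lebesgue \<Phi>'"
    by (rule integrable_cong_AE_imp[OF Phi measurable_completion[OF P'm] AE_completion[OF P']])
  then have "integrable lborel \<Phi>'" using integrable_completion[OF P'm] by simp
  then have int: "integrable (lborel \<Otimes>\<^sub>M lborel) \<Phi>'" by (simp add: lborel_prod)
  define N where "N s = (\<integral>x. \<Phi>' (s, x) \<partial>lborel)" for s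
  have "integrable lborel N" unfolding N_def[abs_def] by (rule lborel_pair.integrable_fst'[OF int])
  then have "integrable lebesgue N"
    using integrable_completion[of N lborel] by (simp add: borel_measurable_integrable)
  then have N: "set_integrable lebesgue {0..T} N"
    unfolding set_integrable_def by (intro integrable_mult_indicator) auto
  have ae1: "AE s in lebesgue. integrable lborel (\<lambda>x. \<Phi>' (s, x))"
    by (rule AE_completion[OF lborel_pair.AE_integrable_fst'[OF int]])
  have "AE p in lborel \<Otimes>\<^sub>M lborel. \<Phi> p = \<Phi>' p" unfolding lborel_prod by (rule P')
  from lborel_pair.AE_pair[OF this] have ae2: "AE s in lebesgue. AE x in lborel. \<Phi> (s, x) = \<Phi>' (s, x)"
    by (rule AE_completion)
  have ae3: "AE s in lebesgue. s \<in> {0..T} \<longrightarrow> H1_weak_deriv (u s) (g s)"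
    using L by (simp add: L2_H1_def AE_restrict_space_iff)
  show thesis
  proof (rule that[OF N])
    show "AE s in lebesgue. s \<in> {0..T} \<longrightarrow> H1_weak_deriv (u s) (g s) \<and>
      N s = (LINT x:{0..1}|lebesgue. (u s x)\<^sup>2 + (g s x)\<^sup>2)"
      using ae1 ae2 ae3
    proof eventually_elim
      case (elim s)
      show ?case
      proof (intro impI conjI)
        assume s: "s \<in> {0..T}"
        show H: "H1_weak_deriv (u s) (g s)" using elim(3) s by simp
        have sl: "\<Phi> (s, x) = indicator {0..1} x * ((u s x)\<^sup>2 + (g s x)\<^sup>2)" for x
          using s by (simp add: \<Phi>_def indicator_def)
        have m: "(\<lambda>x. \<Phi>' (s, x)) \<in> borel_measurable lborel" using elim(1) by (rule borel_measurable_integrable)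
        have "N s = (\<integral>x. \<Phi>' (s, x) \<partial>lebesgue)" unfolding N_def by (rule integral_completion[OF m, symmetric])
        also have "\<dots> = (\<integral>x. \<Phi> (s, x) \<partial>lebesgue)"
        proof (rule integral_cong_AE)
          show "(\<lambda>x. \<Phi>' (s, x)) \<in> borel_measurable lebesgue" by (rule measurable_completion[OF m])
          have "set_integrable lebesgue {0..1} (\<lambda>x. (u s x)\<^sup>2 + (g s x)\<^sup>2)"
            using H by (intro set_integral_add(1)) (simp_all add: H1_weak_deriv_def)
          then show "(\<lambda>x. \<Phi> (s, x)) \<in> borel_measurable lebesgue"
            unfolding sl set_integrable_def by (auto dest: borel_measurable_integrable)
          show "AE x in lebesgue. \<Phi>' (s, x) = \<Phi> (s, x)"
            using AE_completion[OF elim(2)] by eventually_elim simp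
        qed
        also have "\<dots> = (LINT x:{0..1}|lebesgue. (u s x)\<^sup>2 + (g s x)\<^sup>2)"
          unfolding sl set_lebesgue_integral_def by simp
        finally show "N s = (LINT x:{0..1}|lebesgue. (u s x)\<^sup>2 + (g s x)\<^sup>2)" .
      qed
    qed
  qed
qed

lemma grad_eq:
  assumes "(f has_real_derivative d) (at x within {0..1})" "x \<in> {0..1}"
  shows "grad f x = d"
proof -
  have "at x within {0..1} \<noteq> bot"
    using assms(2) by (auto simp: trivial_limit_within islimpt_Icc)
  then show ?thesis
    using assms(1) unfolding grad_def
    by (intro vector_derivative_within) (simp_all add: has_real_derivative_iff_has_vector_derivative)
qed

lemma deriv01_cong:
  assumes "\<And>y. y \<in> {0..1} \<Longrightarrow> f y = g y" "x \<in> {0..1}"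
  shows "(f has_vector_derivative d) (at x within {0..1}) \<longleftrightarrow> (g has_vector_derivative d) (at x within {0..1})"
  using assms by (intro has_vector_derivative_cong_ev) (auto simp: eventually_at_filter)

lemma grad_cong:
  assumes "\<And>y. y \<in> {0..1} \<Longrightarrow> f y = g y" "x \<in> {0..1}"
  shows "grad f x = grad g x"
  unfolding grad_def vector_derivative_def using deriv01_cong[OF assms] by simp

lemma scont_space: "continuous_on {0..1} f \<Longrightarrow> scont (\<lambda>_. f)"
  unfolding scont_def split_beta by (rule continuous_on_compose2[of "{0..1}" f]) (auto intro!: continuous_intros)

section \<open>From the weak formulation to the integrated equation\<close>

context robin
begin

text \<open>Integrate by parts twice, with f = - (K f)''. The affine function satisfies the
  inhomogeneous Robin conditions, the one at 1 by the choice of c, so only the boundary data remain,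
  in the form in which they occur in the weak identity.\<close>

lemma lin_ip:
  assumes f: "continuous_on {0..1} f" and c: "c * (1 + A + B) = \<beta> - \<alpha>"
  shows "ip (\<lambda>x. \<alpha> + c * (A + x)) f = \<beta> * K f 1 / B + \<alpha> * K f 0 / A"
proof -
  let ?u = "\<lambda>x. \<alpha> + c * (A + x)"
  have "((\<lambda>x. - (?u x * f x)) has_integral
      (?u 1 * K1 f 1 - c * K f 1) - (?u 0 * K1 f 0 - c * K f 0)) {0..1}"
  proof (rule fundamental_theorem_of_calculus)
    fix x :: real assume x: "x \<in> {0..1}"
    have 1: "(?u has_real_derivative c) (at x within {0..1})" by (auto intro!: derivative_eq_intros)
    show "((\<lambda>x. ?u x * K1 f x - c * K f x) has_vector_derivative - (?u x * f x)) (at x within {0..1})"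
      unfolding has_real_derivative_iff_has_vector_derivative[symmetric]
      by (rule DERIV_cong[OF DERIV_diff[OF DERIV_mult[OF 1 K1_deriv[OF f x]] DERIV_cmult[OF K_deriv[OF f x]]]])
        (simp add: algebra_simps)
  qed simp
  then have "integral {0..1} (\<lambda>x. - (?u x * f x))
      = (?u 1 * K1 f 1 - c * K f 1) - (?u 0 * K1 f 0 - c * K f 0)" by (rule integral_unique)
  then have "ip ?u f = (?u 0 * K1 f 0 - c * K f 0) - (?u 1 * K1 f 1 - c * K f 1)"
    unfolding ip_def by simp
  also have "?u 0 * K1 f 0 - c * K f 0 = \<alpha> * K f 0 / A"
    unfolding K_bdry using A_pos by (simp add: field_simps)
  also have "?u 1 * K1 f 1 - c * K f 1 = - ((\<alpha> + c * (1 + A + B)) * K f 1 / B)"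
    unfolding K_bdry using B_pos by (simp add: field_simps)
  finally show ?thesis by (simp add: c)
qed

lemma K_C12:
  assumes f: "continuous_on {0..1} f" and T: "0 < T"
  shows "C12 T (\<lambda>_. K f)" "\<And>t x. t \<in> {0..T} \<Longrightarrow> time_deriv {0..T} (\<lambda>_. K f) t x = 0"
    "\<And>x. x \<in> {0..1} \<Longrightarrow> grad (K f) x = K1 f x"
proof -
  show g: "grad (K f) x = K1 f x" if "x \<in> {0..1}" for x by (rule grad_eq[OF K_deriv[OF f that] that])
  have l: "lap (K f) x = - f x" if x: "x \<in> {0..1}" for x
    unfolding lap_def using grad_cong[OF g x] grad_eq[OF K1_deriv[OF f x] x] by simp
  show td: "time_deriv {0..T} (\<lambda>_. K f) t x = 0" if t: "t \<in> {0..T}" for t x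
  proof -
    have "at t within {0..T} \<noteq> bot" using t T by (auto simp: trivial_limit_within islimpt_Icc)
    then show ?thesis unfolding time_deriv_def by (intro vector_derivative_within) simp_all
  qed
  have cont: "continuous_on ({0..T} \<times> {0..1}) (\<lambda>(t, x). h x)" if "continuous_on {0..1} h" for h :: "real \<Rightarrow> real"
    unfolding split_beta by (rule continuous_on_compose2[OF that]) (auto intro!: continuous_intros)
  have eqc: "continuous_on ({0..T} \<times> {0..1}) (\<lambda>(t, x). h' t x)"
    if "continuous_on {0..1} h" "\<And>t x. t \<in> {0..T} \<Longrightarrow> x \<in> {0..1} \<Longrightarrow> h' t x = h x"
    for h :: "real \<Rightarrow> real" and h' :: "real \<Rightarrow> real \<Rightarrow> real"
    by (rule continuous_on_eq[OF cont[OF that(1)]]) (use that(2) in auto)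
  show "C12 T (\<lambda>_. K f)"
    unfolding C12_def
  proof (intro conjI ballI)
    fix t x :: real assume x: "x \<in> {0..1}"
    show "K f differentiable (at x within {0..1})"
      using K_deriv[OF f x] by (auto simp: real_differentiable_def)
    have "(grad (K f) has_real_derivative - f x) (at x within {0..1})"
      by (rule has_field_derivative_transform_within[OF K1_deriv[OF f x] zero_less_one x]) (simp add: g)
    then show "grad (K f) differentiable (at x within {0..1})" by (auto simp: real_differentiable_def)
  next
    show "continuous_on ({0..T} \<times> {0..1}) (\<lambda>(t, x). K f x)" by (rule cont[OF K_cont[OF f]])
    show "continuous_on ({0..T} \<times> {0..1}) (\<lambda>(t, x). time_deriv {0..T} (\<lambda>_. K f) t x)"
      by (rule eqc[OF continuous_on_const[of _ 0]]) (rule td)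
    show "continuous_on ({0..T} \<times> {0..1}) (\<lambda>(t, x). grad (K f) x)"
      by (rule eqc[OF K1_cont[OF f]]) (rule g)
    show "continuous_on ({0..T} \<times> {0..1}) (\<lambda>(t, x). lap (K f) x)"
      by (rule eqc[OF continuous_on_minus[OF f]]) (rule l)
  qed simp_all
qed

text \<open>For the time-independent test function \<open>K f\<close> the term with \<partial>_t H
  vanishes, and the gradient term becomes \<open>ip (u s) f\<close> plus traces of u, which cancel
  against the Robin terms by \<open>K_bdry\<close> up to the data computed in \<open>lin_ip\<close>.
  The delicate point is that each piece must be integrable in time near 0 before the pieces are
  combined.\<close>

lemma weak_identity:
  fixes \<alpha> \<beta> c :: real
  assumes c: "c * (1 + A + B) = \<beta> - \<alpha>"
    and phi: "continuous_on {0..1} \<phi>" and H: "heat_solution \<alpha> \<beta> A B \<phi> u"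
    and f: "continuous_on {0..1} f" and t: "0 < t"
  defines "w \<equiv> \<lambda>t x. u t x - (\<alpha> + c * (A + x))"
  shows "(\<lambda>s. ip (w s) f) integrable_on {0..t}"
    "ip (w t) (K f) - ip (\<lambda>x. \<phi> x - (\<alpha> + c * (A + x))) (K f) = - integral {0..t} (\<lambda>s. ip (w s) f)"
proof -
  obtain g where L: "L2_H1 t u g" and W: "weak_heat_identity \<alpha> \<beta> A B \<phi> u g"
    using H t by (auto simp: heat_solution_def)
  have su: "scont u" and u0: "\<And>x. x \<in> {0..1} \<Longrightarrow> u 0 x = \<phi> x"
    using H by (auto simp: heat_solution_def scont_def)
  have cu: "continuous_on {0..1} (u s)" if "0 \<le> s" for s
  proof (cases "s = 0")
    case True
    then show ?thesis using continuous_on_eq[OF phi, of "u 0"] u0 by simp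
  qed (use that in \<open>auto intro!: scont_slice su\<close>)
  obtain N where N: "set_integrable lebesgue {0..t} N"
    and NN: "AE s in lebesgue. s \<in> {0..t} \<longrightarrow> H1_weak_deriv (u s) (g s) \<and>
      N s = (LINT x:{0..1}|lebesgue. (u s x)\<^sup>2 + (g s x)\<^sup>2)"
    by (rule L2_H1_slices[OF L])
  obtain C0 where C0: "\<And>x. x \<in> {0..1} \<Longrightarrow> \<bar>f x\<bar> \<le> C0"
    using compact_imp_bounded[OF compact_continuous_image[OF f compact_Icc]]
    unfolding bounded_iff real_norm_def by blast
  \<comment> \<open>One bound for f and for the weights 1, x and x - 1 used for the traces.\<close>
  define C where "C = max 1 C0"
  have C: "1 \<le> C" "\<And>x. x \<in> {0..1} \<Longrightarrow> \<bar>f x\<bar> \<le> C" using C0 by (auto simp: C_def intro: le_max_iff_disj[THEN iffD2])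
  have CN: "set_integrable lebesgue {0..t} (\<lambda>s. C * (2 + N s))"
    by (intro set_integrable_mult_right set_integral_add(1) N LINT_continuous(1)[OF continuous_on_const])
  have time: "continuous_on {0<..t} (\<lambda>s. u s x)" if "x \<in> {0..1}" for x
    by (rule continuous_on_subset[OF scont_time[OF su that]]) auto
  have c1: "continuous_on {0..1} (\<lambda>x::real. 1::real)" by (rule continuous_on_const)
  have d1: "((\<lambda>x. x - 1) has_real_derivative 1) (at x within {0..1})" "((\<lambda>x. x) has_real_derivative 1) (at x within {0..1})" for x :: real
    by (auto intro!: derivative_eq_intros)
  have ib: "set_integrable lebesgue {0..t} h"
    if ch: "continuous_on {0<..t} h"
      and b: "\<And>s. H1_weak_deriv (u s) (g s) \<Longrightarrow> continuous_on {0..1} (u s) \<Longrightarrow>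
        \<bar>h s\<bar> \<le> C * (2 + (LINT x:{0..1}|lebesgue. (u s x)\<^sup>2 + (g s x)\<^sup>2))" for h
  proof (rule set_integrable_open_start[OF ch CN])
    show "AE s in lebesgue. s \<in> {0<..t} \<longrightarrow> \<bar>h s\<bar> \<le> C * (2 + N s)"
      using NN
    proof eventually_elim
      case (elim s)
      then show ?case using b[of s] cu[of s] by auto
    qed
  qed
  have i0: "set_integrable lebesgue {0..t} (\<lambda>s. u s 0)"
  proof (rule ib[OF time])
    fix s assume Hs: "H1_weak_deriv (u s) (g s)" and cs: "continuous_on {0..1} (u s)"
    note ibp = weak_deriv_by_parts[OF Hs cs d1(1) c1]
    \<comment> \<open>The weight x - 1 vanishes at 1 and isolates the trace at 0; the weight x does
      the opposite below.\<close>
    have "u s 0 = ip (u s) (\<lambda>x. 1) + (LINT x:{0..1}|lebesgue. g s x * (x - 1))" unfolding ibp(2) by simp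
    then show "\<bar>u s 0\<bar> \<le> C * (2 + (LINT x:{0..1}|lebesgue. (u s x)\<^sup>2 + (g s x)\<^sup>2))"
      using slice_bound[OF Hs cs c1 _ ibp(1), of C] C(1) by simp
  qed simp
  have i1: "set_integrable lebesgue {0..t} (\<lambda>s. u s 1)"
  proof (rule ib[OF time])
    fix s assume Hs: "H1_weak_deriv (u s) (g s)" and cs: "continuous_on {0..1} (u s)"
    note ibp = weak_deriv_by_parts[OF Hs cs d1(2) c1]
    have "u s 1 = ip (u s) (\<lambda>x. 1) + (LINT x:{0..1}|lebesgue. g s x * x)" unfolding ibp(2) by simp
    then show "\<bar>u s 1\<bar> \<le> C * (2 + (LINT x:{0..1}|lebesgue. (u s x)\<^sup>2 + (g s x)\<^sup>2))"
      using slice_bound[OF Hs cs c1 _ ibp(1), of C] C(1) by simp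
  qed simp
  have if0: "set_integrable lebesgue {0..t} (\<lambda>s. ip (u s) f)"
  proof (rule ib)
    show "continuous_on {0<..t} (\<lambda>s. ip (u s) f)"
      by (rule continuous_on_subset[OF ip_time_cont[OF su scont_space[OF f]]]) auto
    fix s assume Hs: "H1_weak_deriv (u s) (g s)" and cs: "continuous_on {0..1} (u s)"
    have "set_integrable lebesgue {0..1} (\<lambda>x. g s x * 0)" by (simp add: set_integrable_def)
    from slice_bound[OF Hs cs f C(2) this] C(1)
    show "\<bar>ip (u s) f\<bar> \<le> C * (2 + (LINT x:{0..1}|lebesgue. (u s x)\<^sup>2 + (g s x)\<^sup>2))" by simp
  qed
  define G where "G s = u s 1 * K1 f 1 - u s 0 * K1 f 0 + ip (u s) f" for s
  define bd where "bd s = (1 / B) * (u s 1 - \<beta>) * K f 1 + (1 / A) * (u s 0 - \<alpha>) * K f 0" for s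
  have iG: "set_integrable lebesgue {0..t} G"
    unfolding G_def by (intro set_integral_add(1) set_integral_diff(1) set_integrable_mult_left i0 i1 if0)
  have ic: "set_integrable lebesgue {0..t} (\<lambda>_. k)" for k :: real by (rule LINT_continuous(1)[OF continuous_on_const])
  have ibd: "set_integrable lebesgue {0..t} bd"
    unfolding bd_def
    by (intro set_integral_add(1) set_integrable_mult_left set_integrable_mult_right set_integral_diff(1) i0 i1 ic)
  have cw: "continuous_on {0..1} (\<lambda>x. \<alpha> + c * (A + x))" by (intro continuous_intros)
  \<comment> \<open>The traces cancel for each s separately.\<close>
  have Gbd: "G s + bd s = ip (w s) f" if "0 \<le> s" for s
  proof -
    have "ip (w s) f = ip (u s) f - (\<beta> * K f 1 / B + \<alpha> * K f 0 / A)"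
      unfolding w_def ip_diff[OF cu[OF that] cw f] lin_ip[OF f c] ..
    then show ?thesis unfolding G_def bd_def K_bdry by (simp add: algebra_simps diff_divide_distrib)
  qed
  have isum: "set_integrable lebesgue {0..t} (\<lambda>s. G s + bd s)" by (rule set_integral_add(1)[OF iG ibd])
  show "(\<lambda>s. ip (w s) f) integrable_on {0..t}"
    using set_lebesgue_integral_eq_integral(1)[OF isum] by (rule integrable_eq) (simp add: Gbd)
  have inner: "AE s in lebesgue. s \<in> {0..t} \<longrightarrow> (LINT x:{0..1}|lebesgue. g s x * grad (K f) x) = G s"
    using NN
  proof eventually_elim
    case (elim s)
    show ?case
    proof
      assume s: "s \<in> {0..t}"
      have "(LINT x:{0..1}|lebesgue. g s x * grad (K f) x) = (LINT x:{0..1}|lebesgue. g s x * K1 f x)"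
        by (rule set_lebesgue_integral_cong) (simp_all add: K_C12(3)[OF f t])
      also have "\<dots> = u s 1 * K1 f 1 - u s 0 * K1 f 0 - ip (u s) (\<lambda>x. - f x)"
        by (rule weak_deriv_by_parts(2)[OF _ _ K1_deriv[OF f] continuous_on_minus[OF f]])
          (use elim s cu in auto)
      finally show "(LINT x:{0..1}|lebesgue. g s x * grad (K f) x) = G s" by (simp add: G_def)
    qed
  qed
  have "(LINT x:{0..1}|lebesgue. u t x * K f x) - (LINT x:{0..1}|lebesgue. \<phi> x * K f x)
      - (LINT s:{0..t}|lebesgue. (LINT x:{0..1}|lebesgue. u s x * time_deriv {0..t} (\<lambda>_. K f) s x))
      = - (LINT s:{0..t}|lebesgue. (LINT x:{0..1}|lebesgue. g s x * grad (K f) x)) - (LINT s:{0..t}|lebesgue. bd s)"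
    using W[unfolded weak_heat_identity_def, rule_format, OF t order_refl K_C12(1)[OF f t]]
    by (simp only: bd_def)
  also have "(LINT s:{0..t}|lebesgue. (LINT x:{0..1}|lebesgue. g s x * grad (K f) x)) = (LINT s:{0..t}|lebesgue. G s)"
    by (rule LINT_AE_eq(2)[OF iG inner])
  also have "(LINT s:{0..t}|lebesgue. (LINT x:{0..1}|lebesgue. u s x * time_deriv {0..t} (\<lambda>_. K f) s x))
      = (LINT s:{0..t}|lebesgue. 0)"
    by (rule set_lebesgue_integral_cong) (simp_all add: K_C12(2)[OF f t])
  also have "(LINT x:{0..1}|lebesgue. u t x * K f x) = ip (u t) (K f)"
    unfolding ip_def using t by (intro LINT_continuous(2) continuous_intros cu K_cont f) simp
  also have "(LINT x:{0..1}|lebesgue. \<phi> x * K f x) = ip \<phi> (K f)"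
    unfolding ip_def by (intro LINT_continuous(2) continuous_intros phi K_cont f)
  finally have "ip (u t) (K f) - ip \<phi> (K f) = - ((LINT s:{0..t}|lebesgue. G s) + (LINT s:{0..t}|lebesgue. bd s))"
    by simp
  also have "(LINT s:{0..t}|lebesgue. G s) + (LINT s:{0..t}|lebesgue. bd s) = integral {0..t} (\<lambda>s. G s + bd s)"
    using set_integral_add(2)[OF iG ibd] set_lebesgue_integral_eq_integral(2)[OF isum] by simp
  also have "\<dots> = integral {0..t} (\<lambda>s. ip (w s) f)" by (rule integral_cong) (simp add: Gbd)
  finally show "ip (w t) (K f) - ip (\<lambda>x. \<phi> x - (\<alpha> + c * (A + x))) (K f) = - integral {0..t} (\<lambda>s. ip (w s) f)"
    unfolding w_def using t by (simp add: ip_diff[OF _ cw K_cont[OF f]] cu phi)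
qed

text \<open>The tested identity between times a and b, applied to the defect h = K w(b) - K w(a) +
  (integral of w over [a, b]) itself, shows that h is orthogonal to itself. So K w is an
  antiderivative in time of the continuous function - w.\<close>

lemma weak_imp_sol:
  fixes \<alpha> \<beta> c :: real
  assumes c: "c * (1 + A + B) = \<beta> - \<alpha>"
    and phi: "continuous_on {0..1} \<phi>" and H: "heat_solution \<alpha> \<beta> A B \<phi> u"
  defines "w \<equiv> \<lambda>t x. u t x - (\<alpha> + c * (A + x))" and "\<psi> \<equiv> \<lambda>x. \<phi> x - (\<alpha> + c * (A + x))"
  shows "sol w" "continuous_on {0..1} f \<Longrightarrow> ((\<lambda>t. ip (w t) (K f)) \<longlongrightarrow> ip \<psi> (K f)) (at_right 0)"
proof -
  have wi: "(\<lambda>s. ip (w s) f) integrable_on {0..t}"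
    "ip (w t) (K f) - ip \<psi> (K f) = - integral {0..t} (\<lambda>s. ip (w s) f)"
    if "continuous_on {0..1} f" "0 < t" for f t
    using weak_identity[OF c phi H that] by (simp_all add: w_def \<psi>_def)
  have "scont u" using H by (auto simp: heat_solution_def scont_def)
  then have sw: "scont w" unfolding w_def by (intro scont_diff scont_space continuous_intros)
  show "((\<lambda>t. ip (w t) (K f)) \<longlongrightarrow> ip \<psi> (K f)) (at_right 0)" if f: "continuous_on {0..1} f"
  proof -
    have "continuous_on {0..1} (\<lambda>t. integral {0..t} (\<lambda>s. ip (w s) f))"
      by (rule indefinite_integral_continuous_1[OF wi(1)[OF f zero_less_one]])
    then have "((\<lambda>t. integral {0..t} (\<lambda>s. ip (w s) f)) \<longlongrightarrow> integral {0..0} (\<lambda>s. ip (w s) f)) (at 0 within {0..1})"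
      unfolding continuous_on_def by (rule bspec) simp
    then have "((\<lambda>t. integral {0..t} (\<lambda>s. ip (w s) f)) \<longlongrightarrow> 0) (at_right 0)"
      by (simp add: at_within_Icc_at_right)
    then have "((\<lambda>t. ip \<psi> (K f) - integral {0..t} (\<lambda>s. ip (w s) f)) \<longlongrightarrow> ip \<psi> (K f) - 0) (at_right 0)"
      by (intro tendsto_diff tendsto_const)
    moreover have "\<forall>\<^sub>F t in at_right 0. ip \<psi> (K f) - integral {0..t} (\<lambda>s. ip (w s) f) = ip (w t) (K f)"
      using eventually_at_right_less by eventually_elim (use wi(2)[OF f] in force)
    ultimately show ?thesis by (simp add: tendsto_cong)
  qed
  define V where "V a b x = integral {a..b} (\<lambda>s. w s x)" for a b x
  have key: "K (w b) x - K (w a) x = - V a b x" if a: "0 < a" "a \<le> b" and x: "x \<in> {0..1}" for a b x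
  proof -
    have b: "0 < b" using a by simp
    have cW: "continuous_on (cbox (a, 0) (b, 1)) (\<lambda>(s, x). w s x)"
      by (rule continuous_on_subset[OF sw[unfolded scont_def]]) (use a in \<open>auto simp: cbox_Pair_eq\<close>)
    have cW': "continuous_on ({0..1} \<times> cbox a b) (\<lambda>(x, s). w s x)"
      unfolding split_beta by (rule scont_comp[OF sw]) (use a in \<open>auto intro!: continuous_intros\<close>)
    have cV: "continuous_on {0..1} (V a b)"
      using integral_continuous_on_param[OF cW'] by (simp add: V_def[abs_def])
    define h where "h x = K (w b) x - K (w a) x + V a b x" for x
    note cs = scont_slice[OF sw a(1)] scont_slice[OF sw b]
    have ch: "continuous_on {0..1} h" unfolding h_def by (intro continuous_intros K_cont cs cV)
    have "ip h h = 0"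
    proof -
      have "ip h h = ip (\<lambda>x. K (w b) x - K (w a) x) h + ip (V a b) h"
        unfolding h_def[abs_def, of ] by (rule ip_add[OF _ cV]) (use ch in \<open>auto intro!: continuous_intros K_cont cs simp: h_def\<close>)
      also have "ip (\<lambda>x. K (w b) x - K (w a) x) h = ip (w b) (K h) - ip (w a) (K h)"
        by (simp add: ip_diff[OF K_cont[OF cs(2)] K_cont[OF cs(1)] ch] K_sym[OF cs(1) ch] K_sym[OF cs(2) ch])
      also have "\<dots> = integral {0..a} (\<lambda>s. ip (w s) h) - integral {0..b} (\<lambda>s. ip (w s) h)"
        using wi(2)[OF ch a(1)] wi(2)[OF ch b] by linarith
      also have "\<dots> = - integral {a..b} (\<lambda>s. ip (w s) h)"
        using Henstock_Kurzweil_Integration.integral_combine[OF _ a(2) wi(1)[OF ch b]] a(1) by simp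
      also have "integral {a..b} (\<lambda>s. ip (w s) h) = ip (V a b) h"
      proof -
        have "continuous_on (cbox (a, 0) (b, 1)) (\<lambda>p. w (fst p) (snd p) * h (snd p))"
          using cW by (intro continuous_on_mult continuous_on_compose2[OF ch])
            (auto simp: split_beta cbox_Pair_eq intro!: continuous_intros)
        then have "continuous_on (cbox (a, 0) (b, 1)) (\<lambda>(s, x). w s x * h x)" by (simp add: split_beta)
        from integral_swap_continuous[OF this] show ?thesis
          unfolding ip_def V_def by simp
      qed
      finally show ?thesis by simp
    qed
    from ip_eq_0D[OF ch this x] show ?thesis by (simp add: h_def)
  qed
  have "tder (\<lambda>t. K (w t)) (\<lambda>t x. - w t x)"
    unfolding tder_def
  proof (intro allI impI ballI)
    fix t x :: real assume t: "0 < t" and x: "x \<in> {0..1}"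
    let ?a = "t / 2" and ?b = "2 * t"
    have "continuous_on {?a..?b} (\<lambda>s. w s x)"
      by (rule continuous_on_subset[OF scont_time[OF sw x]]) (use t in auto)
    then have "((\<lambda>r. V ?a r x) has_real_derivative w t x) (at t within {?a..?b})"
      unfolding V_def has_real_derivative_iff_has_vector_derivative
      by (rule integral_has_vector_derivative) (use t in auto)
    then have "((\<lambda>r. V ?a r x) has_real_derivative w t x) (at t)"
      using t by (simp add: at_within_Icc_at)
    then have "((\<lambda>r. K (w ?a) x - V ?a r x) has_real_derivative 0 - w t x) (at t)"
      by (intro DERIV_diff DERIV_const)
    then have "((\<lambda>r. K (w r) x) has_real_derivative 0 - w t x) (at t)"
    proof (rule has_field_derivative_transform_within_open)
      show "open {?a<..}" "t \<in> {?a<..}" using t by auto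
      fix r assume "r \<in> {?a<..}"
      then show "K (w ?a) x - V ?a r x = K (w r) x" using key[of ?a r x] t x by simp
    qed
    then show "((\<lambda>r. K (w r) x) has_real_derivative - w t x) (at t)" by simp
  qed
  with sw show "sol w" by (simp add: sol_def)
qed

end

section \<open>Smoothness and algebra of the transformation\<close>

definition sder :: "(real \<Rightarrow> real \<Rightarrow> real) \<Rightarrow> (real \<Rightarrow> real \<Rightarrow> real) \<Rightarrow> bool"
  where "sder w w' \<longleftrightarrow> (\<forall>t>0. \<forall>x\<in>{0..1}. (w t has_real_derivative w' t x) (at x within {0..1}))"

lemma sderD: "sder w w' \<Longrightarrow> 0 < t \<Longrightarrow> x \<in> {0..1} \<Longrightarrow> (w t has_real_derivative w' t x) (at x within {0..1})"
  by (simp add: sder_def)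

lemma at_within_pos: "0 < (t::real) \<Longrightarrow> at t within {0<..} = at t"
  by (simp add: at_within_open[OF _ open_greaterThan])

lemma time_deriv_eq:
  assumes "((\<lambda>s. w s x) has_real_derivative d) (at t)" "0 < t"
  shows "time_deriv {0<..} w t x = d"
  unfolding time_deriv_def at_within_pos[OF assms(2)] using assms(1)
  by (intro vector_derivative_at) (simp add: has_real_derivative_iff_has_vector_derivative)

lemma tder_time_deriv: "tder w w' \<Longrightarrow> 0 < t \<Longrightarrow> x \<in> {0..1} \<Longrightarrow> time_deriv {0<..} w t x = w' t x"
  by (rule time_deriv_eq[where w = w]) (rule tderD)

lemma sder_grad: "sder w w' \<Longrightarrow> 0 < t \<Longrightarrow> x \<in> {0..1} \<Longrightarrow> grad (w t) x = w' t x"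
  by (rule grad_eq) (rule sderD)

lemma sder_cong:
  assumes "sder a a'" "\<And>t x. 0 < t \<Longrightarrow> x \<in> {0..1} \<Longrightarrow> a t x = b t x" "\<And>t x. 0 < t \<Longrightarrow> x \<in> {0..1} \<Longrightarrow> a' t x = b' t x"
  shows "sder b b'"
  unfolding sder_def
proof (intro allI impI ballI)
  fix t x :: real assume t: "0 < t" and x: "x \<in> {0..1}"
  show "(b t has_real_derivative b' t x) (at x within {0..1})"
    unfolding assms(3)[OF t x, symmetric]
    by (rule has_field_derivative_transform_within[OF sderD[OF assms(1) t x] zero_less_one x]) (simp add: assms(2)[OF t])
qed

text \<open>\<open>time_deriv\<close> and \<open>grad\<close> at points of the strip depend only on
  values in the strip, so representatives can be exchanged at every order.\<close>

lemma Ck_cong: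
  "(\<And>t x. 0 < t \<Longrightarrow> x \<in> {0..1} \<Longrightarrow> a t x = b t x) \<Longrightarrow> Ck_on_strip k a \<Longrightarrow> Ck_on_strip k b"
proof (induction k arbitrary: a b)
  case 0
  then show ?case using scont_cong[of a b] by (simp add: scont_def)
next
  case (Suc k)
  note eq = Suc.prems(1)
  have c: "scont b" using scont_cong[of a b] Suc.prems by (simp add: scont_def)
  have A: "(\<lambda>s. b s x) differentiable (at t within {0<..})" "b t differentiable (at x within {0..1})"
    "time_deriv {0<..} a t x = time_deriv {0<..} b t x" "grad (a t) x = grad (b t) x"
    if t: "0 < t" and x: "x \<in> {0..1}" for t x
  proof -
    have ev: "((\<lambda>s. a s x) has_vector_derivative d) (at t within {0<..}) \<longleftrightarrow> ((\<lambda>s. b s x) has_vector_derivative d) (at t within {0<..})" for d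
      using t x by (intro has_vector_derivative_cong_ev) (auto simp: eventually_at_filter eq)
    then show "time_deriv {0<..} a t x = time_deriv {0<..} b t x"
      by (simp add: time_deriv_def vector_derivative_def)
    show "grad (a t) x = grad (b t) x" using t x by (intro grad_cong) (auto simp: eq)
    have "(\<lambda>s. a s x) differentiable (at t within {0<..})" "a t differentiable (at x within {0..1})"
      using Suc.prems(2) t x by auto
    then obtain d e where "((\<lambda>s. a s x) has_vector_derivative d) (at t within {0<..})"
      "(a t has_vector_derivative e) (at x within {0..1})"
      unfolding vector_derivative_works by blast
    then have "((\<lambda>s. b s x) has_vector_derivative d) (at t within {0<..})"
      "(b t has_vector_derivative e) (at x within {0..1})"
      using ev deriv01_cong[of "a t" "b t" x e] eq[OF t] x by simp_all
    then show "(\<lambda>s. b s x) differentiable (at t within {0<..})" "b t differentiable (at x within {0..1})"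
      by (auto intro: differentiableI_vector)
  qed
  have "Ck_on_strip k (time_deriv {0<..} b)"
    by (rule Suc.IH[of "time_deriv {0<..} a"]) (use A Suc.prems(2) in auto)
  moreover have "Ck_on_strip k (\<lambda>t. grad (b t))"
    by (rule Suc.IH[of "\<lambda>t. grad (a t)"]) (use A Suc.prems(2) in auto)
  ultimately show ?case using c A(1,2) by (simp add: scont_def)
qed

text \<open>Together with \<open>Ck_SucE\<close> this replaces the derivative operators by explicit
  derivative functions, so that the rules of calculus fit an induction on k.\<close>

lemma Ck_SucI:
  assumes "scont w" "tder w wt" "sder w wx" "Ck_on_strip k wt" "Ck_on_strip k wx"
  shows "Ck_on_strip (Suc k) w"
proof -
  have "Ck_on_strip k (time_deriv {0<..} w)"
    by (rule Ck_cong[OF _ assms(4)]) (simp add: tder_time_deriv[OF assms(2)])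
  moreover have "Ck_on_strip k (\<lambda>t. grad (w t))"
    by (rule Ck_cong[OF _ assms(5)]) (simp add: sder_grad[OF assms(3)])
  moreover have "(\<lambda>s. w s x) differentiable (at t within {0<..}) \<and> w t differentiable (at x within {0..1})"
    if "0 < t" "x \<in> {0..1}" for t x
    using tderD[OF assms(2) that] sderD[OF assms(3) that] at_within_pos[OF that(1)]
    by (auto simp: real_differentiable_def)
  ultimately show ?thesis using assms(1) by (simp add: scont_def)
qed

lemma Ck_SucE:
  assumes "Ck_on_strip (Suc k) w"
  obtains wt wx where "scont w" "tder w wt" "sder w wx" "Ck_on_strip k wt" "Ck_on_strip k wx"
proof (rule that)
  show "scont w" "Ck_on_strip k (time_deriv {0<..} w)" "Ck_on_strip k (\<lambda>t. grad (w t))"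
    using assms by (simp_all add: scont_def)
  have d: "(\<lambda>s. w s x) differentiable (at t within {0<..})" "w t differentiable (at x within {0..1})"
    if "0 < t" "x \<in> {0..1}" for t x using assms that by auto
  show "tder w (time_deriv {0<..} w)"
    unfolding tder_def time_deriv_def has_real_derivative_iff_has_vector_derivative
  proof (intro allI impI ballI)
    fix t x :: real assume t: "0 < t" and x: "x \<in> {0..1}"
    from d(1)[OF this] have "((\<lambda>s. w s x) has_vector_derivative vector_derivative (\<lambda>s. w s x) (at t within {0<..})) (at t within {0<..})"
      by (simp add: vector_derivative_works)
    then show "((\<lambda>s. w s x) has_vector_derivative vector_derivative (\<lambda>s. w s x) (at t within {0<..})) (at t)"
      by (simp add: at_within_pos[OF t])
  qed
  show "sder w (\<lambda>t. grad (w t))"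
    unfolding sder_def grad_def has_real_derivative_iff_has_vector_derivative
    using d(2) by (simp add: vector_derivative_works)
qed

text \<open>The product rule leaves undifferentiated factors, which must count as C^k when given as
  C^(k+1).\<close>

lemma Ck_pred: "Ck_on_strip (Suc k) w \<Longrightarrow> Ck_on_strip k w"
proof (induction k arbitrary: w)
  case 0
  then show ?case by simp
next
  case (Suc k)
  obtain wt wx where w: "scont w" "tder w wt" "sder w wx" "Ck_on_strip (Suc k) wt" "Ck_on_strip (Suc k) wx"
    using Suc.prems by (rule Ck_SucE)
  show ?case by (rule Ck_SucI[OF w(1-3) Suc.IH[OF w(4)] Suc.IH[OF w(5)]])
qed

lemma Ck_const: "Ck_on_strip k (\<lambda>t x. c)"
proof (induction k arbitrary: c)
  case (Suc k)
  show ?case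
    by (rule Ck_SucI[of _ "\<lambda>_ _. 0" "\<lambda>_ _. 0"]) (auto simp: scont_const tder_def sder_def Suc)
qed (simp add: split_beta)

lemma Ck_linear: "Ck_on_strip k (\<lambda>t x. a + c * x)"
proof (cases k)
  case (Suc l)
  have "sder (\<lambda>t x. a + c * x) (\<lambda>_ _. c)" by (auto simp: sder_def intro!: derivative_eq_intros)
  moreover have "scont (\<lambda>t x. a + c * x)" by (intro scont_space continuous_intros)
  ultimately show ?thesis unfolding Suc
    by (intro Ck_SucI[of _ "\<lambda>_ _. 0" "\<lambda>_ _. c"] Ck_const) (auto simp: tder_def)
qed (auto simp: split_beta intro!: continuous_intros)

lemma tder_add: "tder a a' \<Longrightarrow> tder b b' \<Longrightarrow> tder (\<lambda>t x. a t x + b t x) (\<lambda>t x. a' t x + b' t x)"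
  and tder_mult: "tder a a' \<Longrightarrow> tder b b' \<Longrightarrow> tder (\<lambda>t x. a t x * b t x) (\<lambda>t x. a' t x * b t x + a t x * b' t x)"
  and tder_inverse: "tder a a' \<Longrightarrow> (\<And>t x. 0 < t \<Longrightarrow> x \<in> {0..1} \<Longrightarrow> a t x \<noteq> 0) \<Longrightarrow>
    tder (\<lambda>t x. inverse (a t x)) (\<lambda>t x. - a' t x * (inverse (a t x) * inverse (a t x)))"
  unfolding tder_def by (auto intro!: derivative_eq_intros simp: algebra_simps power2_eq_square)

lemma sder_add: "sder a a' \<Longrightarrow> sder b b' \<Longrightarrow> sder (\<lambda>t x. a t x + b t x) (\<lambda>t x. a' t x + b' t x)"
  and sder_mult: "sder a a' \<Longrightarrow> sder b b' \<Longrightarrow> sder (\<lambda>t x. a t x * b t x) (\<lambda>t x. a' t x * b t x + a t x * b' t x)"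
  and sder_inverse: "sder a a' \<Longrightarrow> (\<And>t x. 0 < t \<Longrightarrow> x \<in> {0..1} \<Longrightarrow> a t x \<noteq> 0) \<Longrightarrow>
    sder (\<lambda>t x. inverse (a t x)) (\<lambda>t x. - a' t x * (inverse (a t x) * inverse (a t x)))"
  unfolding sder_def by (auto intro!: derivative_eq_intros simp: algebra_simps power2_eq_square)

lemma Ck_add: "Ck_on_strip k a \<Longrightarrow> Ck_on_strip k b \<Longrightarrow> Ck_on_strip k (\<lambda>t x. a t x + b t x)"
proof (induction k arbitrary: a b)
  case 0
  then show ?case using scont_add[of a b] by (simp add: scont_def)
next
  case (Suc k)
  obtain at' ax where a: "scont a" "tder a at'" "sder a ax" "Ck_on_strip k at'" "Ck_on_strip k ax"
    using Suc.prems(1) by (rule Ck_SucE)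
  obtain bt bx where b: "scont b" "tder b bt" "sder b bx" "Ck_on_strip k bt" "Ck_on_strip k bx"
    using Suc.prems(2) by (rule Ck_SucE)
  show ?case
    by (rule Ck_SucI[OF scont_add[OF a(1) b(1)] tder_add[OF a(2) b(2)] sder_add[OF a(3) b(3)]
      Suc.IH[OF a(4) b(4)] Suc.IH[OF a(5) b(5)]])
qed

lemma Ck_mult: "Ck_on_strip k a \<Longrightarrow> Ck_on_strip k b \<Longrightarrow> Ck_on_strip k (\<lambda>t x. a t x * b t x)"
proof (induction k arbitrary: a b)
  case 0
  then show ?case using scont_mult[of a b] by (simp add: scont_def)
next
  case (Suc k)
  note ab = Suc.prems[THEN Ck_pred]
  obtain at' ax where a: "scont a" "tder a at'" "sder a ax" "Ck_on_strip k at'" "Ck_on_strip k ax"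
    using Suc.prems(1) by (rule Ck_SucE)
  obtain bt bx where b: "scont b" "tder b bt" "sder b bx" "Ck_on_strip k bt" "Ck_on_strip k bx"
    using Suc.prems(2) by (rule Ck_SucE)
  show ?case
    by (rule Ck_SucI[OF scont_mult[OF a(1) b(1)] tder_mult[OF a(2) b(2)] sder_mult[OF a(3) b(3)]
      Ck_add[OF Suc.IH[OF a(4) ab(2)] Suc.IH[OF ab(1) b(4)]]
      Ck_add[OF Suc.IH[OF a(5) ab(2)] Suc.IH[OF ab(1) b(5)]]])
qed

lemma Ck_minus: "Ck_on_strip k a \<Longrightarrow> Ck_on_strip k (\<lambda>t x. - a t x)"
  using Ck_mult[OF Ck_const[of k "-1"]] by simp

text \<open>The derivative of the inverse is again built from inverses of the same function, to
  which the induction hypothesis applies.\<close>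

lemma Ck_inverse:
  "Ck_on_strip k a \<Longrightarrow> (\<And>t x. 0 < t \<Longrightarrow> x \<in> {0..1} \<Longrightarrow> a t x \<noteq> 0) \<Longrightarrow> Ck_on_strip k (\<lambda>t x. inverse (a t x))"
proof (induction k arbitrary: a)
  case 0
  have "continuous_on ({0<..} \<times> {0..1}) (\<lambda>p. inverse (a (fst p) (snd p)))"
    using 0 by (intro continuous_on_inverse) (auto simp: split_beta)
  then show ?case by (simp add: split_beta)
next
  case (Suc k)
  note i = Suc.IH[OF Ck_pred[OF Suc.prems(1)] Suc.prems(2)]
  have "continuous_on ({0<..} \<times> {0..1}) (\<lambda>p. inverse (a (fst p) (snd p)))"
    using Suc.prems by (intro continuous_on_inverse) (auto simp: split_beta)
  then have c: "scont (\<lambda>t x. inverse (a t x))" by (simp add: scont_def split_beta)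
  obtain at' ax where a: "scont a" "tder a at'" "sder a ax" "Ck_on_strip k at'" "Ck_on_strip k ax"
    using Suc.prems(1) by (rule Ck_SucE)
  show ?case
    by (rule Ck_SucI[OF c tder_inverse[OF a(2) Suc.prems(2)] sder_inverse[OF a(3) Suc.prems(2)]
      Ck_mult[OF Ck_minus[OF a(4)] Ck_mult[OF i i]] Ck_mult[OF Ck_minus[OF a(5)] Ck_mult[OF i i]]])
qed

lemma smooth_grad: "smooth_on_strip w \<Longrightarrow> smooth_on_strip (\<lambda>t. grad (w t))"
  unfolding smooth_on_strip_def by (metis Ck_on_strip.simps(2))

lemma smooth_vfun:
  assumes F: "smooth_on_strip F"
    and nz: "\<And>t x. 0 < t \<Longrightarrow> x \<in> {0..1} \<Longrightarrow> grad (F t) x \<noteq> 0"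
  shows "smooth_on_strip (vfun F)"
  unfolding smooth_on_strip_def
proof
  fix k
  note g = smooth_grad[OF F] and l = smooth_grad[OF smooth_grad[OF F]]
  have k: "Ck_on_strip k F" "Ck_on_strip k (\<lambda>t. grad (F t))" "Ck_on_strip k (\<lambda>t. grad (grad (F t)))"
    using F g l by (auto simp: smooth_on_strip_def)
  have "Ck_on_strip k (\<lambda>t x. F t x + F t x * (1 + - F t x) * (grad (grad (F t)) x * inverse (grad (F t) x * grad (F t) x)))"
    by (intro Ck_add Ck_mult Ck_inverse Ck_minus Ck_const k) (use nz in auto)
  then show "Ck_on_strip k (vfun F)"
    by (rule Ck_cong[rotated]) (simp add: vfun_def lap_def divide_inverse power2_eq_square)
qed

text \<open>One variable and an arbitrary set S, so that it yields \<partial>_t v and \<nabla>v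
  alike.\<close>

lemma v_deriv:
  fixes P Q R :: "real \<Rightarrow> real"
  assumes P: "(P has_real_derivative P') (at x within S)" and Q: "(Q has_real_derivative Q') (at x within S)"
    and R: "(R has_real_derivative R') (at x within S)" and nz: "Q x \<noteq> 0"
  shows "((\<lambda>x. P x + P x * (1 - P x) * (R x / (Q x)\<^sup>2)) has_real_derivative
    P' + (1 - 2 * P x) * P' * R x / (Q x)\<^sup>2 + P x * (1 - P x) * (R' / (Q x)\<^sup>2 - 2 * R x * Q' / (Q x) ^ 3)) (at x within S)"
proof (rule DERIV_cong)
  show "((\<lambda>x. P x + P x * (1 - P x) * (R x / (Q x)\<^sup>2)) has_real_derivative
    P' + ((P' * (1 - P x) + (0 - P') * P x) * (R x / (Q x)\<^sup>2)
      + (R' * (Q x)\<^sup>2 - R x * (of_nat 2 * (Q' * Q x ^ (2 - Suc 0)))) / ((Q x)\<^sup>2 * (Q x)\<^sup>2) * (P x * (1 - P x)))) (at x within S)"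
    by (intro DERIV_add DERIV_mult DERIV_divide DERIV_diff DERIV_const DERIV_power P Q R) (use nz in simp)
  show "P' + ((P' * (1 - P x) + (0 - P') * P x) * (R x / (Q x)\<^sup>2)
      + (R' * (Q x)\<^sup>2 - R x * (of_nat 2 * (Q' * Q x ^ (2 - Suc 0)))) / ((Q x)\<^sup>2 * (Q x)\<^sup>2) * (P x * (1 - P x)))
    = P' + (1 - 2 * P x) * P' * R x / (Q x)\<^sup>2 + P x * (1 - P x) * (R' / (Q x)\<^sup>2 - 2 * R x * Q' / (Q x) ^ 3)"
    using nz by (simp add: field_simps power2_eq_square power3_eq_cube)
qed

text \<open>The derivatives of \<open>p = F\<close> are \<open>q = \<nabla>F\<close>, \<open>r = \<Delta>F = \<partial>\<^sub>t F\<close>, \<open>s = \<nabla>\<Delta>F\<close> and \<open>m = \<Delta>\<^sup>2F\<close>. In these terms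
  the flux \<open>\<nabla>v - 2 \<sigma>(v) \<nabla>R\<close> is \<open>- q - (1 - 2 p) r / q + p (1 - p) s / q\<^sup>2\<close>, whose derivative is
  \<open>\<partial>\<^sub>t v\<close>.\<close>

definition sflux :: "real \<Rightarrow> real \<Rightarrow> real \<Rightarrow> real"
  where "sflux p q r = q + (1 - 2 * p) * r / q - p * (1 - p) * r\<^sup>2 / q ^ 3"

definition flux :: "real \<Rightarrow> real \<Rightarrow> real \<Rightarrow> real \<Rightarrow> real"
  where "flux p q r s = - q - (1 - 2 * p) * r / q + p * (1 - p) * s / q\<^sup>2"

section \<open>Algebra of the flux and of the boundary rates\<close>

lemma sigma_flux:
  fixes p q r :: real
  assumes "0 < p" "p < 1" "q \<noteq> 0"
  shows "sigma (p + p * (1 - p) * (r / q\<^sup>2)) * (q / (p * (1 - p))) = sflux p q r"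
proof -
  have sig: "sigma (p + p * (1 - p) * y) = (p * (1 - p)) * ((1 + (1 - p) * y) * (1 - p * y))" for y
    by (simp add: sigma_def algebra_simps)
  have "sigma (p + p * (1 - p) * (r / q\<^sup>2)) * (q / (p * (1 - p)))
      = ((1 + (1 - p) * (r / q\<^sup>2)) * (1 - p * (r / q\<^sup>2))) * q"
    unfolding sig using assms(1,2) by simp
  also have "\<dots> = sflux p q r"
    using assms(3) by (simp add: sflux_def field_simps power2_eq_square power3_eq_cube)
  finally show ?thesis .
qed

text \<open>With y = r / q^2, v = p (1 + (1 - p) y) and 1 - v = (1 - p) (1 - p y); these factors
  cancel the denominators in exp R = p / (1 - p) and its inverse. The same factorization underlies
  \<open>sigma_flux\<close>.\<close>

lemma pfun_flux:
  fixes p q r \<rho> D :: real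
  assumes "0 < p" "p < 1"
  shows "pfun (1 - \<rho>) D (p + p * (1 - p) * (r / q\<^sup>2)) (ln (p / (1 - p)))
    = (p - \<rho> - r / q\<^sup>2 * ((1 - \<rho>) * p\<^sup>2 + \<rho> * (1 - p)\<^sup>2)) / D"
proof -
  have pos: "0 < p / (1 - p)" using assms by simp
  have e: "exp (ln (p / (1 - p))) = p / (1 - p)" "exp (- ln (p / (1 - p))) = (1 - p) / p"
    using pos by (simp_all add: exp_minus)
  have 1: "(1 - (p + p * (1 - p) * (r / q\<^sup>2))) * (1 - \<rho>) * (p / (1 - p)) = (1 - \<rho>) * p * (1 - p * (r / q\<^sup>2))"
  proof -
    have "1 - (p + p * (1 - p) * (r / q\<^sup>2)) = (1 - p) * (1 - p * (r / q\<^sup>2))" by (simp add: algebra_simps)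
    then show ?thesis using assms by simp
  qed
  have 2: "(p + p * (1 - p) * (r / q\<^sup>2)) * (1 - (1 - \<rho>)) * ((1 - p) / p) = \<rho> * (1 - p) * (1 + (1 - p) * (r / q\<^sup>2))"
  proof -
    have "p + p * (1 - p) * (r / q\<^sup>2) = p * (1 + (1 - p) * (r / q\<^sup>2))" by (simp add: algebra_simps)
    then show ?thesis using assms by simp
  qed
  show ?thesis unfolding pfun_def e 1 2 by (simp add: algebra_simps power2_eq_square add_divide_distrib diff_divide_distrib)
qed

text \<open>The heat equation enters through double roles: r is \<Delta>F and \<partial>_t F, s is
  \<nabla>r and \<partial>_t q, m is \<nabla>s and \<partial>_t r. The boundary conditions are left
  to \<open>vfun_bdry\<close>.\<close>

locale transformed =
  fixes F q r s m :: "real \<Rightarrow> real \<Rightarrow> real"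
  assumes F01: "\<And>t x. 0 < t \<Longrightarrow> x \<in> {0..1} \<Longrightarrow> 0 < F t x" "\<And>t x. 0 < t \<Longrightarrow> x \<in> {0..1} \<Longrightarrow> F t x < 1"
    and qnz: "\<And>t x. 0 < t \<Longrightarrow> x \<in> {0..1} \<Longrightarrow> q t x \<noteq> 0"
    and sF: "sder F q" "sder q r" "sder r s" "sder s m"
    and tF: "tder F r" "tder q s" "tder r m"
begin

lemma vfun_eq:
  assumes "0 < t" "x \<in> {0..1}"
  shows "lap (F t) x = r t x" "vfun F t x = F t x + F t x * (1 - F t x) * (r t x / (q t x)\<^sup>2)"
proof -
  have "lap (F t) x = grad (q t) x"
    unfolding lap_def using sder_grad[OF sF(1) assms(1)] by (intro grad_cong assms) simp
  also have "\<dots> = r t x" by (rule sder_grad[OF sF(2) assms])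
  finally show "lap (F t) x = r t x" .
  then show "vfun F t x = F t x + F t x * (1 - F t x) * (r t x / (q t x)\<^sup>2)"
    by (simp add: vfun_def sder_grad[OF sF(1) assms])
qed

definition vt :: "real \<Rightarrow> real \<Rightarrow> real"
  where "vt t x = r t x + (1 - 2 * F t x) * r t x * r t x / (q t x)\<^sup>2
    + F t x * (1 - F t x) * (m t x / (q t x)\<^sup>2 - 2 * r t x * s t x / (q t x) ^ 3)"

lemma vfun_tder: "tder (vfun F) vt"
proof (rule tder_cong)
  show "tder (\<lambda>t x. F t x + F t x * (1 - F t x) * (r t x / (q t x)\<^sup>2)) vt"
    unfolding tder_def vt_def by (intro allI impI ballI v_deriv tderD[OF tF(1)] tderD[OF tF(2)] tderD[OF tF(3)] qnz)
qed (simp_all add: vfun_eq(2))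

lemma vfun_sder: "sder (vfun F) (\<lambda>t x. flux (F t x) (q t x) (r t x) (s t x) + 2 * sflux (F t x) (q t x) (r t x))"
proof (rule sder_cong)
  show "sder (\<lambda>t x. F t x + F t x * (1 - F t x) * (r t x / (q t x)\<^sup>2))
    (\<lambda>t x. q t x + (1 - 2 * F t x) * q t x * r t x / (q t x)\<^sup>2
      + F t x * (1 - F t x) * (s t x / (q t x)\<^sup>2 - 2 * r t x * r t x / (q t x) ^ 3))"
    unfolding sder_def by (intro allI impI ballI v_deriv sderD[OF sF(1)] sderD[OF sF(2)] sderD[OF sF(3)] qnz)
  fix t x :: real assume "0 < t" "x \<in> {0..1}"
  from qnz[OF this]
  show "q t x + (1 - 2 * F t x) * q t x * r t x / (q t x)\<^sup>2
      + F t x * (1 - F t x) * (s t x / (q t x)\<^sup>2 - 2 * r t x * r t x / (q t x) ^ 3)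
    = flux (F t x) (q t x) (r t x) (s t x) + 2 * sflux (F t x) (q t x) (r t x)"
    by (simp add: flux_def sflux_def field_simps power2_eq_square power3_eq_cube)
qed (simp_all add: vfun_eq(2))

text \<open>This is the parabolic equation in conservation form: \<open>vt\<close> was obtained by
  differentiating v in time, and the space derivative of the flux turns out to be the same
  expression.\<close>

lemma flux_sder: "sder (\<lambda>t x. flux (F t x) (q t x) (r t x) (s t x)) vt"
  unfolding sder_def
proof (intro allI impI ballI)
  fix t x :: real assume t: "0 < t" and x: "x \<in> {0..1}"
  note P = sderD[OF sF(1) t x] and Q = sderD[OF sF(2) t x] and R = sderD[OF sF(3) t x] and S = sderD[OF sF(4) t x]
  let ?p = "F t x" and ?q = "q t x" and ?r = "r t x" and ?s = "s t x" and ?m = "m t x"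
  have "((\<lambda>x. - q t x - (1 - 2 * F t x) * r t x / q t x + F t x * (1 - F t x) * s t x / (q t x)\<^sup>2) has_real_derivative
      - ?r - (((0 - 2 * ?q) * ?r + ?s * (1 - 2 * ?p)) * ?q - (1 - 2 * ?p) * ?r * ?r) / (?q * ?q)
      + (((?q * (1 - ?p) + (0 - ?q) * ?p) * ?s + ?m * (?p * (1 - ?p))) * ?q\<^sup>2
        - ?p * (1 - ?p) * ?s * (of_nat 2 * (?r * ?q ^ (2 - Suc 0)))) / (?q\<^sup>2 * ?q\<^sup>2)) (at x within {0..1})"
    by (intro DERIV_add DERIV_mult DERIV_divide DERIV_diff DERIV_const DERIV_power DERIV_cmult DERIV_minus P Q R S)
      (use qnz[OF t x] in simp_all)
  moreover have "- ?r - (((0 - 2 * ?q) * ?r + ?s * (1 - 2 * ?p)) * ?q - (1 - 2 * ?p) * ?r * ?r) / (?q * ?q)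
      + (((?q * (1 - ?p) + (0 - ?q) * ?p) * ?s + ?m * (?p * (1 - ?p))) * ?q\<^sup>2
        - ?p * (1 - ?p) * ?s * (of_nat 2 * (?r * ?q ^ (2 - Suc 0)))) / (?q\<^sup>2 * ?q\<^sup>2) = vt t x"
    using qnz[OF t x] by (simp add: vt_def field_simps power2_eq_square power3_eq_cube)
  ultimately show "((\<lambda>x. flux (F t x) (q t x) (r t x) (s t x)) has_real_derivative vt t x) (at x within {0..1})"
    unfolding flux_def by simp
qed

lemma sflux_differentiable:
  assumes t: "0 < t" and x: "x \<in> {0..1}"
  obtains d where "((\<lambda>x. sflux (F t x) (q t x) (r t x)) has_real_derivative d) (at x within {0..1})"
proof -
  note P = sderD[OF sF(1) t x] and Q = sderD[OF sF(2) t x] and R = sderD[OF sF(3) t x]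
  have "\<exists>d. ((\<lambda>x. sflux (F t x) (q t x) (r t x)) has_real_derivative d) (at x within {0..1})"
    unfolding sflux_def
    by (rule exI, (rule DERIV_add DERIV_mult DERIV_divide DERIV_diff DERIV_const DERIV_power P Q R
      qnz[OF t x] power_not_zero)+)
  then show thesis using that by blast
qed

lemma logit_grad:
  assumes "0 < t" "x \<in> {0..1}"
  shows "grad (logit F t) x = q t x / (F t x * (1 - F t x))"
proof (rule grad_eq[OF _ assms(2)])
  have p: "0 < F t x" "F t x < 1" using F01 assms by auto
  have "((\<lambda>x. F t x / (1 - F t x)) has_real_derivative
      (q t x * (1 - F t x) - F t x * (0 - q t x)) / ((1 - F t x) * (1 - F t x))) (at x within {0..1})"
    by (intro DERIV_divide DERIV_diff DERIV_const sderD[OF sF(1)] assms) (use p in simp)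
  from DERIV_chain2[OF DERIV_ln this] p
  have "((\<lambda>x. ln (F t x / (1 - F t x))) has_real_derivative
      inverse (F t x / (1 - F t x)) * ((q t x * (1 - F t x) - F t x * (0 - q t x)) / ((1 - F t x) * (1 - F t x))))
      (at x within {0..1})" by simp
  moreover have "inverse (F t x / (1 - F t x)) * ((q t x * (1 - F t x) - F t x * (0 - q t x)) / ((1 - F t x) * (1 - F t x)))
      = q t x / (F t x * (1 - F t x))"
  proof -
    have "q t x * (1 - F t x) - F t x * (0 - q t x) = q t x" by (simp add: algebra_simps)
    then show ?thesis using p by (simp add: divide_simps)
  qed
  ultimately show "(logit F t has_real_derivative q t x / (F t x * (1 - F t x))) (at x within {0..1})"
    by (simp add: logit_def[abs_def])
qed

lemma sigma_grad:
  assumes "0 < t" "x \<in> {0..1}"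
  shows "sigma (vfun F t x) * grad (logit F t) x = sflux (F t x) (q t x) (r t x)"
  unfolding logit_grad[OF assms] vfun_eq(2)[OF assms] using F01 qnz assms by (intro sigma_flux)

lemma vfun_parabolic:
  assumes t: "0 < t" and x: "x \<in> {0..1}"
  shows "time_deriv {0<..} (vfun F) t x = lap (vfun F t) x - 2 * grad (\<lambda>y. sigma (vfun F t y) * grad (logit F t) y) x"
proof -
  let ?Z = "\<lambda>x. flux (F t x) (q t x) (r t x) (s t x)" and ?W = "\<lambda>x. sflux (F t x) (q t x) (r t x)"
  obtain d where d: "(?W has_real_derivative d) (at x within {0..1})" by (rule sflux_differentiable[OF assms])
  have "lap (vfun F t) x = grad (\<lambda>x. ?Z x + 2 * ?W x) x"
    unfolding lap_def using sder_grad[OF vfun_sder t] by (intro grad_cong x) simp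
  also have "\<dots> = vt t x + 2 * d"
    by (intro grad_eq[OF _ x] DERIV_add DERIV_cmult d sderD[OF flux_sder t x])
  also have "d = grad ?W x" by (rule grad_eq[OF d x, symmetric])
  also have "\<dots> = grad (\<lambda>y. sigma (vfun F t y) * grad (logit F t) y) x"
    using sigma_grad[OF t] by (intro grad_cong x) simp
  finally show ?thesis using tder_time_deriv[OF vfun_tder t x] by simp
qed

lemma vfun_flux:
  assumes "0 < t" "x \<in> {0..1}"
  shows "grad (vfun F t) x - 2 * sigma (vfun F t x) * grad (logit F t) x = flux (F t x) (q t x) (r t x) (s t x)"
  using sder_grad[OF vfun_sder assms] sigma_grad[OF assms] by (simp add: mult.assoc)

text \<open>One statement for both ends: at 0 with D = A and \<rho> = \<alpha>, at 1 with D = - B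
  and \<rho> = \<beta>, the sign being undone by \<open>pfun_neg_D\<close>. The condition on s is
  the time derivative of the Robin condition on q.\<close>

lemma vfun_bdry:
  assumes t: "0 < t" and x: "x \<in> {0..1}" and D: "D \<noteq> 0"
    and q: "q t x = (F t x - \<rho>) / D" and s: "s t x = r t x / D"
  shows "grad (vfun F t) x - 2 * sigma (vfun F t x) * grad (logit F t) x = - pfun (1 - \<rho>) D (vfun F t x) (logit F t x)"
proof -
  let ?p = "F t x" and ?q = "q t x" and ?r = "r t x"
  have nz: "?q \<noteq> 0" by (rule qnz[OF t x])
  have "(1 - 2 * ?p) * ?r / ?q = ?r / ?q\<^sup>2 * ((1 - 2 * ?p) * ((?p - \<rho>) / D))"
    unfolding q[symmetric] using nz by (simp add: power2_eq_square)
  moreover have "?p * (1 - ?p) * s t x / ?q\<^sup>2 = ?r / ?q\<^sup>2 * (?p * (1 - ?p) / D)" by (simp add: s ac_simps)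
  ultimately have "flux ?p ?q ?r (s t x) = - ((?p - \<rho>) / D)
      - ?r / ?q\<^sup>2 * ((1 - 2 * ?p) * ((?p - \<rho>) / D)) + ?r / ?q\<^sup>2 * (?p * (1 - ?p) / D)"
    by (simp add: flux_def q)
  \<comment> \<open>This rests on p (1 - p) - (1 - 2 p) (p - \<rho>) = (1 - \<rho>) p^2 + \<rho> (1
    - p)^2.\<close>
  also have "\<dots> = - ((?p - \<rho> - ?r / ?q\<^sup>2 * ((1 - \<rho>) * ?p\<^sup>2 + \<rho> * (1 - ?p)\<^sup>2)) / D)"
    using D by (simp add: divide_simps) (simp add: power2_eq_square algebra_simps)
  also have "\<dots> = - pfun (1 - \<rho>) D (vfun F t x) (logit F t x)"
    unfolding vfun_eq(2)[OF t x] logit_def pfun_flux[OF F01(1)[OF t x] F01(2)[OF t x]] ..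
  finally show ?thesis unfolding vfun_flux[OF t x] .
qed

lemma pfun_neg_D: "pfun \<rho> (- D) a M = - pfun \<rho> D a M"
  by (simp add: pfun_def)

end

section \<open>The initial datum\<close>

text \<open>On the set where the difference quotient stays \<open>1 / (n + 1)\<close> away from the integrand, short
  offending intervals form a Vitali cover, and Henstock's lemma bounds the total length of disjoint ones.\<close>

lemma indefinite_integral_has_deriv_ae:
  fixes f :: "real \<Rightarrow> real"
  assumes f: "f integrable_on {a..b}"
  obtains N where "negligible N"
    "\<And>x. x \<in> {a..b} - N \<Longrightarrow> ((\<lambda>y. integral {a..y} f) has_real_derivative f x) (at x within {a..b})"
proof -
  define I where "I y = integral {a..y} f" for y
  have Idiff: "integral {x..y} f = I y - I x" if "x \<in> {a..b}" "y \<in> {a..b}" "x \<le> y" for x y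
  proof -
    have "integral {a..x} f + integral {x..y} f = integral {a..y} f"
      using that by (intro Henstock_Kurzweil_Integration.integral_combine integrable_on_subinterval[OF f]) auto
    then show ?thesis by (simp add: I_def)
  qed
  define bad where "bad n x y \<longleftrightarrow> \<bar>y - x\<bar> < real (Suc n) * \<bar>I y - I x - f x * (y - x)\<bar>" for n x y
  define S where "S n = {x \<in> {a..b}. \<forall>d>0. \<exists>y\<in>{a..b}. y \<noteq> x \<and> \<bar>y - x\<bar> < d \<and> bad n x y}" for n
  have neg: "negligible (S n)" for n
    unfolding negligible_outer_le
  proof (intro allI impI)
    fix e :: real assume e: "0 < e"
    have "0 < e / real (Suc n)" using e by simp
    then obtain \<gamma> where g: "gauge \<gamma>" and hen: "\<And>p. p tagged_partial_division_of cbox a b \<Longrightarrow> \<gamma> fine p \<Longrightarrow>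
        (\<Sum>(x, k)\<in>p. norm (measure lborel k *\<^sub>R f x - integral k f)) < e / real (Suc n)"
      using Henstock_lemma[of f a b "e / real (Suc n)"] f by auto
    \<comment> \<open>A pair stands for the segment from the tag x to y, on either side of x;
      written as a closed ball it fits Vitali's theorem.\<close>
    define J where "J = {(x, y). x \<in> S n \<and> y \<in> {a..b} \<and> y \<noteq> x \<and> closed_segment x y \<subseteq> \<gamma> x \<and> bad n x y}"
    define ce where "ce i = (fst i + snd i) / 2" for i :: "real \<times> real"
    define ra where "ra i = \<bar>snd i - fst i\<bar> / 2" for i :: "real \<times> real"
    have seg: "cball (ce i) (ra i) = closed_segment (fst i) (snd i)" for i
      by (auto simp: cball_eq_atLeastAtMost ce_def ra_def closed_segment_eq_real_ivl abs_if field_simps)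
    have rpos: "0 < ra i" if "i \<in> J" for i using that by (auto simp: J_def ra_def)
    have cover: "\<exists>i. i \<in> J \<and> x \<in> cball (ce i) (ra i) \<and> ra i < d" if x: "x \<in> S n" and d: "0 < d" for x d
    proof -
      have "open (\<gamma> x)" "x \<in> \<gamma> x" using g by (auto simp: gauge_def)
      then obtain \<delta> where del: "0 < \<delta>" "ball x \<delta> \<subseteq> \<gamma> x" using open_contains_ball by blast
      have "0 < min d \<delta>" using d del by simp
      then obtain y where y: "y \<in> {a..b}" "y \<noteq> x" "\<bar>y - x\<bar> < min d \<delta>" "bad n x y"
        using x unfolding S_def by blast
      have "closed_segment x y \<subseteq> ball x \<delta>"
        using y del by (intro closed_segment_subset) (auto simp: dist_real_def)
      then have "(x, y) \<in> J" using x y del by (auto simp: J_def)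
      moreover have "x \<in> cball (ce (x, y)) (ra (x, y))" unfolding seg by simp
      moreover have "ra (x, y) < d" using y d by (simp add: ra_def)
      ultimately show ?thesis by blast
    qed
    obtain C where C: "countable C" "C \<subseteq> J"
      and disj: "pairwise (\<lambda>i j. disjnt (cball (ce i) (ra i)) (cball (ce j) (ra j))) C"
      and negl: "negligible (S n - (\<Union>i\<in>C. cball (ce i) (ra i)))"
      by (rule Vitali_covering_theorem_cballs[of J ra "S n" ce, OF rpos cover]) auto
    let ?U = "\<Union>i\<in>C. cball (ce i) (ra i)"
    have fin: "measure lebesgue (\<Union>i\<in>F. cball (ce i) (ra i)) \<le> e" if F: "F \<subseteq> C" "finite F" for F
    proof -
      define p where "p = (\<lambda>i. (fst i, cball (ce i) (ra i))) ` F"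
      have pfin: "finite p" using F by (simp add: p_def)
      have FJ: "i \<in> J" if "i \<in> F" for i using that F C by auto
      have p: "p tagged_partial_division_of cbox a b"
        unfolding tagged_partial_division_of_def
      proof (intro conjI allI impI pfin)
        fix x K assume "(x, K) \<in> p"
        then obtain i where i: "i \<in> F" "x = fst i" "K = cball (ce i) (ra i)" by (auto simp: p_def)
        show "x \<in> K" unfolding i seg by simp
        show "K \<subseteq> cbox a b" unfolding i seg
          using FJ[OF i(1)] by (intro closed_segment_subset) (auto simp: J_def S_def)
        show "\<exists>u v. K = cbox u v" unfolding i cball_eq_atLeastAtMost cbox_interval[symmetric] by blast
      next
        fix x1 K1 x2 K2 assume "(x1, K1) \<in> p \<and> (x2, K2) \<in> p \<and> (x1, K1) \<noteq> (x2, K2)"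
        then obtain i j where ij: "i \<in> F" "j \<in> F" "i \<noteq> j" "K1 = cball (ce i) (ra i)" "K2 = cball (ce j) (ra j)"
          by (auto simp: p_def)
        then have "disjnt K1 K2" using disj F unfolding pairwise_def by blast
        then show "interior K1 \<inter> interior K2 = {}"
          using interior_subset[of K1] interior_subset[of K2] by (auto simp: disjnt_def)
      qed
      have fine: "\<gamma> fine p"
        unfolding fine_def
      proof (intro ballI, clarify)
        fix x K y assume "(x, K) \<in> p" "y \<in> K"
        then obtain i where i: "i \<in> F" "x = fst i" "K = closed_segment (fst i) (snd i)" by (auto simp: p_def seg)
        have "closed_segment (fst i) (snd i) \<subseteq> \<gamma> (fst i)" using FJ[OF i(1)] by (auto simp: J_def)
        then show "y \<in> \<gamma> x" using i \<open>y \<in> K\<close> by auto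
      qed
      \<comment> \<open>\<open>bad n x y\<close> says that the length of the segment is below
        \<open>Suc n\<close> times its Henstock error, whence e / (n + 1) in the choice of the
        gauge.\<close>
      have term_le: "measure lebesgue K \<le> real (Suc n) * norm (measure lborel K *\<^sub>R f x - integral K f)" if xK: "(x, K) \<in> p" for x K
      proof -
        obtain i where i: "i \<in> F" "x = fst i" "K = cball (ce i) (ra i)"
          using xK by (auto simp: p_def)
        define y where "y = snd i"
        have J: "x \<in> {a..b}" "y \<in> {a..b}" "bad n x y" using FJ[OF i(1)] i by (auto simp: J_def S_def y_def)
        have K: "K = closed_segment x y" by (simp add: i seg y_def)
        show ?thesis
        proof (cases "x \<le> y")
          case True
          then have "K = {x..y}" by (simp add: K closed_segment_eq_real_ivl)
          then show ?thesis using J True by (simp add: Idiff bad_def abs_minus_commute mult.commute)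
        next
          case False
          then have "K = {y..x}" by (simp add: K closed_segment_eq_real_ivl)
          moreover have "\<bar>(x - y) * f x - (I x - I y)\<bar> = \<bar>I y - I x - f x * (y - x)\<bar>" by (simp add: algebra_simps)
          ultimately show ?thesis using J False by (simp add: Idiff bad_def)
        qed
      qed
      have "(\<Union>i\<in>F. cball (ce i) (ra i)) = (\<Union>q\<in>p. snd q)" by (auto simp: p_def)
      also have "measure lebesgue \<dots> \<le> (\<Sum>q\<in>p. measure lebesgue (snd q))"
        by (rule measure_UNION_le[OF pfin]) (auto simp: p_def)
      also have "\<dots> \<le> (\<Sum>q\<in>p. real (Suc n) * norm (measure lborel (snd q) *\<^sub>R f (fst q) - integral (snd q) f))"
        by (intro sum_mono term_le) simp
      also have "\<dots> = real (Suc n) * (\<Sum>(x, K)\<in>p. norm (measure lborel K *\<^sub>R f x - integral K f))"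
        by (simp only: sum_distrib_left split_beta)
      also have "\<dots> \<le> real (Suc n) * (e / real (Suc n))"
        by (rule mult_left_mono[OF less_imp_le[OF hen[OF p fine]]]) simp
      also have "\<dots> = e" by simp
      finally show ?thesis .
    qed
    have U: "?U \<in> lmeasurable" "measure lebesgue ?U \<le> e"
      by (rule fmeasurable_UN_bound measure_UN_bound; use C fin in auto)+
    show "\<exists>T. S n \<subseteq> T \<and> T \<in> lmeasurable \<and> measure lebesgue T \<le> e"
    proof (intro exI[of _ "?U \<union> (S n - ?U)"] conjI)
      show "?U \<union> (S n - ?U) \<in> lmeasurable"
        by (intro fmeasurable.Un U negligible_imp_measurable negl)
      have "measure lebesgue (?U \<union> (S n - ?U)) \<le> measure lebesgue ?U + measure lebesgue (S n - ?U)"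
        by (intro measure_Un_le fmeasurableD U negligible_imp_measurable negl)
      then show "measure lebesgue (?U \<union> (S n - ?U)) \<le> e"
        using U(2) negligible_imp_measure0[OF negl] by simp
    qed auto
  qed
  show thesis
  proof (rule that)
    show "negligible (\<Union>n. S n)" by (rule negligible_countable_Union) (auto simp: neg)
    fix x assume x: "x \<in> {a..b} - (\<Union>n. S n)"
    have "(I has_derivative (\<lambda>h. f x * h)) (at x within {a..b})"
      unfolding has_derivative_within_alt
    proof (intro conjI allI impI)
      show "bounded_linear (\<lambda>h. f x * h)" by (rule bounded_linear_mult_right)
      fix e :: real assume e: "0 < e"
      obtain n where n: "1 / real (Suc n) < e" using nat_approx_posE[OF e] by blast
      have "x \<notin> S n" using x by auto
      then have "\<not> (\<forall>d>0. \<exists>y\<in>{a..b}. y \<noteq> x \<and> \<bar>y - x\<bar> < d \<and> bad n x y)"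
        using x by (simp add: S_def)
      then obtain d where d: "0 < d" "\<forall>y\<in>{a..b}. y \<noteq> x \<longrightarrow> \<bar>y - x\<bar> < d \<longrightarrow> \<not> bad n x y"
        by blast
      show "\<exists>d>0. \<forall>y\<in>{a..b}. norm (y - x) < d \<longrightarrow> norm (I y - I x - f x * (y - x)) \<le> e * norm (y - x)"
      proof (intro exI[of _ d] conjI ballI impI d(1))
        fix y assume y: "y \<in> {a..b}" "norm (y - x) < d"
        show "norm (I y - I x - f x * (y - x)) \<le> e * norm (y - x)"
        proof (cases "y = x")
          case False
          then have "real (Suc n) * \<bar>I y - I x - f x * (y - x)\<bar> \<le> \<bar>y - x\<bar>"
            using d(2)[rule_format, OF y(1)] y(2) by (simp add: bad_def)
          then have "\<bar>I y - I x - f x * (y - x)\<bar> \<le> 1 / real (Suc n) * \<bar>y - x\<bar>"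
            by (simp add: field_simps del: of_nat_Suc)
          also have "\<dots> \<le> e * \<bar>y - x\<bar>" using n by (intro mult_right_mono) auto
          finally show ?thesis by simp
        qed simp
      qed
    qed
    then show "((\<lambda>y. integral {a..y} f) has_real_derivative f x) (at x within {a..b})"
      by (simp add: has_field_derivative_def I_def[abs_def])
  qed
qed

text \<open>Differentiating the fixed point equation gives \<open>grad G x = c0 * exp (I x)\<close>
  with I the integral of a bounded function; so the gradient is Lipschitz, and it has the expected
  derivative wherever I has. The form of the denominator Z encodes the Robin condition at 1, the
  summand A in the numerator the one at 0.\<close>

lemma is_F_props:
  assumes ab: "0 < \<alpha>" "\<alpha> < \<beta>" "\<beta> < 1" and AB: "0 < A" "0 < B"
    and gam: "\<gamma> \<in> M_ac" and F: "is_F \<alpha> \<beta> A B \<gamma> G"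
  shows "\<And>x. x \<in> {0..1} \<Longrightarrow> (G has_real_derivative grad G x) (at x within {0..1})"
    "continuous_on {0..1} (grad G)"
    "\<And>x. x \<in> {0..1} \<Longrightarrow> \<alpha> < G x \<and> G x < \<beta> \<and> 0 < grad G x"
    "grad G 0 = (G 0 - \<alpha>) / A" "grad G 1 = (\<beta> - G 1) / B"
    "\<exists>L. \<forall>x\<in>{0..1}. \<forall>y\<in>{0..1}. \<bar>grad G x - grad G y\<bar> \<le> L * \<bar>x - y\<bar>"
    "AE x in lebesgue_on {0..1}. (grad G has_real_derivative grad G x * Rfun \<gamma> G x) (at x within {0..1})"
proof -
  define I where "I y = (LINT z:{0..y}|lebesgue. Rfun \<gamma> G z)" for y
  define J where "J x = (LINT y:{0..x}|lebesgue. exp (I y))" for x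
  define Z where "Z = A + J 1 + B * exp (I 1)"
  have cl: "G \<in> F_class \<alpha> \<beta>" and eq: "\<And>x. x \<in> {0..1} \<Longrightarrow> G x = \<alpha> + (\<beta> - \<alpha>) * ((A + J x) / Z)"
    using F by (auto simp: is_F_def Let_def I_def[abs_def] J_def[abs_def] Z_def)
  show dG: "(G has_real_derivative grad G x) (at x within {0..1})" if "x \<in> {0..1}" for x
    using cl that unfolding F_class_def grad_def has_real_derivative_iff_has_vector_derivative
    by (simp add: vector_derivative_works)
  show cg: "continuous_on {0..1} (grad G)" using cl by (simp add: F_class_def)
  show bd: "\<alpha> < G x \<and> G x < \<beta> \<and> 0 < grad G x" if "x \<in> {0..1}" for x
    using cl that by (simp add: F_class_def)
  have cG: "continuous_on {0..1} G" by (rule DERIV_continuous_on[OF dG])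
  define k where "k z = grad G z / (G z * (1 - G z))" for z
  have ck: "continuous_on {0..1} k"
    unfolding k_def using bd ab by (intro continuous_intros cg cG) force
  have R: "Rfun \<gamma> G = (\<lambda>z. \<gamma> z * k z - G z * k z)" by (rule ext) (simp only: Rfun_def k_def left_diff_distrib)
  have "set_integrable lebesgue {0..1} (\<lambda>z. \<gamma> z * k z)"
  proof (rule absolutely_integrable_bounded_measurable_product_real)
    show "\<gamma> \<in> borel_measurable (lebesgue_on {0..1})" using gam by (simp add: M_ac_def)
    show "bounded (\<gamma> ` {0..1})"
      unfolding bounded_iff using gam by (auto simp: M_ac_def intro!: exI[of _ 1])
    show "set_integrable lebesgue {0..1} k" by (rule LINT_continuous(1)[OF ck])
  qed simp
  then have iR: "set_integrable lebesgue {0..1} (Rfun \<gamma> G)"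
    unfolding R by (rule set_integral_diff(1)[OF _ LINT_continuous(1)[OF continuous_on_mult[OF cG ck]]])
  have sub: "set_integrable lebesgue {0..y} (Rfun \<gamma> G)" if "y \<in> {0..1}" for y
    by (rule set_integrable_subset[OF iR]) (use that in auto)
  have hk: "Rfun \<gamma> G integrable_on {0..1}" using set_lebesgue_integral_eq_integral(1)[OF iR] .
  have I_eq: "I y = integral {0..y} (Rfun \<gamma> G)" if "y \<in> {0..1}" for y
    unfolding I_def by (rule set_lebesgue_integral_eq_integral(2)[OF sub[OF that]])
  obtain M where M: "\<And>z. z \<in> {0..1} \<Longrightarrow> \<bar>k z\<bar> \<le> M"
    using compact_imp_bounded[OF compact_continuous_image[OF ck compact_Icc]]
    unfolding bounded_iff real_norm_def by blast
  have RM: "\<bar>Rfun \<gamma> G z\<bar> \<le> M" if z: "z \<in> {0..1}" for z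
  proof -
    have "0 \<le> \<gamma> z" "\<gamma> z \<le> 1" using gam z by (auto simp: M_ac_def)
    then have "\<bar>\<gamma> z - G z\<bar> \<le> 1" using bd[OF z] ab by linarith
    then have "\<bar>\<gamma> z - G z\<bar> * \<bar>k z\<bar> \<le> 1 * M" by (intro mult_mono M z) auto
    then show ?thesis by (simp add: Rfun_def k_def abs_mult)
  qed
  have M0: "0 \<le> M" using M[of 0] by simp
  have Ilip0: "\<bar>I y - I x\<bar> \<le> M * (y - x)" if xy: "x \<in> {0..1}" "y \<in> {0..1}" "x \<le> y" for x y
  proof -
    have "integral {0..x} (Rfun \<gamma> G) + integral {x..y} (Rfun \<gamma> G) = integral {0..y} (Rfun \<gamma> G)"
      using xy by (intro Henstock_Kurzweil_Integration.integral_combine integrable_on_subinterval[OF hk]) auto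
    then have "I y - I x = integral {x..y} (Rfun \<gamma> G)"
      using I_eq[OF xy(1)] I_eq[OF xy(2)] by linarith
    also have "norm \<dots> \<le> integral {x..y} (\<lambda>_. M)"
      using xy by (intro integral_norm_bound_integral integrable_on_subinterval[OF hk]) (auto intro!: RM)
    finally show ?thesis using xy by (simp add: mult.commute)
  qed
  have Ilip: "\<bar>I y - I x\<bar> \<le> M * \<bar>y - x\<bar>" if "x \<in> {0..1}" "y \<in> {0..1}" for x y
    using Ilip0[of x y] Ilip0[of y x] that by (cases "x \<le> y") (auto simp: abs_minus_commute)
  have cI: "continuous_on {0..1} I"
  proof (rule lipschitz_on_continuous_on)
    show "M-lipschitz_on {0..1} I" using Ilip M0 by (auto simp: lipschitz_on_def dist_real_def)
  qed
  have ce: "continuous_on {0..1} (\<lambda>y. exp (I y))" by (intro continuous_intros cI)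
  have J_eq: "J x = integral {0..x} (\<lambda>y. exp (I y))" if "x \<in> {0..1}" for x
    unfolding J_def by (rule LINT_continuous(2), rule continuous_on_subset[OF ce]) (use that in auto)
  have I0: "I 0 = 0" using I_eq[of 0] by simp
  have J0: "J 0 = 0" using J_eq[of 0] by simp
  have "0 \<le> J 1"
    unfolding J_eq[of 1, simplified] by (intro integral_nonneg integrable_continuous_interval ce) simp
  then have Z: "0 < Z" unfolding Z_def using AB by (intro add_pos_pos add_pos_nonneg mult_pos_pos) auto
  define c0 where "c0 = (\<beta> - \<alpha>) / Z"
  have g: "grad G x = c0 * exp (I x)" if x: "x \<in> {0..1}" for x
  proof (rule grad_eq[OF _ x])
    have "((\<lambda>u. integral {0..u} (\<lambda>y. exp (I y))) has_real_derivative exp (I x)) (at x within {0..1})"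
      using integral_has_vector_derivative[OF ce x] by (simp add: has_real_derivative_iff_has_vector_derivative)
    from DERIV_add[OF DERIV_const[of \<alpha>] DERIV_cmult[OF DERIV_cdivide[OF DERIV_add[OF DERIV_const[of A] this], of Z], of "\<beta> - \<alpha>"]]
    have "((\<lambda>u. \<alpha> + (\<beta> - \<alpha>) * ((A + integral {0..u} (\<lambda>y. exp (I y))) / Z)) has_real_derivative c0 * exp (I x)) (at x within {0..1})"
      by (simp add: c0_def)
    then show "(G has_real_derivative c0 * exp (I x)) (at x within {0..1})"
      by (rule has_field_derivative_transform_within[OF _ zero_less_one x]) (simp add: eq J_eq)
  qed
  show "grad G 0 = (G 0 - \<alpha>) / A"
    using g[of 0] eq[of 0] AB by (simp add: I0 J0 c0_def)
  show "grad G 1 = (\<beta> - G 1) / B"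
  proof -
    have "\<beta> - G 1 = (\<beta> - \<alpha>) * (1 - (A + J 1) / Z)" by (simp add: eq algebra_simps)
    also have "1 - (A + J 1) / Z = B * exp (I 1) / Z" using Z by (simp add: divide_simps) (simp add: Z_def)
    finally show ?thesis using g[of 1] AB by (simp add: c0_def)
  qed
  have c0: "0 < c0" using Z ab by (simp add: c0_def)
  have Ib: "I x \<le> M" if "x \<in> {0..1}" for x
  proof -
    have "\<bar>I x - I 0\<bar> \<le> M * \<bar>x - 0\<bar>" by (rule Ilip) (use that in auto)
    also have "\<dots> \<le> M * 1" using that M0 by (intro mult_left_mono) auto
    finally show ?thesis by (simp add: I0)
  qed
  show "\<exists>L. \<forall>x\<in>{0..1}. \<forall>y\<in>{0..1}. \<bar>grad G x - grad G y\<bar> \<le> L * \<bar>x - y\<bar>"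
  proof (intro exI ballI)
    fix x y :: real assume x: "x \<in> {0..1}" and y: "y \<in> {0..1}"
    have ed: "\<bar>exp a - exp b\<bar> \<le> exp M * \<bar>a - b\<bar>" if "a \<le> M" "b \<le> M" for a b
    proof -
      have e1: "exp u - exp v \<le> exp M * (u - v)" if "u \<le> M" "v \<le> u" for u v :: real
      proof -
        \<comment> \<open>exp lies above its tangent at u.\<close>
        have "exp u * (1 + (v - u)) \<le> exp u * exp (v - u)"
          by (rule mult_left_mono[OF exp_ge_add_one_self]) simp
        then have "exp u - exp v \<le> exp u * (u - v)" by (simp add: exp_add[symmetric] algebra_simps)
        also have "\<dots> \<le> exp M * (u - v)" using that by (intro mult_right_mono) auto
        finally show ?thesis .
      qed
      show ?thesis
        using e1[of a b] e1[of b a] that by (cases "a \<le> b") (auto simp: abs_if)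
    qed
    have "\<bar>grad G x - grad G y\<bar> = c0 * \<bar>exp (I x) - exp (I y)\<bar>"
      unfolding g[OF x] g[OF y] right_diff_distrib[symmetric] abs_mult using c0 by simp
    also have "\<dots> \<le> c0 * (exp M * (M * \<bar>x - y\<bar>))"
      using c0 Ilip[OF y x] by (intro mult_left_mono order_trans[OF ed[OF Ib[OF x] Ib[OF y]]]) auto
    finally show "\<bar>grad G x - grad G y\<bar> \<le> (c0 * (exp M * M)) * \<bar>x - y\<bar>" by (simp add: mult.assoc)
  qed
  obtain N where N: "negligible N" "\<And>x. x \<in> {0..1} - N \<Longrightarrow>
      ((\<lambda>y. integral {0..y} (Rfun \<gamma> G)) has_real_derivative Rfun \<gamma> G x) (at x within {0..1})"
    using indefinite_integral_has_deriv_ae[OF hk] by blast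
  have dg: "(grad G has_real_derivative grad G x * Rfun \<gamma> G x) (at x within {0..1})" if x: "x \<in> {0..1} - N" for x
  proof -
    have x1: "x \<in> {0..1}" using x by auto
    have "(I has_real_derivative Rfun \<gamma> G x) (at x within {0..1})"
      by (rule has_field_derivative_transform_within[OF N(2)[OF x] zero_less_one x1]) (simp add: I_eq)
    from DERIV_cmult[OF DERIV_chain2[OF DERIV_exp this], of c0]
    have "((\<lambda>y. c0 * exp (I y)) has_real_derivative grad G x * Rfun \<gamma> G x) (at x within {0..1})"
      by (simp add: g[OF x1] mult.assoc)
    then show ?thesis
      by (rule has_field_derivative_transform_within[OF _ zero_less_one x1]) (simp add: g)
  qed
  have "AE x in lebesgue. x \<notin> N" using N(1) by (simp add: negligible_iff_null_sets AE_not_in)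
  then show "AE x in lebesgue_on {0..1}. (grad G has_real_derivative grad G x * Rfun \<gamma> G x) (at x within {0..1})"
    by (subst AE_restrict_space_iff) (auto elim!: eventually_mono intro: dg)
qed

context robin
begin

text \<open>w and its space derivative - K1 w1 are treated together because they close up: the
  derivatives of w are w1 and - K1 w1, those of - K1 w1 are - K1 w2 and w1, and w1 is again a
  solution, with time derivative w2.\<close>

lemma sol_Ck:
  "sol w \<Longrightarrow> Ck_on_strip k w \<and> (\<forall>w1. sol_deriv w w1 \<longrightarrow> Ck_on_strip k (\<lambda>t x. - K1 (w1 t) x))"
proof (induction k arbitrary: w)
  case 0
  show ?case
  proof (intro conjI allI impI)
    show "Ck_on_strip 0 w" using solD(1)[OF 0] by (simp add: scont_def)
    fix w1 assume "sol_deriv w w1"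
    then have "scont (\<lambda>t x. - K1 (w1 t) x)" by (intro scont_minus scont_K solD sol_derivD(2))
    then show "Ck_on_strip 0 (\<lambda>t x. - K1 (w1 t) x)" by (simp add: scont_def)
  qed
next
  case (Suc k)
  have sp: "sder w (\<lambda>t x. - K1 (w1 t) x)" "sder (\<lambda>t x. - K1 (w1 t) x) w1" if "sol_deriv w w1" for w w1
    using sol_space_deriv(1,2)[OF that] by (simp_all add: sder_def)
  have main: "Ck_on_strip (Suc k) w \<and> Ck_on_strip (Suc k) (\<lambda>t x. - K1 (w1 t) x)" if w1: "sol_deriv w w1" for w1
  proof
    note d = sol_derivD[OF w1]
    obtain w2 where w2: "sol_deriv w1 w2" by (rule sol_time_deriv[OF d(2)])
    note IH = Suc.IH[OF d(1)] Suc.IH[OF d(2)]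
    show "Ck_on_strip (Suc k) w"
      by (rule Ck_SucI[OF solD(1)[OF d(1)] d(3) sp(1)[OF w1]]) (use IH w1 in auto)
    have "tder (\<lambda>t x. - K1 (w1 t) x) (\<lambda>t x. - K1 (w2 t) x)"
      by (intro tder_minus K_tder(2) solD d sol_derivD[OF w2])
    then show "Ck_on_strip (Suc k) (\<lambda>t x. - K1 (w1 t) x)"
      by (rule Ck_SucI[OF scont_minus[OF scont_K(2)[OF solD(1)[OF d(2)]]] _ sp(2)[OF w1]]) (use IH w2 in auto)
  qed
  obtain w1 where "sol_deriv w w1" by (rule sol_time_deriv[OF Suc.prems])
  then show ?case using main by blast
qed

end

text \<open>The first conjunct makes the quotients and the logarithm in \<open>vfun\<close> and
  \<open>logit\<close> genuine, since division by 0 yields 0. The differentiability claim does the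
  same for \<open>lap (F 0)\<close>, which is defined by a choice operator and always has some
  value.\<close>

theorem proposition6p7:
  fixes \<alpha> \<beta> A B :: real and \<gamma> F\<gamma> :: "real \<Rightarrow> real" and F :: "real \<Rightarrow> real \<Rightarrow> real"
  assumes "0 < \<alpha>" and "\<alpha> < \<beta>" and "\<beta> < 1" and "0 < A" and "0 < B"
    and "\<gamma> \<in> M_ac"
    and "is_F \<alpha> \<beta> A B \<gamma> F\<gamma>"
    and "heat_solution \<alpha> \<beta> A B F\<gamma> F"
  shows "(\<forall>t\<ge>0. \<forall>x\<in>{0..1}. 0 < F t x \<and> F t x < 1 \<and> grad (F t) x \<noteq> 0)
    \<and> smooth_on_strip F
    \<and> (AE x in lebesgue_on {0..1}. grad (F 0) differentiable (at x within {0..1}) \<and> vfun F 0 x = \<gamma> x)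
    \<and> smooth_on_strip (vfun F)
    \<and> elliptic_system \<alpha> \<beta> A B (vfun F) F
    \<and> parabolic_system \<alpha> \<beta> A B (vfun F) (logit F)"
proof -
  interpret robin A B by unfold_locales fact+
  note G = is_F_props[OF assms(1-7)]
  have cG: "continuous_on {0..1} F\<gamma>" by (rule DERIV_continuous_on[OF G(1)])
  have F0: "F 0 x = F\<gamma> x" if "x \<in> {0..1}" for x using assms(8) that by (simp add: heat_solution_def)
  have grad0: "grad (F 0) x = grad F\<gamma> x" if "x \<in> {0..1}" for x using F0 that by (rule grad_cong)
  define c where "c = (\<beta> - \<alpha>) / (1 + A + B)"
  have c: "c * (1 + A + B) = \<beta> - \<alpha>" using S_pos by (simp add: c_def)
  \<comment> \<open>\<alpha> + c (A + x) is the stationary solution; the equation for c is its Robin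
    condition at 1.\<close>
  define w where "w t x = F t x - (\<alpha> + c * (A + x))" for t x
  have sw: "sol w" unfolding w_def[abs_def] by (rule weak_imp_sol(1)[OF c cG assms(8)])
  obtain w1 where w1: "sol_deriv w w1" by (rule sol_time_deriv[OF sw])
  obtain w2 where w2: "sol_deriv w1 w2" by (rule sol_time_deriv[OF sol_derivD(2)[OF w1]])
  have psi: "((\<lambda>x. F\<gamma> x - (\<alpha> + c * (A + x))) has_real_derivative grad F\<gamma> x - c) (at x within {0..1})"
    if "x \<in> {0..1}" for x
    using G(1)[OF that] by (auto intro!: derivative_eq_intros)
  obtain L where L: "\<And>x y. x \<in> {0..1} \<Longrightarrow> y \<in> {0..1} \<Longrightarrow> \<bar>grad F\<gamma> x - grad F\<gamma> y\<bar> \<le> L * \<bar>x - y\<bar>"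
    using G(6) by blast
  have lip: "\<bar>(grad F\<gamma> x - c) - (grad F\<gamma> y - c)\<bar> \<le> L * \<bar>x - y\<bar>" if "x \<in> {0..1}" "y \<in> {0..1}" for x y
    using L[OF that] by simp
  have b0: "grad F\<gamma> 0 - c = (F\<gamma> 0 - (\<alpha> + c * (A + 0))) / A"
    unfolding G(4) using assms(4) by (simp add: field_simps)
  have b1: "grad F\<gamma> 1 - c = - (F\<gamma> 1 - (\<alpha> + c * (A + 1))) / B"
  proof -
    have "- (F\<gamma> 1 - (\<alpha> + c * (A + 1))) = \<beta> - F\<gamma> 1 - c * B" using c by (simp add: algebra_simps)
    then show ?thesis unfolding G(5) using assms(5) by (simp add: field_simps)
  qed
  have lim: "uniform_limit {0..1} w (\<lambda>x. F\<gamma> x - (\<alpha> + c * (A + x))) (at_right 0)"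
    "uniform_limit {0..1} (\<lambda>t x. - K1 (w1 t) x) (\<lambda>x. grad F\<gamma> x - c) (at_right 0)"
    by (rule initial_layer[OF w1 psi lip b0 b1];
        use weak_imp_sol(2)[OF c cG assms(8)] in \<open>simp add: w_def[abs_def]\<close>)+
  have bounds: "\<alpha> < F t x" "F t x < \<beta>" "0 < - K1 (w1 t) x + c" if t: "0 < t" and x: "x \<in> {0..1}" for t x
  proof -
    have *: "\<And>x. x \<in> {0..1} \<Longrightarrow> \<alpha> < F\<gamma> x" "\<And>x. x \<in> {0..1} \<Longrightarrow> F\<gamma> x < \<beta>" "\<And>x. x \<in> {0..1} \<Longrightarrow> 0 < grad F\<gamma> x"
      using G(3) by auto
    show "\<alpha> < F t x" "F t x < \<beta>" "0 < - K1 (w1 t) x + c"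
      using heat_bounds[OF assms(2) w1 cG G(2) * lim[unfolded c_def] t x] by (simp_all add: w_def c_def)
  qed
  define q where "q t x = - K1 (w1 t) x + c" for t x
  define s where "s t x = - K1 (w2 t) x" for t x
  have lin: "sder (\<lambda>t x. \<alpha> + c * (A + x)) (\<lambda>_ _. c)" "tder (\<lambda>t x. \<alpha> + c * (A + x)) (\<lambda>_ _. 0)"
    by (auto simp: sder_def tder_def intro!: derivative_eq_intros)
  have sd: "sder w (\<lambda>t x. - K1 (w1 t) x)" "sder (\<lambda>t x. - K1 (w1 t) x) w1" "sder w1 s" "sder s w2"
    using sol_space_deriv(1,2)[OF w1] sol_space_deriv(1,2)[OF w2] by (simp_all add: sder_def s_def[abs_def])
  \<comment> \<open>The stationary part is affine and constant in time, so \<partial>_t F =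
    \<Delta>F = w1, and all further derivatives are those of w.\<close>
  interpret transformed F q w1 s w2
  proof
    show "0 < F t x" "F t x < 1" "q t x \<noteq> 0" if "0 < t" "x \<in> {0..1}" for t x
      using bounds[OF that] assms(1,3) by (simp_all add: q_def)
    show "sder F q"
      by (rule sder_cong[OF sder_add[OF sd(1) lin(1)]]) (simp_all add: w_def q_def)
    show "sder q w1"
      unfolding q_def[abs_def] sder_def using DERIV_add[OF sderD[OF sd(2)] DERIV_const[of c]] by simp
    show "sder w1 s" "sder s w2" by fact+
    show "tder F w1"
      by (rule tder_cong[OF tder_add[OF sol_derivD(3)[OF w1] lin(2)]]) (simp_all add: w_def)
    have "tder (\<lambda>t x. - K1 (w1 t) x) s"
      unfolding s_def[abs_def]
      by (intro tder_minus K_tder(2) solD sol_derivD(2)[OF w1] sol_derivD(2,3)[OF w2])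
    then show "tder q s"
      unfolding q_def[abs_def] tder_def using DERIV_add[OF _ DERIV_const[of c]] by fastforce
    show "tder w1 w2" by (rule sol_derivD(3)[OF w2])
  qed
  have q: "grad (F t) x = q t x" if "0 < t" "x \<in> {0..1}" for t x by (rule sder_grad[OF sF(1) that])
  have bc: "q t 0 = (F t 0 - \<alpha>) / A" "q t 1 = (\<beta> - F t 1) / B" "s t 0 = w1 t 0 / A" "s t 1 = - w1 t 1 / B"
    if t: "0 < t" for t
  proof -
    show "q t 0 = (F t 0 - \<alpha>) / A"
      unfolding q_def sol_space_deriv(3)[OF w1 t] w_def using assms(4) by (simp add: field_simps)
    have "- (F t 1 - (\<alpha> + c * (A + 1))) = \<beta> - F t 1 - c * B" using c by (simp add: algebra_simps)
    then show "q t 1 = (\<beta> - F t 1) / B"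
      unfolding q_def sol_space_deriv(4)[OF w1 t] w_def using assms(5) by (simp add: field_simps)
    show "s t 0 = w1 t 0 / A" "s t 1 = - w1 t 1 / B"
      unfolding s_def by (rule sol_space_deriv(3,4)[OF w2 t])+
  qed
  have "0 < F t x \<and> F t x < 1 \<and> grad (F t) x \<noteq> 0" if "0 \<le> t" "x \<in> {0..1}" for t x
  proof (cases "t = 0")
    case True
    then show ?thesis using F0[OF that(2)] grad0[OF that(2)] G(3)[OF that(2)] assms(1,3) by simp
  next
    case False
    then show ?thesis using F01 qnz q that by simp
  qed
  moreover have smooth: "smooth_on_strip F"
    unfolding smooth_on_strip_def
  proof
    fix k
    have "Ck_on_strip k (\<lambda>t x. w t x + ((\<alpha> + c * A) + c * x))"
      by (intro Ck_add Ck_linear conjunct1[OF sol_Ck[OF sw]])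
    then show "Ck_on_strip k F" by (rule Ck_cong[rotated]) (simp add: w_def algebra_simps)
  qed
  moreover have "AE x in lebesgue_on {0..1}. grad (F 0) differentiable (at x within {0..1}) \<and> vfun F 0 x = \<gamma> x"
    using G(7) AE_space[of "lebesgue_on {0..1::real}"]
  proof eventually_elim
    case (elim x)
    then have x: "x \<in> {0..1}" by simp
    have d: "(grad (F 0) has_real_derivative grad F\<gamma> x * Rfun \<gamma> F\<gamma> x) (at x within {0..1})"
      by (rule has_field_derivative_transform_within[OF elim(1) zero_less_one x]) (simp add: grad0)
    \<comment> \<open>Where the integral of \<open>Rfun\<close> is differentiable,
      \<Delta>F(\<gamma>) = \<nabla>F(\<gamma>) \<open>Rfun\<close>, and the formula for v solves
      this relation for \<gamma>.\<close>
    have "lap (F 0) x = grad F\<gamma> x * Rfun \<gamma> F\<gamma> x" unfolding lap_def by (rule grad_eq[OF d x])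
    then have "vfun F 0 x = F\<gamma> x + F\<gamma> x * (1 - F\<gamma> x) * (grad F\<gamma> x * Rfun \<gamma> F\<gamma> x / (grad F\<gamma> x)\<^sup>2)"
      by (simp add: vfun_def F0[OF x] grad0[OF x])
    also have "\<dots> = \<gamma> x"
      using G(3)[OF x] assms(1,3) by (simp add: Rfun_def power2_eq_square)
    finally show ?case using d by (auto simp: real_differentiable_def)
  qed
  moreover have "smooth_on_strip (vfun F)"
    by (rule smooth_vfun[OF smooth]) (use q qnz in simp)
  moreover have "elliptic_system \<alpha> \<beta> A B (vfun F) F"
    unfolding elliptic_system_def
  proof (intro allI impI conjI ballI)
    fix t :: real assume t: "0 < t"
    show "grad (F t) 0 = 1 / A * (F t 0 - \<alpha>)" "grad (F t) 1 = 1 / B * (\<beta> - F t 1)"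
      using bc(1,2)[OF t] q[OF t] by simp_all
    fix x :: real assume "x \<in> {0<..<1}"
    then have x: "x \<in> {0..1}" by simp
    show "lap (F t) x = (vfun F t x - F t x) * ((grad (F t) x)\<^sup>2 / (F t x * (1 - F t x)))"
      using F01[OF t x] qnz[OF t x] unfolding vfun_eq[OF t x] q[OF t x] by simp
  qed
  moreover have "parabolic_system \<alpha> \<beta> A B (vfun F) (logit F)"
    unfolding parabolic_system_def
  proof (intro allI impI conjI ballI)
    fix t :: real assume t: "0 < t"
    have "grad (vfun F t) 1 - 2 * sigma (vfun F t 1) * grad (logit F t) 1 = - pfun (1 - \<beta>) (- B) (vfun F t 1) (logit F t 1)"
      by (rule vfun_bdry[OF t]) (use bc(2,4)[OF t] assms(5) in \<open>simp_all add: field_simps\<close>)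
    then show "grad (vfun F t) 1 - 2 * sigma (vfun F t 1) * grad (logit F t) 1 = pfun (1 - \<beta>) B (vfun F t 1) (logit F t 1)"
      by (simp add: pfun_neg_D)
    show "grad (vfun F t) 0 - 2 * sigma (vfun F t 0) * grad (logit F t) 0 = - pfun (1 - \<alpha>) A (vfun F t 0) (logit F t 0)"
      by (rule vfun_bdry[OF t]) (use bc(1,3)[OF t] assms(4) in simp_all)
    fix x :: real assume "x \<in> {0<..<1}"
    then show "time_deriv {0<..} (vfun F) t x
        = lap (vfun F t) x - 2 * grad (\<lambda>y. sigma (vfun F t y) * grad (logit F t) y) x"
      by (intro vfun_parabolic t) simp
  qed
  ultimately show ?thesis by blast
qed

end
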